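(* For any $c\in\mathcal C$ and $x>0$, there exists a unique strong solution to $$dX_t=(X_t^\alpha-\mu X_t-c_tX_t)\,dt-\sigma X_t\,dW_t\quad (t>0),\qquad X_0=x,$$ and this solution is strictly positive a.s. (i.e. a.s. $X_t>0$ for all $t\ge0$).
   Context: Let $\Omega=\{\omega\in C([0,\infty);\mathbb R):\omega_0=0\}$, $W$ the canonical process, $\mathbb P$ the Wiener measure, and $\mathbb F=\{\mathcal F_t\}_{t\ge0}$ the $\mathbb P$-augmentation of the natural filtration of $W$. Constants: $\alpha\in(0,1)$, $\sigma>0$, $\mu>0$. $\mathcal C$ is the set of progressively measurable $c:\Omega\times[0,\infty)\to[0,\infty)$ with $\int_0^t c_s\,ds<\infty$ for all $t>0$ a.s. A strong solution is a continuous $\mathbb F$-adapted $[0,\infty)$-valued process satisfying the integrated equation for all $t\ge 0$ a.s.; uniqueness is up to indistinguishability. *)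

theory Defs
  imports "HOL-Probability.Probability"
begin

text \<open>
  A path is a function on the reals that is \<^const>\<open>undefined\<close> at negative times, so that
  continuous functions on $[0,\infty)$ correspond to exactly one element of the path space.
\<close>

definition path_space :: "(real \<Rightarrow> real) set" where
  "path_space = {\<omega> \<in> extensional {0..}. continuous_on {0..} \<omega> \<and> \<omega> 0 = 0}"

text \<open>
  The Wiener measure, on the \<open>\<sigma>\<close>-algebra generated by the coordinate maps (which is the Borel
  \<open>\<sigma>\<close>-algebra of locally uniform convergence). It is not complete; the ambient complete
  measure is \<^term>\<open>completion P\<close>.
\<close>

locale wiener_measure = prob_space P for P :: "(real \<Rightarrow> real) measure" +
  assumes space_wiener: "space P = path_space"
    and sets_wiener: "sets P = sets (restrict_space (PiM {0..} (\<lambda>_. borel)) path_space)"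
    and normal_increments:
      "\<And>s t. 0 \<le> s \<Longrightarrow> s < t \<Longrightarrow>
         distributed P lborel (\<lambda>\<omega>. \<omega> t - \<omega> s) (normal_density 0 (sqrt (t - s)))"
    and indep_increments:
      "\<And>(n::nat) \<tau>. 0 \<le> \<tau> 0 \<Longrightarrow> (\<And>i. i < n \<Longrightarrow> \<tau> i < \<tau> (Suc i)) \<Longrightarrow>
         indep_vars (\<lambda>_. borel) (\<lambda>i \<omega>. \<omega> (\<tau> (Suc i)) - \<omega> (\<tau> i)) {..<n}"

definition natural_filtration :: "real \<Rightarrow> (real \<Rightarrow> real) measure" where
  "natural_filtration t = sigma path_space
     {(\<lambda>\<omega>. \<omega> s) -` B \<inter> path_space | s B. s \<in> {0..t} \<and> B \<in> sets borel}"

definition augmented_filtration :: "(real \<Rightarrow> real) measure \<Rightarrow> real \<Rightarrow> (real \<Rightarrow> real) measure" where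
  "augmented_filtration P t =
     sigma path_space (sets (natural_filtration t) \<union> null_sets (completion P))"

definition adapted ::
  "(real \<Rightarrow> real) measure \<Rightarrow> ((real \<Rightarrow> real) \<Rightarrow> real \<Rightarrow> real) \<Rightarrow> bool" where
  "adapted P X \<longleftrightarrow> (\<forall>t\<ge>0. (\<lambda>\<omega>. X \<omega> t) \<in> borel_measurable (augmented_filtration P t))"

definition continuous_process :: "((real \<Rightarrow> real) \<Rightarrow> real \<Rightarrow> real) \<Rightarrow> bool" where
  "continuous_process X \<longleftrightarrow> (\<forall>\<omega>\<in>path_space. continuous_on {0..} (X \<omega>))"

definition progressively_measurable ::
  "(real \<Rightarrow> real) measure \<Rightarrow> ((real \<Rightarrow> real) \<Rightarrow> real \<Rightarrow> real) \<Rightarrow> bool" where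
  "progressively_measurable P H \<longleftrightarrow>
     (\<forall>t\<ge>0. (\<lambda>(\<omega>, s). H \<omega> s) \<in>
        borel_measurable (augmented_filtration P t \<Otimes>\<^sub>M restrict_space borel {0..t}))"

definition consumption_processes ::
  "(real \<Rightarrow> real) measure \<Rightarrow> ((real \<Rightarrow> real) \<Rightarrow> real \<Rightarrow> real) set" where
  "consumption_processes P = {c. progressively_measurable P c \<and>
     (\<forall>\<omega>\<in>path_space. \<forall>s\<ge>0. 0 \<le> c \<omega> s) \<and>
     (AE \<omega> in P. \<forall>t>0. (\<integral>\<^sup>+ s\<in>{0..t}. ennreal (c \<omega> s) \<partial>lborel) < \<infinity>)}"

text \<open>
  A simple integrand $\sum_{i<n} \xi_i 1_{(\tau_i,\tau_{i+1}]}$ with deterministic partition points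
  and bounded $\mathcal F_{\tau_i}$-measurable coefficients.
\<close>

definition simple_integrand ::
  "(real \<Rightarrow> real) measure \<Rightarrow> nat \<Rightarrow> (nat \<Rightarrow> real) \<Rightarrow> (nat \<Rightarrow> (real \<Rightarrow> real) \<Rightarrow> real) \<Rightarrow> bool" where
  "simple_integrand P n \<tau> \<xi> \<longleftrightarrow>
     0 \<le> \<tau> 0 \<and> (\<forall>i<n. \<tau> i < \<tau> (Suc i)) \<and>
     (\<forall>i<n. \<xi> i \<in> borel_measurable (augmented_filtration P (\<tau> i))) \<and>
     (\<exists>K. \<forall>i<n. \<forall>\<omega>\<in>path_space. \<bar>\<xi> i \<omega>\<bar> \<le> K)"

definition simple_process ::
  "nat \<Rightarrow> (nat \<Rightarrow> real) \<Rightarrow> (nat \<Rightarrow> (real \<Rightarrow> real) \<Rightarrow> real) \<Rightarrow> (real \<Rightarrow> real) \<Rightarrow> real \<Rightarrow> real" where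
  "simple_process n \<tau> \<xi> \<omega> s = (\<Sum>i<n. \<xi> i \<omega> * indicator {\<tau> i<..\<tau> (Suc i)} s)"

definition simple_integral ::
  "nat \<Rightarrow> (nat \<Rightarrow> real) \<Rightarrow> (nat \<Rightarrow> (real \<Rightarrow> real) \<Rightarrow> real) \<Rightarrow> (real \<Rightarrow> real) \<Rightarrow> real \<Rightarrow> real" where
  "simple_integral n \<tau> \<xi> \<omega> t =
     (\<Sum>i<n. \<xi> i \<omega> * (\<omega> (min (\<tau> (Suc i)) t) - \<omega> (min (\<tau> i) t)))"

text \<open>
  \<open>ito_integral P H I\<close> says that the process \<open>I\<close> is a continuous version of
  $\int_0^\cdot H_s\,dW_s$, for progressively measurable \<open>H\<close> with $\int_0^T H_s^2\,ds < \infty$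
  almost surely. The integral is the limit, in probability uniformly on compact time intervals,
  of the integrals of simple integrands $H^k$ for which $\int_0^T (H^k_s - H_s)^2\,ds$ tends to
  $0$ in probability for every \<open>T\<close>. It does not depend on the approximating sequence and is unique
  up to indistinguishability. The events below belong to the completed \<open>\<sigma>\<close>-algebra because
  \<open>H\<close> is progressively measurable and \<open>I\<close> is continuous and adapted.
\<close>

definition ito_integral ::
  "(real \<Rightarrow> real) measure \<Rightarrow> ((real \<Rightarrow> real) \<Rightarrow> real \<Rightarrow> real) \<Rightarrow>
   ((real \<Rightarrow> real) \<Rightarrow> real \<Rightarrow> real) \<Rightarrow> bool" where
  "ito_integral P H I \<longleftrightarrow>
     progressively_measurable P H \<and>
     (AE \<omega> in P. \<forall>T>0. (\<integral>\<^sup>+ s\<in>{0..T}. ennreal ((H \<omega> s)\<^sup>2) \<partial>lborel) < \<infinity>) \<and>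
     continuous_process I \<and> adapted P I \<and>
     (\<exists>n \<tau> \<xi>. (\<forall>k. simple_integrand P (n k) (\<tau> k) (\<xi> k)) \<and>
       (\<forall>T>0. \<forall>\<epsilon>>0.
         (\<lambda>k. measure (completion P) {\<omega> \<in> path_space. ennreal \<epsilon> <
            (\<integral>\<^sup>+ s\<in>{0..T}. ennreal ((simple_process (n k) (\<tau> k) (\<xi> k) \<omega> s - H \<omega> s)\<^sup>2) \<partial>lborel)})
           \<longlonglongrightarrow> 0 \<and>
         (\<lambda>k. measure (completion P) {\<omega> \<in> path_space.
            \<exists>t\<in>{0..T}. \<epsilon> < \<bar>simple_integral (n k) (\<tau> k) (\<xi> k) \<omega> t - I \<omega> t\<bar>})
           \<longlonglongrightarrow> 0))"

text \<open>
  Strong solutions of $dX_t = b(t,X_t)\,dt + a(t,X_t)\,dW_t$, $X_0 = x$, with random coefficients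
  and values in $[0,\infty)$.
\<close>

definition strong_solution ::
  "(real \<Rightarrow> real) measure \<Rightarrow> ((real \<Rightarrow> real) \<Rightarrow> real \<Rightarrow> real \<Rightarrow> real) \<Rightarrow>
   ((real \<Rightarrow> real) \<Rightarrow> real \<Rightarrow> real \<Rightarrow> real) \<Rightarrow> real \<Rightarrow> ((real \<Rightarrow> real) \<Rightarrow> real \<Rightarrow> real) \<Rightarrow> bool" where
  "strong_solution P b a x X \<longleftrightarrow>
     continuous_process X \<and> adapted P X \<and>
     (\<forall>\<omega>\<in>path_space. \<forall>t\<ge>0. 0 \<le> X \<omega> t) \<and>
     (AE \<omega> in P. \<forall>t>0. set_integrable lborel {0..t} (\<lambda>s. b \<omega> s (X \<omega> s))) \<and>
     (\<exists>I. ito_integral P (\<lambda>\<omega> s. a \<omega> s (X \<omega> s)) I \<and>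
       (AE \<omega> in P. \<forall>t\<ge>0.
          X \<omega> t = x + (LINT s:{0..t}|lborel. b \<omega> s (X \<omega> s)) + I \<omega> t))"

definition indistinguishable ::
  "(real \<Rightarrow> real) measure \<Rightarrow> ((real \<Rightarrow> real) \<Rightarrow> real \<Rightarrow> real) \<Rightarrow>
   ((real \<Rightarrow> real) \<Rightarrow> real \<Rightarrow> real) \<Rightarrow> bool" where
  "indistinguishable P X Y \<longleftrightarrow> (AE \<omega> in P. \<forall>t\<ge>0. X \<omega> t = Y \<omega> t)"

end

theory Submission
  imports Defs "HOL-Real_Asymp.Real_Asymp"
begin

text \<open>
  With $M_t = \exp(-\sigma W_t - \sigma^2 t/2)$ the substitution $X = M G$ turns the equation into
  a random Bernoulli equation for $G$, solved pathwise in closed form; this solution is positive.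
  In the absence of an Ito formula the two product rules needed, for $M G$ (existence) and for
  $Y / M$ (uniqueness), are proved on time grids. The only stochastic terms are sums of predictable
  coefficients times explicit centred functions of Gaussian increments. A maximal inequality for
  such sums bounds them in probability by their quadratic variation, which vanishes with the mesh.
  In the uniqueness part, a subsequence of the approximating simple integrals converges almost
  surely, so that all remaining terms can be treated path by path.
\<close>

section \<open>Indefinite integrals\<close>

text \<open>The Ito integral is given only through the existence of some approximating simple
  integrands. For existence they may be chosen: left-end values on a regular grid. For uniqueness
  they come with arbitrary partitions and with integrals that are close, but not equal, to the given
  one. Each partition is therefore refined, and Y is replaced on the grid by its drift part plus the
  integral of the simple integrand, so that the one-step identity is exact and its coefficients are
  known at the left end.

  No moment bounds are assumed of the solutions or of c, so the stochastic estimates are localised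
  and stated in probability. Since c is merely integrable in time, the pathwise calculus works with
  primitives that need not be differentiable everywhere.

  The power \<alpha> < 1 is not Lipschitz at 0, so uniqueness does not come from a Gronwall
  estimate. It comes from a sign: once noise and linear terms are divided out, the remaining drift
  is nonnegative, the quotient stays above x > 0, and there the equation can be integrated
  explicitly.\<close>

definition primitive :: "(real \<Rightarrow> real) \<Rightarrow> real \<Rightarrow> real" where
  "primitive f t = (LINT s:{0..t}|lborel. f s)"

lemma primitive_0 [simp]: "primitive f 0 = 0"
  unfolding primitive_def set_lebesgue_integral_def
  by (rule integral_eq_zero_AE) (rule AE_mp[OF AE_lborel_singleton[of 0]], auto simp: indicator_def)

lemma primitive_diff:
  assumes f: "set_integrable lborel {0..T} f" and st: "0 \<le> s" "s \<le> t" "t \<le> T"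
  shows "primitive f t - primitive f s = (LINT r:{s<..t}|lborel. f r)"
proof -
  have eq: "{0..t} = {0..s} \<union> {s<..t}" using st by auto
  have "primitive f t = (LINT r:{0..s}|lborel. f r) + (LINT r:{s<..t}|lborel. f r)"
    unfolding primitive_def eq
    by (rule set_integral_Un) (use st in \<open>auto intro: set_integrable_subset[OF f]\<close>)
  then show ?thesis by (simp add: primitive_def)
qed

lemma primitive_cong:
  assumes "\<And>s. 0 \<le> s \<Longrightarrow> s \<le> t \<Longrightarrow> f s = g s"
  shows "primitive f t = primitive g t"
  unfolding primitive_def by (rule set_lebesgue_integral_cong) (use assms in auto)

lemma primitive_uminus:
  assumes "set_integrable lborel {0..t} f"
  shows "primitive (\<lambda>s. - f s) t = - primitive f t"
  unfolding primitive_def by (rule set_integral_uminus[OF assms])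

lemma primitive_add:
  assumes "set_integrable lborel {0..t} f" "set_integrable lborel {0..t} g"
  shows "primitive (\<lambda>s. f s + g s) t = primitive f t + primitive g t"
  unfolding primitive_def by (rule set_integral_add[OF assms])

lemma primitive_mono:
  assumes f: "set_integrable lborel {0..T} f" and "\<And>r. 0 \<le> r \<Longrightarrow> r \<le> T \<Longrightarrow> 0 \<le> f r"
    and st: "0 \<le> s" "s \<le> t" "t \<le> T"
  shows "primitive f s \<le> primitive f t"
proof -
  have "0 \<le> (LINT r:{s<..t}|lborel. f r)"
    unfolding set_lebesgue_integral_def
    by (rule Bochner_Integration.integral_nonneg) (use assms in \<open>auto simp: indicator_def\<close>)
  then show ?thesis using primitive_diff[OF f st] by simp
qed

lemma primitive_nonneg:
  assumes "\<And>r. 0 \<le> r \<Longrightarrow> r \<le> t \<Longrightarrow> 0 \<le> f r"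
  shows "0 \<le> primitive f t"
  unfolding primitive_def set_lebesgue_integral_def
  by (rule Bochner_Integration.integral_nonneg) (use assms in \<open>auto simp: indicator_def\<close>)

lemma continuous_on_primitive_Icc:
  assumes "set_integrable lborel {0..T} f"
  shows "continuous_on {0..T} (primitive f)"
proof -
  have "continuous_on {0..T} (\<lambda>x. integral {0..x} f)"
    using set_borel_integral_eq_integral(1)[OF assms] by (rule indefinite_integral_continuous_1)
  moreover have "primitive f x = integral {0..x} f" if "x \<in> {0..T}" for x
    unfolding primitive_def
    by (rule set_borel_integral_eq_integral(2)) (rule set_integrable_subset[OF assms], use that in auto)
  ultimately show ?thesis using continuous_on_cong[of "{0..T}" "{0..T}" "primitive f" "\<lambda>x. integral {0..x} f"] by simp
qed

lemma continuous_on_Ici_real: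
  fixes f :: "real \<Rightarrow> real"
  assumes "\<And>T. 0 < T \<Longrightarrow> continuous_on {0..T} f"
  shows "continuous_on {0..} f"
  unfolding continuous_on_def
proof
  fix t :: real assume t: "t \<in> {0..}"
  have "(f \<longlongrightarrow> f t) (at t within {0..t+1})"
    using assms[of "t+1"] t by (auto simp: continuous_on_def)
  moreover have "at t within {0..t+1} = at t within {0..}"
    by (rule at_within_nhd[of _ "{..<t+1}"]) (use t in auto)
  ultimately show "(f \<longlongrightarrow> f t) (at t within {0..})" by simp
qed

lemma continuous_on_primitive:
  assumes "\<And>T. 0 < T \<Longrightarrow> set_integrable lborel {0..T} f"
  shows "continuous_on {0..} (primitive f)"
  using assms by (intro continuous_on_Ici_real continuous_on_primitive_Icc)

lemma set_integrable_Icc_continuous: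
  fixes f :: "real \<Rightarrow> real"
  assumes "continuous_on {0..T} f"
  shows "set_integrable lborel {0..T} f"
  unfolding set_integrable_def using borel_integrable_atLeastAtMost'[OF assms]
  by (simp add: set_integrable_def)

lemma set_integrable_mult_continuous:
  fixes b K :: "real \<Rightarrow> real"
  assumes b: "set_integrable lborel {0..T} b" and K: "continuous_on {0..T} K"
  shows "set_integrable lborel {0..T} (\<lambda>r. K r * b r)"
proof -
  have "bounded (K ` {0..T})" using K by (intro compact_imp_bounded compact_continuous_image) auto
  then obtain B where B: "\<And>r. r \<in> {0..T} \<Longrightarrow> \<bar>K r\<bar> \<le> B" by (force simp: bounded_iff)
  have m: "(\<lambda>r. indicator {0..T} r * K r) \<in> borel_measurable lborel"
    using borel_measurable_continuous_on_indicator[OF _ K] by simp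
  \<comment> \<open>Both functions are controlled only on \<open>{0..T}\<close>, so each factor
    carries its own copy of the indicator.\<close>
  have "(\<lambda>r. (indicator {0..T} r * K r) * (indicator {0..T} r * b r)) \<in> borel_measurable lborel"
    by (rule borel_measurable_times[OF m])
       (use borel_measurable_integrable[OF b[unfolded set_integrable_def]] in simp)
  also have "(\<lambda>r. (indicator {0..T} r * K r) * (indicator {0..T} r * b r))
      = (\<lambda>r. indicator {0..T} r *\<^sub>R (K r * b r))" by (auto simp: indicator_def)
  finally have m2: "(\<lambda>r. indicator {0..T} r *\<^sub>R (K r * b r)) \<in> borel_measurable lborel" .
  show ?thesis unfolding set_integrable_def
  proof (rule Bochner_Integration.integrable_bound[OF _ m2])
    show "integrable lborel (\<lambda>r. B * (indicator {0..T} r *\<^sub>R b r))"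
      using b by (auto simp: set_integrable_def)
    show "AE r in lborel. norm (indicator {0..T} r *\<^sub>R (K r * b r)) \<le> norm (B * (indicator {0..T} r *\<^sub>R b r))"
    proof (rule AE_I2)
      fix r
      have "\<bar>K r\<bar> * \<bar>b r\<bar> \<le> \<bar>B\<bar> * \<bar>b r\<bar>" if "r \<in> {0..T}"
        using B[OF that] by (intro mult_right_mono) auto
      then show "norm (indicator {0..T} r *\<^sub>R (K r * b r)) \<le> norm (B * (indicator {0..T} r *\<^sub>R b r))"
        by (auto simp: indicator_def abs_mult)
    qed
  qed
qed

text \<open>The error of one term of a Riemann-Stieltjes sum is measured by an increment of the
  primitive of \<open>\<bar>b r\<bar>\<close>, so that the errors telescope over a grid. A free
  number \<open>\<kappa>\<close> covers both right-end values of \<open>K\<close> and products of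
  values taken at different points.\<close>

lemma primitive_riemann_stieltjes:
  assumes b: "set_integrable lborel {0..T} b" and K: "continuous_on {0..T} K"
    and st: "0 \<le> s" "s \<le> t" "t \<le> T"
    and \<kappa>: "\<And>r. s \<le> r \<Longrightarrow> r \<le> t \<Longrightarrow> \<bar>\<kappa> - K r\<bar> \<le> e"
  shows "\<bar>\<kappa> * (primitive b t - primitive b s)
      - (primitive (\<lambda>r. K r * b r) t - primitive (\<lambda>r. K r * b r) s)\<bar>
    \<le> e * (primitive (\<lambda>r. \<bar>b r\<bar>) t - primitive (\<lambda>r. \<bar>b r\<bar>) s)"
proof -
  let ?J = "{s<..t}"
  have Kb: "set_integrable lborel {0..T} (\<lambda>r. K r * b r)"
    by (rule set_integrable_mult_continuous[OF b K])
  have sub: "?J \<subseteq> {0..T}" using st by auto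
  have b': "set_integrable lborel ?J b" and Kb': "set_integrable lborel ?J (\<lambda>r. K r * b r)"
    using set_integrable_subset[OF b _ sub] set_integrable_subset[OF Kb _ sub] by auto
  have "\<kappa> * (primitive b t - primitive b s)
      - (primitive (\<lambda>r. K r * b r) t - primitive (\<lambda>r. K r * b r) s)
      = (LINT r:?J|lborel. \<kappa> * b r - K r * b r)"
    unfolding primitive_diff[OF b st] primitive_diff[OF Kb st]
    using b' Kb' by (subst set_integral_diff) auto
  also have "\<bar>\<dots>\<bar> \<le> (LINT r:?J|lborel. \<bar>\<kappa> * b r - K r * b r\<bar>)"
    using b' Kb' set_integral_norm_bound[of lborel ?J "\<lambda>r. \<kappa> * b r - K r * b r"]
    by (auto simp: set_integral_diff)
  also have "\<dots> \<le> (LINT r:?J|lborel. e * \<bar>b r\<bar>)"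
  proof (rule set_integral_mono)
    show "set_integrable lborel ?J (\<lambda>r. \<bar>\<kappa> * b r - K r * b r\<bar>)"
      using b' Kb' by (intro set_integrable_abs set_integral_diff) auto
    show "set_integrable lborel ?J (\<lambda>r. e * \<bar>b r\<bar>)"
      using b' by (auto intro: set_integrable_abs)
    show "\<bar>\<kappa> * b r - K r * b r\<bar> \<le> e * \<bar>b r\<bar>" if "r \<in> ?J" for r
      using \<kappa>[of r] that by (auto simp: left_diff_distrib[symmetric] abs_mult intro!: mult_right_mono)
  qed
  also have "\<dots> = e * (primitive (\<lambda>r. \<bar>b r\<bar>) t - primitive (\<lambda>r. \<bar>b r\<bar>) s)"
    using primitive_diff[OF set_integrable_abs[OF b] st] by simp
  finally show ?thesis .
qed

text \<open>Over an equal subdivision of \<open>{0..T}\<close> the bounds telescope to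
  \<open>e\<close> times a fixed number, and \<open>e\<close> is arbitrary. This takes the place of
  a zero-derivative argument, since primitives of merely integrable functions need not be
  differentiable at every point.\<close>

lemma eq_of_increments_le_primitive:
  fixes f :: "real \<Rightarrow> real"
  assumes T: "0 \<le> T"
    and small: "\<And>e. 0 < e \<Longrightarrow> \<exists>d>0. \<forall>s t. 0 \<le> s \<longrightarrow> s \<le> t \<longrightarrow> t \<le> T \<longrightarrow> t - s \<le> d \<longrightarrow>
      \<bar>f t - f s\<bar> \<le> e * (primitive w t - primitive w s)"
  shows "f T = f 0"
proof -
  have "\<bar>f T - f 0\<bar> \<le> e * (\<bar>primitive w T\<bar> + 1)" if e: "e > 0" for e
  proof -
    obtain d where d: "d > 0" and D: "\<And>s t. 0 \<le> s \<Longrightarrow> s \<le> t \<Longrightarrow> t \<le> T \<Longrightarrow> t - s \<le> d \<Longrightarrow>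
      \<bar>f t - f s\<bar> \<le> e * (primitive w t - primitive w s)"
      using small[OF e] by blast
    obtain n where n: "T / d < real (Suc n)"
      by (meson lessI less_trans of_nat_less_iff reals_Archimedean2)
    define N where "N = Suc n"
    define p where "p i = T * real i / real N" for i
    have N: "N > 0" "T / real N \<le> d" using n d by (auto simp: N_def field_simps)
    have "f T - f 0 = (\<Sum>i<N. f (p (Suc i)) - f (p i))"
      by (subst sum_lessThan_telescope) (use N in \<open>simp add: p_def\<close>)
    also have "\<bar>\<dots>\<bar> \<le> (\<Sum>i<N. \<bar>f (p (Suc i)) - f (p i)\<bar>)" by (rule sum_abs)
    also have "\<dots> \<le> (\<Sum>i<N. e * (primitive w (p (Suc i)) - primitive w (p i)))"
    proof (rule sum_mono)
      fix i assume i: "i \<in> {..<N}"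
      have "real i + 1 \<le> real N" using i by auto
      then have "T * (real i + 1) \<le> T * real N" using T by (intro mult_left_mono)
      then have "p (Suc i) \<le> T" using N by (simp add: p_def pos_divide_le_eq add.commute)
      moreover have "p (Suc i) - p i = T / real N"
        by (simp add: p_def diff_divide_distrib[symmetric] algebra_simps)
      moreover have "0 \<le> p i" using T by (simp add: p_def)
      moreover have "0 \<le> T / real N" using T by simp
      ultimately show "\<bar>f (p (Suc i)) - f (p i)\<bar> \<le> e * (primitive w (p (Suc i)) - primitive w (p i))"
        using N(2) by (intro D) auto
    qed
    also have "\<dots> = e * primitive w T"
      unfolding sum_distrib_left[symmetric]
      by (subst sum_lessThan_telescope) (use N in \<open>simp add: p_def\<close>)
    also have "\<dots> \<le> e * (\<bar>primitive w T\<bar> + 1)" using e by (intro mult_left_mono) auto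
    finally show ?thesis .
  qed
  note * = this
  have "\<bar>f T - f 0\<bar> \<le> 0"
  proof (rule field_le_epsilon)
    fix e :: real assume "e > 0"
    then show "\<bar>f T - f 0\<bar> \<le> 0 + e"
      using *[of "e / (\<bar>primitive w T\<bar> + 1)"] add_nonneg_pos[of "\<bar>primitive w T\<bar>" 1] by simp
  qed
  then show ?thesis by simp
qed

lemma uniformly_continuous_Icc:
  fixes f :: "real \<Rightarrow> real"
  assumes "continuous_on {0..T} f" "0 < e"
  obtains d where "0 < d" "\<And>s t. s \<in> {0..T} \<Longrightarrow> t \<in> {0..T} \<Longrightarrow> \<bar>s - t\<bar> \<le> d \<Longrightarrow> \<bar>f s - f t\<bar> \<le> e"
proof -
  have "uniformly_continuous_on {0..T} f"
    by (rule compact_uniformly_continuous) (use assms in auto)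
  then obtain d where d: "d > 0" and D: "\<And>s t. s \<in> {0..T} \<Longrightarrow> t \<in> {0..T} \<Longrightarrow> dist t s < d \<Longrightarrow> dist (f t) (f s) < e"
    using assms(2) unfolding uniformly_continuous_on_def by metis
  show ?thesis
  proof (rule that[of "d/2"])
    fix s t assume "s \<in> {0..T}" "t \<in> {0..T}" "\<bar>s - t\<bar> \<le> d/2"
    then show "\<bar>f s - f t\<bar> \<le> e" using D[of t s] d by (auto simp: dist_real_def)
  qed (use d in auto)
qed

lemma bounded_Icc:
  fixes f :: "real \<Rightarrow> real"
  assumes "continuous_on {0..T} f"
  obtains B where "0 < B" "\<And>r. r \<in> {0..T} \<Longrightarrow> \<bar>f r\<bar> \<le> B"
proof -
  have "bounded (f ` {0..T})" using assms by (intro compact_imp_bounded compact_continuous_image) auto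
  then obtain B where "\<And>r. r \<in> {0..T} \<Longrightarrow> \<bar>f r\<bar> \<le> B" by (force simp: bounded_iff)
  then have "\<And>r. r \<in> {0..T} \<Longrightarrow> \<bar>f r\<bar> \<le> max B 1" by (meson max.coboundedI1)
  then show ?thesis using that[of "max B 1"] by (simp add: max_def)
qed

lemma grid_mono:
  fixes p :: "nat \<Rightarrow> real"
  assumes "\<And>i. i < r \<Longrightarrow> p i < p (Suc i)" "i \<le> j" "j \<le> r"
  shows "p i \<le> p j"
  using assms(2,3)
proof (induction j rule: dec_induct)
  case (step m)
  then show ?case using assms(1)[of m] by auto
qed simp

text \<open>Integrating factor rule in which the exponent is only a primitive of an integrable
  function, as is the case for the consumption rate. The difference of the two sides has increments
  that are small multiples of increments of the primitive of \<open>w\<close>, so it is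
  constant.\<close>

lemma exp_primitive_mult:
  assumes T: "0 \<le> T" and a: "set_integrable lborel {0..T} a" and u': "set_integrable lborel {0..T} u'"
    and u: "\<And>t. 0 \<le> t \<Longrightarrow> t \<le> T \<Longrightarrow> u t = u0 + primitive u' t"
  shows "exp (primitive a T) * u T = u0 + primitive (\<lambda>r. exp (primitive a r) * (u' r + a r * u r)) T"
proof -
  define E where "E r = exp (primitive a r)" for r
  define w where "w r = \<bar>u' r\<bar> + \<bar>a r\<bar>" for r
  have cA: "continuous_on {0..T} (primitive a)" by (rule continuous_on_primitive_Icc[OF a])
  have cE: "continuous_on {0..T} E" unfolding E_def by (intro continuous_intros cA)
  have "continuous_on {0..T} (\<lambda>t. u0 + primitive u' t)"
    by (intro continuous_intros continuous_on_primitive_Icc[OF u'])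
  then have cu: "continuous_on {0..T} u"
    using u continuous_on_cong[of "{0..T}" "{0..T}" u "\<lambda>t. u0 + primitive u' t"] by auto
  have cuE: "continuous_on {0..T} (\<lambda>r. u r * E r)" by (intro continuous_intros cu cE)
  have i1: "set_integrable lborel {0..T} (\<lambda>r. E r * u' r)" by (rule set_integrable_mult_continuous[OF u' cE])
  have i2: "set_integrable lborel {0..T} (\<lambda>r. u r * E r * a r)"
    by (rule set_integrable_mult_continuous[OF a cuE])
  define f where "f t = E t * u t - primitive (\<lambda>r. E r * u' r) t - primitive (\<lambda>r. u r * E r * a r) t" for t
  have "f T = f 0"
  proof (rule eq_of_increments_le_primitive[OF T, where w = w])
    fix e :: real assume e: "e > 0"
    obtain B where B: "B > 0" "\<And>r. r \<in> {0..T} \<Longrightarrow> \<bar>u r\<bar> \<le> B" using bounded_Icc[OF cu] by blast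
    obtain B' where B': "B' > 0" "\<And>r. r \<in> {0..T} \<Longrightarrow> \<bar>E r\<bar> \<le> B'" using bounded_Icc[OF cE] by blast
    \<comment> \<open>The oscillation of \<open>E\<close> enters twice: directly in the first bound,
      and multiplied by the bound \<open>B\<close> of \<open>u\<close> in the second, where only
      half of \<open>e\<close> may be spent on it.\<close>
    define e1 where "e1 = min e (e / (2 * B))"
    have e1: "e1 > 0" using e B by (auto simp: e1_def)
    obtain d1 where d1: "0 < d1" "\<And>s t. s \<in> {0..T} \<Longrightarrow> t \<in> {0..T} \<Longrightarrow> \<bar>s - t\<bar> \<le> d1 \<Longrightarrow> \<bar>E s - E t\<bar> \<le> e1"
      using uniformly_continuous_Icc[OF cE e1] by blast
    have "e / (2 * B') > 0" using e B' by auto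
    then obtain d2 where d2: "0 < d2" "\<And>s t. s \<in> {0..T} \<Longrightarrow> t \<in> {0..T} \<Longrightarrow> \<bar>s - t\<bar> \<le> d2 \<Longrightarrow> \<bar>u s - u t\<bar> \<le> e / (2 * B')"
      using uniformly_continuous_Icc[OF cu] by blast
    show "\<exists>d>0. \<forall>s t. 0 \<le> s \<longrightarrow> s \<le> t \<longrightarrow> t \<le> T \<longrightarrow> t - s \<le> d \<longrightarrow>
      \<bar>f t - f s\<bar> \<le> e * (primitive w t - primitive w s)"
    proof (intro exI[of _ "min d1 d2"] conjI allI impI)
      show "0 < min d1 d2" using d1 d2 by auto
      fix s t :: real assume st: "0 \<le> s" "s \<le> t" "t \<le> T" and d: "t - s \<le> min d1 d2"
      have b1: "\<bar>E t * (primitive u' t - primitive u' s) - (primitive (\<lambda>r. E r * u' r) t - primitive (\<lambda>r. E r * u' r) s)\<bar>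
          \<le> e * (primitive (\<lambda>r. \<bar>u' r\<bar>) t - primitive (\<lambda>r. \<bar>u' r\<bar>) s)"
      proof (rule primitive_riemann_stieltjes[OF u' cE st])
        fix r assume "s \<le> r" "r \<le> t"
        then show "\<bar>E t - E r\<bar> \<le> e" using d1(2)[of t r] st d by (auto simp: e1_def)
      qed
      \<comment> \<open>The mean value theorem is applied to \<open>exp\<close> on the range of
        \<open>primitive a\<close>; the intermediate value theorem then carries the intermediate
        point back to a time \<open>q\<close>, because \<open>primitive a\<close> itself need not be
        differentiable.\<close>
      have "\<exists>q. s \<le> q \<and> q \<le> t \<and> E t - E s = E q * (primitive a t - primitive a s)"
      proof -
        have cst: "continuous_on {s..t} (primitive a)"
          by (rule continuous_on_subset[OF cA]) (use st in auto)
        consider "primitive a s < primitive a t" | "primitive a s = primitive a t" | "primitive a t < primitive a s"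
          by linarith
        then show ?thesis
        proof cases
          case 1
          obtain z where z: "z > primitive a s" "z < primitive a t" "exp (primitive a t) - exp (primitive a s) = (primitive a t - primitive a s) * exp z"
            using MVT2[OF 1, of exp exp] by (auto intro: DERIV_exp)
          obtain q where "s \<le> q" "q \<le> t" "primitive a q = z"
            using IVT'[of "primitive a" s z t] z st cst by auto
          then show ?thesis using z by (auto simp: E_def intro!: exI[of _ q])
        next
          case 2 then show ?thesis using st by (auto simp: E_def)
        next
          case 3
          obtain z where z: "z > primitive a t" "z < primitive a s" "exp (primitive a s) - exp (primitive a t) = (primitive a s - primitive a t) * exp z"
            using MVT2[OF 3, of exp exp] by (auto intro: DERIV_exp)
          obtain q where "s \<le> q" "q \<le> t" "primitive a q = z"
            using IVT2'[of "primitive a" t z s] z st cst by auto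
          then show ?thesis using z by (auto simp: E_def algebra_simps intro!: exI[of _ q])
        qed
      qed
      then obtain q where q: "s \<le> q" "q \<le> t" "E t - E s = E q * (primitive a t - primitive a s)" by blast
      have b2: "\<bar>u s * E q * (primitive a t - primitive a s) - (primitive (\<lambda>r. u r * E r * a r) t - primitive (\<lambda>r. u r * E r * a r) s)\<bar>
          \<le> e * (primitive (\<lambda>r. \<bar>a r\<bar>) t - primitive (\<lambda>r. \<bar>a r\<bar>) s)"
      proof (rule primitive_riemann_stieltjes[OF a cuE st])
        fix r assume r: "s \<le> r" "r \<le> t"
        have "\<bar>u s * E q - u r * E r\<bar> = \<bar>u s * (E q - E r) + (u s - u r) * E r\<bar>" by (simp add: algebra_simps)
        also have "\<dots> \<le> \<bar>u s\<bar> * \<bar>E q - E r\<bar> + \<bar>u s - u r\<bar> * \<bar>E r\<bar>"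
          by (metis abs_mult abs_triangle_ineq)
        also have "\<dots> \<le> B * (e / (2 * B)) + e / (2 * B') * B'"
          using B(2)[of s] B'(2)[of r] d1(2)[of q r] d2(2)[of s r] r q st d e B B'
          by (intro add_mono mult_mono) (auto simp: e1_def)
        also have "\<dots> = e" using B B' by simp
        finally show "\<bar>u s * E q - u r * E r\<bar> \<le> e" .
      qed
      have us: "u t - u s = primitive u' t - primitive u' s" using u[of t] u[of s] st by simp
      have wt: "primitive w r = primitive (\<lambda>r. \<bar>u' r\<bar>) r + primitive (\<lambda>r. \<bar>a r\<bar>) r" if "r \<le> T" for r
        unfolding w_def
        by (rule primitive_add) (use that in \<open>auto intro!: set_integrable_abs intro: set_integrable_subset[OF u'] set_integrable_subset[OF a]\<close>)
      have "E t * u t - E s * u s = E t * (u t - u s) + u s * (E t - E s)" by (simp add: algebra_simps)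
      also have "\<dots> = E t * (primitive u' t - primitive u' s) + u s * E q * (primitive a t - primitive a s)"
        by (simp add: us q(3))
      finally have "f t - f s = (E t * (primitive u' t - primitive u' s) - (primitive (\<lambda>r. E r * u' r) t - primitive (\<lambda>r. E r * u' r) s))
        + (u s * E q * (primitive a t - primitive a s) - (primitive (\<lambda>r. u r * E r * a r) t - primitive (\<lambda>r. u r * E r * a r) s))"
        by (simp add: f_def)
      then show "\<bar>f t - f s\<bar> \<le> e * (primitive w t - primitive w s)"
        using b1 b2 wt[of t] wt[of s] st by (simp add: algebra_simps)
    qed
  qed
  moreover have "u 0 = u0" using u[of 0] T by simp
  ultimately have "E T * u T = u0 + (primitive (\<lambda>r. E r * u' r) T + primitive (\<lambda>r. u r * E r * a r) T)"
    by (simp add: f_def E_def)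
  also have "primitive (\<lambda>r. E r * u' r) T + primitive (\<lambda>r. u r * E r * a r) T
      = primitive (\<lambda>r. E r * u' r + u r * E r * a r) T"
    by (rule primitive_add[symmetric, OF i1 i2])
  also have "\<dots> = primitive (\<lambda>r. E r * (u' r + a r * u r)) T"
    by (rule primitive_cong) (simp add: algebra_simps)
  finally show ?thesis by (simp add: E_def)
qed

section \<open>The Bernoulli equation along a path\<close>

lemma primitive_has_derivative:
  assumes h: "continuous_on {0..T} h" and t: "t \<in> {0..T}"
  shows "(primitive h has_real_derivative h t) (at t within {0..T})"
proof -
  have "((\<lambda>u. integral {0..u} h) has_real_derivative h t) (at t within {0..T})"
    by (rule integral_has_real_derivative[OF h t])
  moreover have "primitive h x = integral {0..x} h" if "x \<in> {0..T}" for x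
    unfolding primitive_def
    by (rule set_borel_integral_eq_integral(2), rule set_integrable_subset[OF set_integrable_Icc_continuous[OF h]])
       (use that in auto)
  ultimately show ?thesis
    using t by (auto intro: has_field_derivative_transform_within[of _ _ _ _ 1])
qed

lemma primitive_FTC:
  assumes T: "0 \<le> T" and h: "continuous_on {0..T} h"
    and F: "\<And>t. t \<in> {0..T} \<Longrightarrow> (F has_real_derivative h t) (at t within {0..T})"
  shows "primitive h T = F T - F 0"
proof -
  have "(h has_integral F T - F 0) {0..T}"
    by (rule fundamental_theorem_of_calculus[OF T])
       (use F in \<open>auto simp: has_real_derivative_iff_has_vector_derivative\<close>)
  then show ?thesis
    unfolding primitive_def
    by (subst set_borel_integral_eq_integral(2)[OF set_integrable_Icc_continuous[OF h]])
       (auto intro: integral_unique)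
qed

locale bernoulli_ode =
  fixes \<alpha> x :: real
  assumes \<alpha>: "0 < \<alpha>" "\<alpha> < 1" and x: "0 < x"
begin

text \<open>Separation of variables for \<open>q' = d * q powr \<alpha>\<close> with
  \<open>q 0 = x\<close>: along a positive solution, \<open>q powr (1 - \<alpha>)\<close> has
  derivative \<open>(1 - \<alpha>) * d\<close>.\<close>

definition flow :: "(real \<Rightarrow> real) \<Rightarrow> real \<Rightarrow> real" where
  "flow d t = (x powr (1 - \<alpha>) + (1 - \<alpha>) * primitive d t) powr (1 / (1 - \<alpha>))"

lemma flow_0 [simp]: "flow d 0 = x"
  using \<alpha> x by (simp add: flow_def powr_powr)

context
  fixes d :: "real \<Rightarrow> real"
  assumes d: "continuous_on {0..} d" "\<And>t. 0 \<le> t \<Longrightarrow> 0 < d t"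
begin

lemma d_Icc: "continuous_on {0..T} d"
  by (rule continuous_on_subset[OF d(1)]) auto

lemma flow_base_pos: "0 \<le> t \<Longrightarrow> 0 < x powr (1 - \<alpha>) + (1 - \<alpha>) * primitive d t"
  using \<alpha> x d(2) by (intro add_pos_nonneg mult_nonneg_nonneg primitive_nonneg) (auto intro: less_imp_le)

lemma flow_pos: "0 \<le> t \<Longrightarrow> 0 < flow d t"
  using flow_base_pos[of t] by (simp add: flow_def)

lemma continuous_flow: "continuous_on {0..} (flow d)"
  unfolding flow_def using flow_base_pos
  by (intro continuous_intros continuous_on_primitive set_integrable_Icc_continuous d_Icc) (metis atLeast_iff atLeastAtMost_iff less_irrefl)

lemma flow_eq:
  assumes T: "0 \<le> T"
  shows "flow d T = x + primitive (\<lambda>s. d s * flow d s powr \<alpha>) T"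
proof -
  have "primitive (\<lambda>s. d s * flow d s powr \<alpha>) T = flow d T - flow d 0"
  proof (rule primitive_FTC[OF T])
    have "continuous_on {0..T} (flow d)" by (rule continuous_on_subset[OF continuous_flow]) auto
    moreover have "flow d t \<noteq> 0" if "t \<in> {0..T}" for t using flow_pos[of t] that by auto
    ultimately show "continuous_on {0..T} (\<lambda>s. d s * flow d s powr \<alpha>)"
      by (intro continuous_on_mult continuous_on_powr continuous_on_const d_Icc) auto
    fix t assume t: "t \<in> {0..T}"
    have p: "0 < x powr (1 - \<alpha>) + (1 - \<alpha>) * primitive d t" using flow_base_pos t by auto
    \<comment> \<open>With this exponent the outer derivative of the power becomes
      \<open>flow d t powr \<alpha>\<close>.\<close>
    have "1 / (1 - \<alpha>) - 1 = \<alpha> / (1 - \<alpha>)" using \<alpha> by (simp add: field_simps)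
    then show "(flow d has_real_derivative d t * flow d t powr \<alpha>) (at t within {0..T})"
      unfolding flow_def using \<alpha>
      by (auto intro!: derivative_eq_intros primitive_has_derivative[OF d_Icc t] p simp: powr_powr)
  qed
  then show ?thesis by simp
qed

text \<open>The integrand is nonnegative, hence \<open>q \<ge> x > 0\<close>. Away from 0 the
  function \<open>q powr (1 - \<alpha>) / (1 - \<alpha>)\<close> can be differentiated, and its
  derivative is \<open>d\<close>, which determines \<open>q\<close>.\<close>

lemma flow_unique:
  assumes q: "continuous_on {0..} q" "\<And>t. 0 \<le> t \<Longrightarrow> 0 \<le> q t"
    and eq: "\<And>t. 0 \<le> t \<Longrightarrow> q t = x + primitive (\<lambda>s. d s * q s powr \<alpha>) t"
    and T: "0 \<le> T"
  shows "q T = flow d T"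
proof -
  have qpos: "0 < q t" if "0 \<le> t" for t
    unfolding eq[OF that] using x d(2) by (intro add_pos_nonneg primitive_nonneg mult_nonneg_nonneg) (auto intro: less_imp_le)
  have cq: "continuous_on {0..T} q" by (rule continuous_on_subset[OF q(1)]) auto
  have ch: "continuous_on {0..T} (\<lambda>s. d s * q s powr \<alpha>)"
    using qpos by (intro continuous_intros d_Icc cq) (metis atLeast_iff atLeastAtMost_iff less_irrefl)
  have dq: "(q has_real_derivative d t * q t powr \<alpha>) (at t within {0..T})" if t: "t \<in> {0..T}" for t
  proof -
    have "((\<lambda>t. x + primitive (\<lambda>s. d s * q s powr \<alpha>) t) has_real_derivative d t * q t powr \<alpha>) (at t within {0..T})"
      by (auto intro!: derivative_eq_intros primitive_has_derivative[OF ch t])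
    then show ?thesis
      by (rule has_field_derivative_transform_within[of _ _ _ _ 1]) (use t eq in auto)
  qed
  have "primitive d T = q T powr (1 - \<alpha>) / (1 - \<alpha>) - q 0 powr (1 - \<alpha>) / (1 - \<alpha>)"
  proof (rule primitive_FTC[OF T d_Icc])
    fix t assume t: "t \<in> {0..T}"
    have "0 < q t" using qpos t by auto
    moreover have "q t powr (- \<alpha>) * q t powr \<alpha> = 1" using calculation by (simp add: powr_add[symmetric])
    ultimately show "((\<lambda>t. q t powr (1 - \<alpha>) / (1 - \<alpha>)) has_real_derivative d t) (at t within {0..T})"
      using \<alpha> by (auto intro!: derivative_eq_intros dq t)
  qed
  moreover have "q 0 = x" using eq[of 0] by simp
  ultimately have "x powr (1 - \<alpha>) + (1 - \<alpha>) * primitive d T = q T powr (1 - \<alpha>)"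
    using \<alpha> by (simp add: diff_divide_distrib[symmetric])
  then have "flow d T = (q T powr (1 - \<alpha>)) powr (1 / (1 - \<alpha>))" by (simp only: flow_def)
  also have "\<dots> = q T powr 1" unfolding powr_powr using \<alpha> by simp
  finally show ?thesis using qpos[OF T] by simp
qed

end


section \<open>Removing the linear drift by an integrating factor\<close>

definition damping :: "real \<Rightarrow> (real \<Rightarrow> real) \<Rightarrow> real \<Rightarrow> real" where
  "damping \<mu> c t = exp (primitive (\<lambda>s. - (\<mu> + c s)) t)"

text \<open>In the ansatz \<open>X = D * q\<close> with \<open>D = m * damping\<close>, the damping
  absorbs the linear drift and what remains is \<open>D * q' = (D * q) powr \<alpha>\<close>.
  Division by \<open>D\<close> gives the density \<open>D powr (\<alpha> - 1)\<close> fed to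
  \<open>flow\<close>. The amplitude is \<open>X / m\<close>.\<close>

definition amplitude :: "real \<Rightarrow> (real \<Rightarrow> real) \<Rightarrow> (real \<Rightarrow> real) \<Rightarrow> real \<Rightarrow> real" where
  "amplitude \<mu> c m t = damping \<mu> c t * flow (\<lambda>s. (m s * damping \<mu> c s) powr (\<alpha> - 1)) t"

context
  fixes \<mu> :: real and c m :: "real \<Rightarrow> real"
  assumes m: "continuous_on {0..} m" "\<And>t. 0 \<le> t \<Longrightarrow> 0 < m t"
    and c: "\<And>T. 0 < T \<Longrightarrow> set_integrable lborel {0..T} c"
begin

abbreviation "rate \<equiv> \<lambda>s. - (\<mu> + c s)"
abbreviation "dens \<equiv> \<lambda>s. (m s * damping \<mu> c s) powr (\<alpha> - 1)"

lemma c_nonneg_T: "0 \<le> T \<Longrightarrow> set_integrable lborel {0..T} c"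
  by (rule set_integrable_subset[OF c[of "T+1"]]) auto

lemma rate_integrable: "0 \<le> T \<Longrightarrow> set_integrable lborel {0..T} rate"
  using c_nonneg_T[of T] set_integrable_Icc_continuous[of T "\<lambda>_. \<mu>"]
  by (auto simp: set_integrable_def algebra_simps)

lemma continuous_damping: "continuous_on {0..} (damping \<mu> c)"
  unfolding damping_def by (intro continuous_intros continuous_on_primitive rate_integrable) auto

lemma damping_pos: "0 < damping \<mu> c t"
  by (simp add: damping_def)

lemma continuous_dens: "continuous_on {0..} dens"
proof -
  have ne: "m t \<noteq> 0" "damping \<mu> c t \<noteq> 0" if "0 \<le> t" for t
    using m(2)[of t] damping_pos[of t] that by auto
  show ?thesis by (intro continuous_intros m continuous_damping) (use ne in auto)
qed

lemma dens_pos: "0 \<le> t \<Longrightarrow> 0 < dens t"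
  using m(2)[of t] damping_pos[of t] by simp

lemma amplitude_0: "amplitude \<mu> c m 0 = x"
  by (simp add: amplitude_def damping_def)

lemma continuous_amplitude: "continuous_on {0..} (amplitude \<mu> c m)"
  unfolding amplitude_def
  by (intro continuous_intros continuous_damping continuous_flow continuous_dens dens_pos)

lemma amplitude_pos: "0 \<le> t \<Longrightarrow> 0 < amplitude \<mu> c m t"
  unfolding amplitude_def
  by (intro mult_pos_pos damping_pos flow_pos continuous_dens dens_pos)

text \<open>The integrating factor rule for damping times flow yields the density \<open>g\<close>.
  Since \<open>D * D powr (\<alpha> - 1) = D powr \<alpha>\<close>, multiplication by
  \<open>m\<close> turns it into the original drift evaluated at \<open>m * amplitude\<close>. These
  are the facts that the stochastic product rule for \<open>m * amplitude\<close> consumes.\<close>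

lemma amplitude_eq:
  defines "g \<equiv> \<lambda>s. damping \<mu> c s * (dens s * flow dens s powr \<alpha> + rate s * flow dens s)"
  assumes T: "0 \<le> T"
  shows "set_integrable lborel {0..T} g"
    and "amplitude \<mu> c m T = x + primitive g T"
    and "m T * g T = (m T * amplitude \<mu> c m T) powr \<alpha> - \<mu> * (m T * amplitude \<mu> c m T)
      - c T * (m T * amplitude \<mu> c m T)"
proof -
  have cf: "continuous_on {0..T} (flow dens)"
    by (rule continuous_on_subset[OF continuous_flow[OF continuous_dens dens_pos]]) auto
  have cd: "continuous_on {0..T} dens" by (rule continuous_on_subset[OF continuous_dens]) auto
  have ce: "continuous_on {0..T} (damping \<mu> c)" by (rule continuous_on_subset[OF continuous_damping]) auto
  have fp: "0 < flow dens t" if "0 \<le> t" for t by (rule flow_pos[OF continuous_dens dens_pos that])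
  have ch: "continuous_on {0..T} (\<lambda>s. dens s * flow dens s powr \<alpha>)"
    using fp by (intro continuous_on_mult cd continuous_on_powr cf continuous_on_const) (metis atLeastAtMost_iff less_irrefl)
  have ih: "set_integrable lborel {0..T} (\<lambda>s. dens s * flow dens s powr \<alpha>)"
    by (rule set_integrable_Icc_continuous[OF ch])
  have i2: "set_integrable lborel {0..T} (\<lambda>s. rate s * flow dens s)"
    using set_integrable_mult_continuous[OF rate_integrable[OF T] cf] by (simp add: mult.commute)
  show "set_integrable lborel {0..T} g"
    unfolding g_def by (rule set_integrable_mult_continuous[OF set_integral_add(1)[OF ih i2] ce])
  show "amplitude \<mu> c m T = x + primitive g T"
    unfolding amplitude_def damping_def g_def
    by (rule exp_primitive_mult[OF T rate_integrable[OF T] ih[unfolded damping_def]])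
       (rule flow_eq[OF continuous_dens dens_pos, unfolded damping_def])
  define D where "D = m T * damping \<mu> c T"
  have D: "0 < D" using m(2)[OF T] damping_pos[of T] by (simp add: D_def)
  have "m T * (damping \<mu> c T * (dens T * flow dens T powr \<alpha>)) = D * (D powr (\<alpha> - 1) * flow dens T powr \<alpha>)"
    by (simp add: D_def)
  also have "\<dots> = (D * flow dens T) powr \<alpha>"
  proof -
    have "D * D powr (\<alpha> - 1) = D powr 1 * D powr (\<alpha> - 1)" using D by simp
    also have "\<dots> = D powr \<alpha>" by (subst powr_add[symmetric]) simp
    finally show ?thesis using D fp[OF T] by (simp add: powr_mult mult.assoc[symmetric])
  qed
  finally have e: "m T * (damping \<mu> c T * (dens T * flow dens T powr \<alpha>)) = (D * flow dens T) powr \<alpha>" .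
  have "m T * g T = m T * (damping \<mu> c T * (dens T * flow dens T powr \<alpha>)) + rate T * (D * flow dens T)"
    by (simp add: g_def D_def algebra_simps)
  also have "\<dots> = (m T * amplitude \<mu> c m T) powr \<alpha> - \<mu> * (m T * amplitude \<mu> c m T)
      - c T * (m T * amplitude \<mu> c m T)"
    unfolding e by (simp add: amplitude_def D_def algebra_simps)
  finally show "m T * g T = (m T * amplitude \<mu> c m T) powr \<alpha> - \<mu> * (m T * amplitude \<mu> c m T)
      - c T * (m T * amplitude \<mu> c m T)" .
qed

text \<open>Dividing \<open>y / m\<close> by the damping as well leaves a quotient \<open>q\<close>
  that solves the separable equation, so \<open>flow_unique\<close> applies. The equation assumed
  for \<open>y / m\<close> is the one that division of a solution by the exponential martingale
  produces.\<close>

lemma amplitude_unique: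
  assumes y: "continuous_on {0..} y" "\<And>t. 0 \<le> t \<Longrightarrow> 0 \<le> y t"
    and int: "\<And>T. 0 < T \<Longrightarrow> set_integrable lborel {0..T} (\<lambda>s. y s powr \<alpha> - \<mu> * y s - c s * y s)"
    and eq: "\<And>t. 0 \<le> t \<Longrightarrow> y t / m t = x + primitive (\<lambda>s. 1 / m s * (y s powr \<alpha> - \<mu> * y s - c s * y s)) t"
    and T: "0 \<le> T"
  shows "y T = m T * amplitude \<mu> c m T"
proof -
  define q where "q t = y t / (m t * damping \<mu> c t)" for t
  have mne: "m t \<noteq> 0" if "0 \<le> t" for t using m(2)[of t] that by auto
  have dne: "damping \<mu> c t \<noteq> 0" for t using damping_pos[of t] by simp
  have pu: "exp (primitive (\<lambda>s. - rate s) r) = 1 / exp (primitive rate r)" if "0 \<le> r" for r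
    unfolding primitive_uminus[OF rate_integrable[OF that]] by (simp add: exp_minus field_simps)
  have cq: "continuous_on {0..} q"
    unfolding q_def by (intro continuous_intros y m continuous_damping) (use mne dne in auto)
  have q0: "0 \<le> q t" if "0 \<le> t" for t
    unfolding q_def using y(2)[OF that] m(2)[OF that] damping_pos[of t] by (auto intro!: divide_nonneg_pos mult_pos_pos)
  have "q t = x + primitive (\<lambda>s. dens s * q s powr \<alpha>) t" if t: "0 \<le> t" for t
  proof -
    have cm: "continuous_on {0..t} (\<lambda>s. 1 / m s)"
      using mne by (intro continuous_intros continuous_on_subset[OF m(1)]) auto
    have i0: "set_integrable lborel {0..t} (\<lambda>s. y s powr \<alpha> - \<mu> * y s - c s * y s)"
      by (rule set_integrable_subset[OF int[of "t+1"]]) (use t in auto)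
    have ir: "set_integrable lborel {0..t} (\<lambda>s. - rate s)"
      using rate_integrable[OF t] by (simp add: set_integrable_def del: minus_add_distrib)
    have "exp (primitive (\<lambda>s. - rate s) t) * (y t / m t) = x + primitive (\<lambda>r. exp (primitive (\<lambda>s. - rate s) r)
      * (1 / m r * (y r powr \<alpha> - \<mu> * y r - c r * y r) + (- rate r) * (y r / m r))) t"
      by (rule exp_primitive_mult[OF t ir set_integrable_mult_continuous[OF i0 cm] eq])
    also have "exp (primitive (\<lambda>s. - rate s) t) * (y t / m t) = q t"
      unfolding pu[OF t] by (simp add: q_def damping_def)
    also have "primitive (\<lambda>r. exp (primitive (\<lambda>s. - rate s) r)
      * (1 / m r * (y r powr \<alpha> - \<mu> * y r - c r * y r) + (- rate r) * (y r / m r))) t = primitive (\<lambda>s. dens s * q s powr \<alpha>) t"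
    proof (rule primitive_cong)
      fix r assume r: "0 \<le> r" "r \<le> t"
      define D where "D = m r * damping \<mu> c r"
      have D: "0 < D" using m(2)[OF r(1)] damping_pos[of r] by (simp add: D_def)
      \<comment> \<open>The derivative of the inverse damping contributes
        \<open>(\<mu> + c r) * (y r / m r)\<close>, which removes both linear terms.\<close>
      have "exp (primitive (\<lambda>s. - rate s) r) * (1 / m r * (y r powr \<alpha> - \<mu> * y r - c r * y r) + (- rate r) * (y r / m r))
        = 1 / (exp (primitive rate r) * m r) * y r powr \<alpha>"
        unfolding pu[OF r(1)] using m(2)[OF r(1)] by (simp add: field_simps)
      also have "\<dots> = 1 / D * y r powr \<alpha>" by (simp add: D_def damping_def mult.commute)
      also have "\<dots> = D powr (\<alpha> - 1) * (y r / D) powr \<alpha>"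
        using D y(2)[OF r(1)] by (simp add: powr_divide powr_diff)
      finally show "exp (primitive (\<lambda>s. - rate s) r) * (1 / m r * (y r powr \<alpha> - \<mu> * y r - c r * y r) + (- rate r) * (y r / m r))
        = dens r * q r powr \<alpha>" by (simp add: D_def q_def)
    qed
    finally show ?thesis .
  qed
  then have "q T = flow dens T"
    by (intro flow_unique[OF continuous_dens dens_pos cq q0 _ T])
  moreover have "y T = q T * (m T * damping \<mu> c T)"
    using m(2)[OF T] damping_pos[of T] by (simp add: q_def)
  ultimately show ?thesis by (simp add: amplitude_def)
qed

end

end

section \<open>Filtration and independence of increments\<close>

lemma measurable_coarser:
  assumes "f \<in> measurable A N" "sets A \<subseteq> sets B" "space A = space B"
  shows "f \<in> measurable B N"
  using assms by (auto simp: measurable_def)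

lemma measurable_pair_coarser:
  assumes f: "f \<in> measurable (A \<Otimes>\<^sub>M C) N" and AB: "sets A \<subseteq> sets B" "space A = space B"
  shows "f \<in> measurable (B \<Otimes>\<^sub>M C) N"
proof -
  have "(\<lambda>p. (fst p, snd p)) \<in> measurable (B \<Otimes>\<^sub>M C) (A \<Otimes>\<^sub>M C)"
    by (intro measurable_Pair measurable_snd measurable_compose[OF measurable_fst measurable_coarser[OF measurable_ident AB], simplified])
  from measurable_compose[OF this f] show ?thesis by simp
qed

lemma space_natural [simp]: "space (natural_filtration t) = path_space"
  by (simp add: natural_filtration_def space_measure_of_conv)

lemma sets_natural:
  "sets (natural_filtration t) = sigma_sets path_space
     {(\<lambda>\<omega>. \<omega> s) -` B \<inter> path_space | s B. s \<in> {0..t} \<and> B \<in> sets borel}"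
  unfolding natural_filtration_def by (rule sets_measure_of) auto

context wiener_measure
begin

abbreviation (input) "Q \<equiv> completion P"
abbreviation (input) "F \<equiv> augmented_filtration P"

text \<open>The augmented filtration contains the null sets of the completion, so adapted processes
  are measurable for the completion but in general not for \<open>P\<close>. The stochastic
  estimates are carried out there.\<close>

sublocale Q: prob_space "completion P"
proof
  have "emeasure (completion P) (space P) = 1"
    by (subst emeasure_completion) (auto simp: emeasure_space_1 main_part_sets)
  then show "emeasure (completion P) (space (completion P)) = 1" by simp
qed

lemma space_Q: "space Q = path_space"
  by (simp add: space_wiener)

lemma space_F [simp]: "space (F t) = path_space"
  by (simp add: augmented_filtration_def space_measure_of_conv)

lemma F_gen_Pow: "sets (natural_filtration t) \<union> null_sets Q \<subseteq> Pow path_space"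
  using sets.space_closed[of "natural_filtration t"] sets.space_closed[of Q] space_Q
  by (auto simp: null_sets_def)

lemma sets_F: "sets (F t) = sigma_sets path_space (sets (natural_filtration t) \<union> null_sets Q)"
  unfolding augmented_filtration_def by (rule sets_measure_of[OF F_gen_Pow])

lemma measurable_coordinate_P:
  assumes "0 \<le> s" shows "(\<lambda>\<omega>. \<omega> s) \<in> borel_measurable P"
proof -
  have "(\<lambda>\<omega>. \<omega> s) \<in> borel_measurable (restrict_space (PiM {0..} (\<lambda>_. borel)) path_space)"
    by (intro measurable_restrict_space1 measurable_component_singleton) (use assms in auto)
  then show ?thesis by (subst measurable_cong_sets[OF sets_wiener refl])
qed

lemma measurable_coordinate:
  assumes "0 \<le> s" shows "(\<lambda>\<omega>. \<omega> s) \<in> borel_measurable Q"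
  by (rule measurable_completion[OF measurable_coordinate_P[OF assms]])

lemma sets_F_Q: "sets (F t) \<subseteq> sets Q"
proof -
  have "sets (natural_filtration t) \<subseteq> sets Q"
    unfolding sets_natural space_Q[symmetric]
    by (rule sets.sigma_sets_subset) (auto intro!: measurable_sets[OF measurable_coordinate] simp del: space_completion sets_completion)
  then show ?thesis
    unfolding sets_F space_Q[symmetric]
    by (intro sets.sigma_sets_subset) (auto simp: null_sets_def)
qed

lemma sets_F_mono:
  assumes "s \<le> t" shows "sets (F s) \<subseteq> sets (F t)"
proof -
  have "sets (natural_filtration s) \<subseteq> sets (natural_filtration t)"
    unfolding sets_natural by (rule sigma_sets_mono') (use assms in force)
  then show ?thesis unfolding sets_F by (intro sigma_sets_mono') auto
qed

lemma null_sets_F: "N \<in> null_sets Q \<Longrightarrow> N \<in> sets (F t)"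
  unfolding sets_F by auto

lemma measurable_F_mono: "f \<in> measurable (F s) N \<Longrightarrow> s \<le> t \<Longrightarrow> f \<in> measurable (F t) N"
  by (erule measurable_coarser) (simp_all add: sets_F_mono)

lemma measurable_F_Q: "f \<in> measurable (F s) N \<Longrightarrow> f \<in> measurable Q N"
  by (erule measurable_coarser) (simp_all add: sets_F_Q space_wiener)

lemma measurable_coordinate_F:
  assumes "0 \<le> s" "s \<le> t" shows "(\<lambda>\<omega>. \<omega> s) \<in> borel_measurable (F t)"
proof (rule measurableI)
  fix B :: "real set" assume "B \<in> sets borel"
  then have "(\<lambda>\<omega>. \<omega> s) -` B \<inter> path_space \<in> sets (natural_filtration t)"
    unfolding sets_natural using assms by (intro sigma_sets.Basic) auto
  then show "(\<lambda>\<omega>. \<omega> s) -` B \<inter> space (F t) \<in> sets (F t)" unfolding sets_F by auto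
qed simp

text \<open>A coordinate at a time in \<open>R\<close> is a sum of increments starting at time 0,
  where all paths vanish. The first event is therefore determined by increments up to
  \<open>s\<close>, which are independent of the one after \<open>s\<close>.\<close>

lemma cylinder_indep:
  assumes st: "0 \<le> s" "s < t" and R: "finite R" "R \<subseteq> {0..s}" and B: "\<And>r. B r \<in> sets borel"
    and D: "D \<in> sets borel"
  shows "prob ({\<omega>\<in>path_space. \<forall>r\<in>R. \<omega> r \<in> B r} \<inter> ((\<lambda>\<omega>. \<omega> t - \<omega> s) -` D \<inter> path_space))
    = prob {\<omega>\<in>path_space. \<forall>r\<in>R. \<omega> r \<in> B r} * prob ((\<lambda>\<omega>. \<omega> t - \<omega> s) -` D \<inter> path_space)"
proof -
  \<comment> \<open>Adding 0 makes the coordinates telescoping sums; adding \<open>s\<close> makes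
    the last interval, the one up to \<open>t\<close>, begin exactly at \<open>s\<close>.\<close>
  define l where "l = sorted_list_of_set (insert 0 (insert s R))"
  have fin: "finite (insert 0 (insert s R))" using R by simp
  have setl: "set l = insert 0 (insert s R)" unfolding l_def by (rule set_sorted_list_of_set[OF fin])
  have sl: "sorted_wrt (<) l" unfolding l_def by (rule strict_sorted_list_of_set)
  have lne: "l \<noteq> []" using setl by auto
  define n where "n = length l - 1"
  have len: "length l = Suc n" using lne by (cases l) (auto simp: n_def)
  \<comment> \<open>There are \<open>n\<close> increments up to \<open>s\<close>; the increment from
    \<open>s\<close> to \<open>t\<close> carries the index \<open>n\<close>.\<close>
  define \<tau> where "\<tau> i = (if i \<le> n then l ! i else t)" for i
  have mono: "l ! i < l ! j" if "i < j" "j \<le> n" for i j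
    using sl that len by (simp add: sorted_wrt_iff_nth_less)
  have inl: "l ! i \<in> {0..s}" if "i \<le> n" for i
    using nth_mem[of i l] that len setl R st by auto
  have index: "\<exists>i\<le>n. l ! i = r" if "r \<in> set l" for r
    using that len by (auto simp: in_set_conv_nth less_Suc_eq_le)
  obtain i0 where i0: "i0 \<le> n" "l ! i0 = 0" using index[of 0] setl by auto
  obtain is' where is': "is' \<le> n" "l ! is' = s" using index[of s] setl by auto
  have l0: "l ! 0 = 0"
  proof (cases "i0 = 0")
    case False
    then have "l ! 0 < l ! i0" using mono[of 0 i0] i0 by auto
    then show ?thesis using inl[of 0] i0 by auto
  qed (use i0 in auto)
  have ln: "l ! n = s"
  proof (cases "is' = n")
    case False
    then have "l ! is' < l ! n" using mono[of is' n] is' by auto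
    then show ?thesis using inl[of n] is' by auto
  qed (use is' in auto)
  have \<tau>0: "\<tau> 0 = 0" using l0 by (simp add: \<tau>_def)
  have \<tau>n: "\<tau> n = s" "\<tau> (Suc n) = t" using ln by (auto simp: \<tau>_def)
  have \<tau>inc: "\<tau> i < \<tau> (Suc i)" if "i < Suc n" for i
    using mono[of i "Suc i"] that ln st by (cases "i = n") (auto simp: \<tau>_def)
  define X where "X i \<omega> = \<omega> (\<tau> (Suc i)) - \<omega> (\<tau> i)" for i and \<omega> :: "real \<Rightarrow> real"
  have "indep_vars (\<lambda>_. borel) X {..<Suc n}"
    unfolding X_def by (rule indep_increments) (use \<tau>0 \<tau>inc in auto)
  then have ind: "indep_var (PiM {..<n} (\<lambda>_. borel)) (\<lambda>\<omega>. restrict (\<lambda>i. X i \<omega>) {..<n})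
      (PiM {n} (\<lambda>_. borel)) (\<lambda>\<omega>. restrict (\<lambda>i. X i \<omega>) {n})"
    by (rule indep_var_restrict) auto
  have "\<forall>r\<in>R. \<exists>i\<le>n. l ! i = r" using index setl by auto
  then obtain k where k: "\<And>r. r \<in> R \<Longrightarrow> k r \<le> n" "\<And>r. r \<in> R \<Longrightarrow> l ! k r = r" by metis
  define A1 where "A1 = {v \<in> space (PiM {..<n} (\<lambda>_. borel :: real measure)). \<forall>r\<in>R. (\<Sum>i<k r. v i) \<in> B r}"
  define A2 where "A2 = {v \<in> space (PiM {n} (\<lambda>_. borel :: real measure)). v n \<in> D}"
  have A1: "A1 \<in> sets (PiM {..<n} (\<lambda>_. borel))"
    unfolding A1_def
  proof (rule sets.sets_Collect_finite_All[OF _ R(1)])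
    fix r assume r: "r \<in> R"
    have "(\<lambda>v. \<Sum>i<k r. v i) \<in> borel_measurable (PiM {..<n} (\<lambda>_. borel :: real measure))"
      by (intro borel_measurable_sum measurable_component_singleton) (use k(1)[OF r] in auto)
    from measurable_sets[OF this B[of r]]
    show "{v \<in> space (PiM {..<n} (\<lambda>_. borel)). (\<Sum>i<k r. v i) \<in> B r} \<in> sets (PiM {..<n} (\<lambda>_. borel))"
      by (simp add: vimage_def Int_def conj_commute)
  qed
  have A2: "A2 \<in> sets (PiM {n} (\<lambda>_. borel))"
  proof -
    have "(\<lambda>v. v n) \<in> borel_measurable (PiM {n} (\<lambda>_. borel :: real measure))"
      by (intro measurable_component_singleton) auto
    from measurable_sets[OF this D] show ?thesis
      by (simp add: A2_def vimage_def Int_def conj_commute)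
  qed
  have telescope: "(\<Sum>i<j. X i \<omega>) = \<omega> (\<tau> j)" if "\<omega> \<in> path_space" for j \<omega>
    unfolding X_def by (subst sum_lessThan_telescope) (use that \<tau>0 in \<open>auto simp: path_space_def\<close>)
  have e1: "(\<lambda>\<omega>. restrict (\<lambda>i. X i \<omega>) {..<n}) -` A1 \<inter> space P = {\<omega>\<in>path_space. \<forall>r\<in>R. \<omega> r \<in> B r}"
  proof -
    have "((\<Sum>i<k r. restrict (\<lambda>i. X i \<omega>) {..<n} i) = \<omega> r)" if "\<omega> \<in> path_space" "r \<in> R" for \<omega> r
    proof -
      have "(\<Sum>i<k r. restrict (\<lambda>i. X i \<omega>) {..<n} i) = (\<Sum>i<k r. X i \<omega>)"
        by (rule sum.cong) (use k(1)[OF that(2)] in auto)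
      then show ?thesis using telescope[OF that(1)] k[OF that(2)] by (simp add: \<tau>_def)
    qed
    then show ?thesis by (auto simp: A1_def space_wiener space_PiM)
  qed
  have e2: "(\<lambda>\<omega>. restrict (\<lambda>i. X i \<omega>) {n}) -` A2 \<inter> space P = (\<lambda>\<omega>. \<omega> t - \<omega> s) -` D \<inter> path_space"
    using \<tau>n by (auto simp: A2_def space_wiener space_PiM X_def)
  have "(\<lambda>\<omega>. (restrict (\<lambda>i. X i \<omega>) {..<n}, restrict (\<lambda>i. X i \<omega>) {n})) -` (A1 \<times> A2) \<inter> space P
    = ((\<lambda>\<omega>. restrict (\<lambda>i. X i \<omega>) {..<n}) -` A1 \<inter> space P) \<inter> ((\<lambda>\<omega>. restrict (\<lambda>i. X i \<omega>) {n}) -` A2 \<inter> space P)"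
    by auto
  then show ?thesis using indep_varD[OF ind A1 A2] e1 e2 by simp
qed

definition cylinders :: "real \<Rightarrow> (real \<Rightarrow> real) set set" where
  "cylinders s = {{\<omega>\<in>path_space. \<forall>r\<in>R. \<omega> r \<in> B r} | R B.
     finite R \<and> R \<subseteq> {0..s} \<and> (\<forall>r. B r \<in> sets (borel :: real measure))}"

lemma cylinders_sets:
  assumes "C \<in> cylinders s" shows "C \<in> sets P"
proof -
  obtain R B where R: "finite R" "R \<subseteq> {0..s}" "\<And>r. B r \<in> sets (borel :: real measure)"
    and C: "C = {\<omega>\<in>path_space. \<forall>r\<in>R. \<omega> r \<in> B r}"
    using assms by (auto simp: cylinders_def)
  show ?thesis unfolding C space_wiener[symmetric]
  proof (rule sets.sets_Collect_finite_All[OF _ R(1)])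
    fix r assume "r \<in> R"
    then show "{\<omega> \<in> space P. \<omega> r \<in> B r} \<in> sets P"
      using measurable_sets[OF measurable_coordinate_P[of r] R(3)[of r]] R(2)
      by (auto simp: vimage_def Int_def conj_commute)
  qed
qed

text \<open>Null sets are included because they are among the generators of the augmented
  filtration. Intersecting with one stays inside the family, since in the completion every subset of
  a null set is a null set.\<close>

lemma Int_stable_cylinders: "Int_stable (cylinders s \<union> null_sets Q)"
proof (rule Int_stableI)
  have cc: "a \<inter> b \<in> cylinders s" if a: "a \<in> cylinders s" and b: "b \<in> cylinders s" for a b
  proof -
    obtain R B R' B' where R: "finite R" "R \<subseteq> {0..s}" "\<And>r. B r \<in> sets (borel :: real measure)"
      and a: "a = {\<omega>\<in>path_space. \<forall>r\<in>R. \<omega> r \<in> B r}"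
      and R': "finite R'" "R' \<subseteq> {0..s}" "\<And>r. B' r \<in> sets (borel :: real measure)"
      and b: "b = {\<omega>\<in>path_space. \<forall>r\<in>R'. \<omega> r \<in> B' r}"
      using a b by (auto simp: cylinders_def)
    \<comment> \<open>A time constrained by only one of the two cylinders gets the whole line from
      the other.\<close>
    define B'' where "B'' r = (if r \<in> R then B r else UNIV) \<inter> (if r \<in> R' then B' r else UNIV)" for r
    have "a \<inter> b = {\<omega>\<in>path_space. \<forall>r\<in>R \<union> R'. \<omega> r \<in> B'' r}"
      by (auto simp: a b B''_def split: if_splits)
    moreover have "B'' r \<in> sets borel" for r using R(3) R'(3) by (auto simp: B''_def)
    moreover have "finite (R \<union> R')" "R \<union> R' \<subseteq> {0..s}" using R R' by auto
    ultimately show ?thesis unfolding cylinders_def by blast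
  qed
  fix a b assume "a \<in> cylinders s \<union> null_sets Q" "b \<in> cylinders s \<union> null_sets Q"
  then consider "a \<in> cylinders s" "b \<in> cylinders s" | "a \<in> null_sets Q" | "b \<in> null_sets Q" by blast
  then show "a \<inter> b \<in> cylinders s \<union> null_sets Q"
    by cases (use cc null_sets_completion_subset[of "a \<inter> b" a P] null_sets_completion_subset[of "a \<inter> b" b P] in blast)+
qed

text \<open>A generator on which independence from a later increment can be checked directly: on
  cylinders through finitely many increments, on null sets trivially.\<close>

lemma sets_F_cylinders: "sets (F s) = sigma_sets path_space (cylinders s \<union> null_sets Q)"
proof (rule antisym)
  have "sets (natural_filtration s) \<subseteq> sigma_sets path_space (cylinders s)"
    unfolding sets_natural
  proof (rule sigma_sets_mono, safe)
    fix r and B :: "real set" assume "r \<in> {0..s}" "B \<in> sets borel"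
    then have "{\<omega>\<in>path_space. \<forall>q\<in>{r}. \<omega> q \<in> B} \<in> cylinders s"
      unfolding cylinders_def by (intro CollectI exI[of _ "{r}"] exI[of _ "\<lambda>_. B"]) auto
    moreover have "{\<omega>\<in>path_space. \<forall>q\<in>{r}. \<omega> q \<in> B} = (\<lambda>\<omega>. \<omega> r) -` B \<inter> path_space" by auto
    ultimately show "(\<lambda>\<omega>. \<omega> r) -` B \<inter> path_space \<in> sigma_sets path_space (cylinders s)"
      by auto
  qed
  also have "\<dots> \<subseteq> sigma_sets path_space (cylinders s \<union> null_sets Q)" by (rule sigma_sets_mono') auto
  finally show "sets (F s) \<subseteq> sigma_sets path_space (cylinders s \<union> null_sets Q)"
    unfolding sets_F by (intro sigma_sets_mono) auto
  have "C \<in> sets (F s)" if "C \<in> cylinders s" for C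
  proof -
    obtain R B where R: "finite R" "R \<subseteq> {0..s}" "\<And>r. B r \<in> sets (borel :: real measure)"
      and C: "C = {\<omega>\<in>path_space. \<forall>r\<in>R. \<omega> r \<in> B r}"
      using \<open>C \<in> cylinders s\<close> by (auto simp: cylinders_def)
    have "{\<omega>\<in>space (F s). \<forall>r\<in>R. \<omega> r \<in> B r} \<in> sets (F s)"
    proof (rule sets.sets_Collect_finite_All[OF _ R(1)])
      fix r assume "r \<in> R"
      then show "{\<omega> \<in> space (F s). \<omega> r \<in> B r} \<in> sets (F s)"
        using measurable_sets[OF measurable_coordinate_F[of r s] R(3)[of r]] R(2)
        by (auto simp: vimage_def Int_def conj_commute)
    qed
    then show ?thesis by (simp add: C)
  qed
  then show "sigma_sets path_space (cylinders s \<union> null_sets Q) \<subseteq> sets (F s)"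
    using sets.sigma_sets_subset[of "cylinders s \<union> null_sets Q" "F s"] null_sets_F by auto
qed

text \<open>Independence is verified on the intersection-stable generator of cylinders and null sets
  and then extended to the generated \<sigma>-algebra. Null sets are independent of every event, so
  augmenting the filtration destroys nothing.\<close>

lemma indep_var_increment:
  fixes u :: "(real \<Rightarrow> real) \<Rightarrow> real" and \<phi> :: "real \<Rightarrow> real"
  assumes st: "0 \<le> s" "s < t" and u: "u \<in> borel_measurable (F s)" and \<phi>: "\<phi> \<in> borel_measurable borel"
  shows "Q.indep_var borel u borel (\<lambda>\<omega>. \<phi> (\<omega> t - \<omega> s))"
proof -
  define W where "W \<omega> = \<omega> t - \<omega> s" for \<omega> :: "real \<Rightarrow> real"
  have Wm: "W \<in> borel_measurable P"
    unfolding W_def using st by (intro borel_measurable_diff measurable_coordinate_P) auto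
  define G where "G = {W -` D \<inter> space Q | D. D \<in> sets borel}"
  have G: "D \<in> sets P" if "D \<in> G" for D using that Wm by (auto simp: G_def intro: measurable_sets)
  have "Q.indep_set (cylinders s \<union> null_sets Q) G"
  proof (rule Q.indep_setI)
    show "cylinders s \<union> null_sets Q \<subseteq> Q.events" using cylinders_sets by (auto simp: null_sets_def)
    show "G \<subseteq> Q.events" using G by auto
    fix a b assume a: "a \<in> cylinders s \<union> null_sets Q" and b: "b \<in> G"
    show "Q.prob (a \<inter> b) = Q.prob a * Q.prob b"
    proof (cases "a \<in> null_sets Q")
      case True
      then have "a \<inter> b \<in> null_sets Q" by (meson Int_lower1 null_sets_completion_subset)
      then show ?thesis using True by (simp add: measure_eq_0_null_sets)
    next
      case False
      then have ac: "a \<in> cylinders s" using a by auto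
      obtain D where D: "D \<in> sets borel" "b = (\<lambda>\<omega>. \<omega> t - \<omega> s) -` D \<inter> path_space"
        using b by (auto simp: G_def W_def[abs_def] space_wiener)
      have "prob (a \<inter> b) = prob a * prob b"
        using ac cylinder_indep[OF st _ _ _ D(1)] by (auto simp: cylinders_def D(2))
      then show ?thesis using cylinders_sets[OF ac] G[OF b] by simp
    qed
  qed
  moreover have "Int_stable G"
  proof (rule Int_stableI)
    fix a b assume "a \<in> G" "b \<in> G"
    then obtain D D' where "a = W -` D \<inter> space Q" "b = W -` D' \<inter> space Q" "D \<in> sets borel" "D' \<in> sets borel"
      by (auto simp: G_def)
    then have "a \<inter> b = W -` (D \<inter> D') \<inter> space Q" "D \<inter> D' \<in> sets borel" by auto
    then show "a \<inter> b \<in> G" unfolding G_def by blast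
  qed
  ultimately have ind: "Q.indep_set (sets (F s)) (sigma_sets (space Q) G)"
    using Q.indep_set_sigma_sets[OF _ Int_stable_cylinders, of s G] by (simp add: sets_F_cylinders space_wiener)
  have "Q.indep_var borel u borel W"
    unfolding Q.indep_var_eq
  proof (intro conjI)
    show "u \<in> borel_measurable Q" by (rule measurable_F_Q[OF u])
    show "W \<in> borel_measurable Q" by (rule measurable_completion[OF Wm])
    have "sigma_sets (space Q) {u -` A \<inter> space Q |A. A \<in> sets borel} \<subseteq> sets (F s)"
    proof -
      have "{u -` A \<inter> space Q |A. A \<in> sets borel} \<subseteq> sets (F s)"
        using measurable_sets[OF u] by (auto simp: space_wiener)
      from sets.sigma_sets_subset[OF this] show ?thesis by (simp add: space_wiener)
    qed
    then show "Q.indep_set (sigma_sets (space Q) {u -` A \<inter> space Q |A. A \<in> sets borel})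
      (sigma_sets (space Q) {W -` A \<inter> space Q |A. A \<in> sets borel})"
      unfolding Q.indep_set_def
      by (intro Q.indep_sets_mono_sets[OF ind[unfolded G_def Q.indep_set_def]]) (simp split: bool.split)
  qed
  from Q.indep_var_compose[OF this measurable_ident \<phi>] show ?thesis by (simp add: comp_def W_def)
qed

text \<open>The form in which independence enters the maximal inequality: next to a factor known at
  time \<open>s\<close>, a function of the later increment may be replaced by its mean.\<close>

lemma expectation_mult_increment:
  fixes u :: "(real \<Rightarrow> real) \<Rightarrow> real" and \<phi> :: "real \<Rightarrow> real"
  assumes st: "0 \<le> s" "s < t" and u: "u \<in> borel_measurable (F s)" and \<phi>: "\<phi> \<in> borel_measurable borel"
    and iu: "integrable Q u" and i\<phi>: "integrable Q (\<lambda>\<omega>. \<phi> (\<omega> t - \<omega> s))"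
  shows "integrable Q (\<lambda>\<omega>. u \<omega> * \<phi> (\<omega> t - \<omega> s))"
    and "Q.expectation (\<lambda>\<omega>. u \<omega> * \<phi> (\<omega> t - \<omega> s)) = Q.expectation u * Q.expectation (\<lambda>\<omega>. \<phi> (\<omega> t - \<omega> s))"
  using Q.indep_var_lebesgue_integral[OF indep_var_increment[OF st u \<phi>] iu i\<phi>]
    Q.indep_var_integrable[OF indep_var_increment[OF st u \<phi>] iu i\<phi>] by auto

end

section \<open>Gaussian moments\<close>

text \<open>Completing the square: an exponential weight shifts the mean of a centred Gaussian and
  keeps its variance, which reduces exponential moments to polynomial ones.\<close>

lemma exp_mult_normal_density:
  assumes "0 < \<sigma>"
  shows "exp (l * w) * normal_density 0 \<sigma> w = exp (l\<^sup>2 * \<sigma>\<^sup>2 / 2) * normal_density (l * \<sigma>\<^sup>2) \<sigma> w"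
proof -
  have "l * w + - w\<^sup>2 / (2 * \<sigma>\<^sup>2) = l\<^sup>2 * \<sigma>\<^sup>2 / 2 + - (w - l * \<sigma>\<^sup>2)\<^sup>2 / (2 * \<sigma>\<^sup>2)"
    using assms by (simp add: field_simps power2_eq_square)
  then have "exp (l * w) * exp (- w\<^sup>2 / (2 * \<sigma>\<^sup>2)) = exp (l\<^sup>2 * \<sigma>\<^sup>2 / 2) * exp (- (w - l * \<sigma>\<^sup>2)\<^sup>2 / (2 * \<sigma>\<^sup>2))"
    by (simp only: exp_add[symmetric])
  then show ?thesis by (simp add: normal_density_def)
qed

text \<open>The three functions of an increment needed below, and their squares, are sums of such
  terms, so one moment formula serves them all.\<close>

definition exp_quad :: "real \<Rightarrow> real \<Rightarrow> real \<Rightarrow> real \<Rightarrow> real \<Rightarrow> real" where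
  "exp_quad l A B C w = exp (l * w) * (A + B * w + C * w\<^sup>2)"

text \<open>The moments of order 0, 1 and 2 of a Gaussian with mean \<open>l * h\<close> and
  variance \<open>h\<close>, the law produced by the exponential weight; the prefactor is the total
  mass of the weighted law.\<close>

definition exp_quad_mean :: "real \<Rightarrow> real \<Rightarrow> real \<Rightarrow> real \<Rightarrow> real \<Rightarrow> real" where
  "exp_quad_mean l A B C h = exp (l\<^sup>2 * h / 2) * (A + B * (l * h) + C * (h + (l * h)\<^sup>2))"

lemma normal_exp_quad_moment:
  assumes "0 < \<sigma>"
  shows "has_bochner_integral lborel (\<lambda>w. normal_density 0 \<sigma> w * exp_quad l A B C w)
    (exp_quad_mean l A B C (\<sigma>\<^sup>2))"
proof -
  define m where "m = l * \<sigma>\<^sup>2"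
  let ?d = "normal_density m \<sigma>" and ?e = "exp (l\<^sup>2 * \<sigma>\<^sup>2 / 2)"
  have h0: "has_bochner_integral lborel ?d 1"
    using normal_moment_even[OF assms, of m 0] by simp
  have h1: "has_bochner_integral lborel (\<lambda>w. ?d w * (w - m)) 0"
    using normal_moment_odd[OF assms, of m 0] by simp
  have h2: "has_bochner_integral lborel (\<lambda>w. ?d w * (w - m)\<^sup>2) (\<sigma>\<^sup>2)"
    using normal_moment_even[OF assms, of m 1] assms by (simp add: fact_numeral power2_eq_square)
  \<comment> \<open>The polynomial is expanded around the shifted mean \<open>m\<close>, where the
    first central moment vanishes.\<close>
  have h: "has_bochner_integral lborel (\<lambda>w. ?e * ((A + B * m + C * m\<^sup>2) * ?d w
      + (B + 2 * C * m) * (?d w * (w - m)) + C * (?d w * (w - m)\<^sup>2)))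
    (?e * ((A + B * m + C * m\<^sup>2) * 1 + (B + 2 * C * m) * 0 + C * \<sigma>\<^sup>2))"
    by (intro has_bochner_integral_mult_right has_bochner_integral_add h0 h1 h2)
  have eq: "normal_density 0 \<sigma> w * exp_quad l A B C w = ?e * ((A + B * m + C * m\<^sup>2) * ?d w
      + (B + 2 * C * m) * (?d w * (w - m)) + C * (?d w * (w - m)\<^sup>2))" for w
  proof -
    have "normal_density 0 \<sigma> w * exp_quad l A B C w
      = (exp (l * w) * normal_density 0 \<sigma> w) * (A + B * w + C * w\<^sup>2)" by (simp add: exp_quad_def)
    also have "\<dots> = ?e * ?d w * (A + B * w + C * w\<^sup>2)"
      unfolding exp_mult_normal_density[OF assms] m_def ..
    finally show ?thesis by (simp add: algebra_simps power2_eq_square)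
  qed
  show ?thesis
    unfolding eq exp_quad_mean_def m_def[symmetric]
    by (rule has_bochner_integral_cong[THEN iffD1, OF refl refl _ h]) (simp add: algebra_simps)
qed

text \<open>The ratio of the values of the exponential martingale after and before a time step
  \<open>h\<close> with increment \<open>w\<close>, minus its Euler approximation
  \<open>1 - \<sigma> * w\<close>.\<close>

definition exp_remainder :: "real \<Rightarrow> real \<Rightarrow> real \<Rightarrow> real" where
  "exp_remainder \<sigma> h w = exp (- \<sigma> * w - \<sigma>\<^sup>2 * h / 2) - 1 + \<sigma> * w"

text \<open>The exponential is the growth factor of the inverse martingale \<open>L\<close> over a
  time step \<open>h\<close>. If \<open>Y\<close> makes the Euler step with factor
  \<open>1 - \<sigma> * w\<close>, this is the relative change of \<open>Y * L\<close>.\<close>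

definition inv_remainder :: "real \<Rightarrow> real \<Rightarrow> real \<Rightarrow> real" where
  "inv_remainder \<sigma> h w = exp (\<sigma> * w + \<sigma>\<^sup>2 * h / 2) * (1 - \<sigma> * w) - 1"

text \<open>The response of \<open>Y * L\<close>, in units of \<open>L\<close>, to a unit error in
  the integrand used for the step of \<open>Y\<close>.\<close>

definition inv_linear :: "real \<Rightarrow> real \<Rightarrow> real \<Rightarrow> real" where
  "inv_linear \<sigma> h w = exp (\<sigma> * w + \<sigma>\<^sup>2 * h / 2) * w"

context wiener_measure
begin

lemma increment_exp_quad:
  assumes st: "0 \<le> s" "s < t"
  shows "has_bochner_integral Q (\<lambda>\<omega>. exp_quad l A B C (\<omega> t - \<omega> s)) (exp_quad_mean l A B C (t - s))"
proof -
  let ?g = "exp_quad l A B C"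
  have gm: "?g \<in> borel_measurable borel" unfolding exp_quad_def by measurable
  have sq: "0 < sqrt (t - s)" "(sqrt (t - s))\<^sup>2 = t - s" using st by auto
  note d = normal_increments[OF st]
  note h = normal_exp_quad_moment[OF sq(1), of l A B C, unfolded sq(2)]
  have "integrable P (\<lambda>\<omega>. ?g (\<omega> t - \<omega> s))"
    using distributed_integrable[OF d, of ?g] gm integrable.intros[OF h] by simp
  moreover have "(\<integral>\<omega>. ?g (\<omega> t - \<omega> s) \<partial>P) = exp_quad_mean l A B C (t - s)"
    using distributed_integral[OF d, of ?g] gm has_bochner_integral_integral_eq[OF h] by simp
  moreover have m: "(\<lambda>\<omega>. ?g (\<omega> t - \<omega> s)) \<in> borel_measurable P"
    by (intro measurable_compose[OF _ gm] borel_measurable_diff measurable_coordinate_P) (use st in auto)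
  ultimately show ?thesis
    unfolding has_bochner_integral_iff
    by (simp add: integrable_completion[OF m] integral_completion[OF m])
qed

text \<open>A function with the frequencies \<open>l\<close> and 0 has a square with the frequencies
  \<open>2 * l\<close>, \<open>l\<close> and 0; hence three summands, the last one without an
  exponential.\<close>

lemma increment_exp_quad_sum:
  assumes st: "0 \<le> s" "s < t"
    and f: "\<And>w. f w = exp_quad l A B C w + exp_quad l' A' B' C' w + exp_quad 0 A'' B'' C'' w"
    and v: "exp_quad_mean l A B C (t - s) + exp_quad_mean l' A' B' C' (t - s)
      + exp_quad_mean 0 A'' B'' C'' (t - s) = v"
  shows "has_bochner_integral Q (\<lambda>\<omega>. f (\<omega> t - \<omega> s)) v"
  unfolding f v[symmetric] by (intro has_bochner_integral_add increment_exp_quad st)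

text \<open>It is centred because the exponential has mean 1. To the second moment the exponential
  contributes \<open>exp r - 1\<close>, its covariance with the linear term \<open>- 2 * r\<close>,
  and the linear term \<open>r\<close>; the first-order parts cancel, which leaves the order
  \<open>r\<^sup>2\<close>.\<close>

lemma exp_remainder_moments:
  fixes \<sigma> s t :: real
  assumes st: "0 \<le> s" "s < t"
  defines "r \<equiv> \<sigma>\<^sup>2 * (t - s)"
  shows "has_bochner_integral Q (\<lambda>\<omega>. exp_remainder \<sigma> (t - s) (\<omega> t - \<omega> s)) 0"
    and "has_bochner_integral Q (\<lambda>\<omega>. (exp_remainder \<sigma> (t - s) (\<omega> t - \<omega> s))\<^sup>2) (exp r - 1 - r)"
proof -
  have e: "exp (- \<sigma> * w - \<sigma>\<^sup>2 * (t - s) / 2) = exp (- \<sigma> * w) * exp (- r / 2)" for w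
    by (simp add: r_def mult_exp_exp)
  have e2: "exp (- 2 * \<sigma> * w) = (exp (- \<sigma> * w))\<^sup>2" "exp (- r) = (exp (- r / 2))\<^sup>2" for w
    by (simp_all add: power2_eq_square mult_exp_exp)
  have m: "exp ((- \<sigma>)\<^sup>2 * (t - s) / 2) * exp (- r / 2) = 1" "exp ((- 2 * \<sigma>)\<^sup>2 * (t - s) / 2) * exp (- r) = exp r"
    by (simp_all add: r_def mult_exp_exp power2_eq_square)
  show "has_bochner_integral Q (\<lambda>\<omega>. exp_remainder \<sigma> (t - s) (\<omega> t - \<omega> s)) 0"
  proof (rule increment_exp_quad_sum[OF st])
    show "exp_remainder \<sigma> (t - s) w = exp_quad (- \<sigma>) (exp (- r / 2)) 0 0 w + exp_quad 0 0 0 0 w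
      + exp_quad 0 (- 1) \<sigma> 0 w" for w
      unfolding exp_remainder_def exp_quad_def e by simp
  qed (use m in \<open>simp add: exp_quad_mean_def\<close>)
  show "has_bochner_integral Q (\<lambda>\<omega>. (exp_remainder \<sigma> (t - s) (\<omega> t - \<omega> s))\<^sup>2) (exp r - 1 - r)"
  proof (rule increment_exp_quad_sum[OF st])
    show "(exp_remainder \<sigma> (t - s) w)\<^sup>2 = exp_quad (- 2 * \<sigma>) (exp (- r)) 0 0 w
      + exp_quad (- \<sigma>) (- 2 * exp (- r / 2)) (2 * \<sigma> * exp (- r / 2)) 0 w
      + exp_quad 0 1 (- 2 * \<sigma>) (\<sigma>\<^sup>2) w" for w
      unfolding exp_remainder_def exp_quad_def e e2 by (simp add: power2_eq_square algebra_simps)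
    have "exp_quad_mean (- \<sigma>) (- 2 * exp (- r / 2)) (2 * \<sigma> * exp (- r / 2)) 0 (t - s)
      = exp ((- \<sigma>)\<^sup>2 * (t - s) / 2) * exp (- r / 2) * (- 2 - 2 * r)"
      by (simp add: exp_quad_mean_def r_def algebra_simps power2_eq_square)
    then show "exp_quad_mean (- 2 * \<sigma>) (exp (- r)) 0 0 (t - s)
      + exp_quad_mean (- \<sigma>) (- 2 * exp (- r / 2)) (2 * \<sigma> * exp (- r / 2)) 0 (t - s)
      + exp_quad_mean 0 1 (- 2 * \<sigma>) (\<sigma>\<^sup>2) (t - s) = exp r - 1 - r"
      unfolding m using m(2) by (simp add: exp_quad_mean_def r_def)
  qed
qed

text \<open>Neither function is centred. The mean of the remainder is \<open>- r\<^sup>2 / 2\<close>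
  to leading order, while that of the linear function is of first order in the step. Both means are
  subtracted later, and their weighted sums are estimated separately.\<close>

lemma
  fixes \<sigma> s t :: real
  assumes st: "0 \<le> s" "s < t"
  defines "r \<equiv> \<sigma>\<^sup>2 * (t - s)"
  shows inv_remainder_moments:
      "has_bochner_integral Q (\<lambda>\<omega>. inv_remainder \<sigma> (t - s) (\<omega> t - \<omega> s)) (exp r * (1 - r) - 1)"
      "has_bochner_integral Q (\<lambda>\<omega>. (inv_remainder \<sigma> (t - s) (\<omega> t - \<omega> s))\<^sup>2)
        (exp (3 * r) * ((1 - 2 * r)\<^sup>2 + r) - 2 * exp r * (1 - r) + 1)"
    and inv_linear_moments:
      "has_bochner_integral Q (\<lambda>\<omega>. inv_linear \<sigma> (t - s) (\<omega> t - \<omega> s)) (exp r * (\<sigma> * (t - s)))"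
      "has_bochner_integral Q (\<lambda>\<omega>. (inv_linear \<sigma> (t - s) (\<omega> t - \<omega> s))\<^sup>2)
        (exp (3 * r) * (1 + 4 * r) * (t - s))"
proof -
  have e: "exp (\<sigma> * w + \<sigma>\<^sup>2 * (t - s) / 2) = exp (\<sigma> * w) * exp (r / 2)" for w
    by (simp add: r_def mult_exp_exp)
  have e2: "exp (2 * \<sigma> * w) = (exp (\<sigma> * w))\<^sup>2" "exp r = (exp (r / 2))\<^sup>2" for w
    by (simp_all add: power2_eq_square mult_exp_exp)
  have m: "exp (\<sigma>\<^sup>2 * (t - s) / 2) * exp (r / 2) = exp r" "exp ((2 * \<sigma>)\<^sup>2 * (t - s) / 2) * exp r = exp (3 * r)"
    by (simp_all add: r_def mult_exp_exp power2_eq_square)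
  show "has_bochner_integral Q (\<lambda>\<omega>. inv_remainder \<sigma> (t - s) (\<omega> t - \<omega> s)) (exp r * (1 - r) - 1)"
  proof (rule increment_exp_quad_sum[OF st])
    show "inv_remainder \<sigma> (t - s) w = exp_quad \<sigma> (exp (r / 2)) (- \<sigma> * exp (r / 2)) 0 w + exp_quad 0 0 0 0 w
      + exp_quad 0 (- 1) 0 0 w" for w
      unfolding inv_remainder_def exp_quad_def e by (simp add: algebra_simps)
    have "exp_quad_mean \<sigma> (exp (r / 2)) (- \<sigma> * exp (r / 2)) 0 (t - s)
      = exp (\<sigma>\<^sup>2 * (t - s) / 2) * exp (r / 2) * (1 - r)"
      by (simp add: exp_quad_mean_def r_def algebra_simps power2_eq_square)
    then show "exp_quad_mean \<sigma> (exp (r / 2)) (- \<sigma> * exp (r / 2)) 0 (t - s) + exp_quad_mean 0 0 0 0 (t - s)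
      + exp_quad_mean 0 (- 1) 0 0 (t - s) = exp r * (1 - r) - 1"
      unfolding m by (simp add: exp_quad_mean_def)
  qed
  show "has_bochner_integral Q (\<lambda>\<omega>. (inv_remainder \<sigma> (t - s) (\<omega> t - \<omega> s))\<^sup>2)
      (exp (3 * r) * ((1 - 2 * r)\<^sup>2 + r) - 2 * exp r * (1 - r) + 1)"
  proof (rule increment_exp_quad_sum[OF st])
    show "(inv_remainder \<sigma> (t - s) w)\<^sup>2 = exp_quad (2 * \<sigma>) (exp r) (- 2 * \<sigma> * exp r) (\<sigma>\<^sup>2 * exp r) w
      + exp_quad \<sigma> (- 2 * exp (r / 2)) (2 * \<sigma> * exp (r / 2)) 0 w + exp_quad 0 1 0 0 w" for w
      unfolding inv_remainder_def exp_quad_def e e2 by (simp add: power2_eq_square algebra_simps)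
    have "exp_quad_mean (2 * \<sigma>) (exp r) (- 2 * \<sigma> * exp r) (\<sigma>\<^sup>2 * exp r) (t - s)
      = exp ((2 * \<sigma>)\<^sup>2 * (t - s) / 2) * exp r * ((1 - 2 * r)\<^sup>2 + r)"
      by (simp add: exp_quad_mean_def r_def algebra_simps power2_eq_square)
    moreover have "exp_quad_mean \<sigma> (- 2 * exp (r / 2)) (2 * \<sigma> * exp (r / 2)) 0 (t - s)
      = exp (\<sigma>\<^sup>2 * (t - s) / 2) * exp (r / 2) * (- 2 * (1 - r))"
      by (simp add: exp_quad_mean_def r_def algebra_simps power2_eq_square)
    ultimately show "exp_quad_mean (2 * \<sigma>) (exp r) (- 2 * \<sigma> * exp r) (\<sigma>\<^sup>2 * exp r) (t - s)
      + exp_quad_mean \<sigma> (- 2 * exp (r / 2)) (2 * \<sigma> * exp (r / 2)) 0 (t - s) + exp_quad_mean 0 1 0 0 (t - s)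
      = exp (3 * r) * ((1 - 2 * r)\<^sup>2 + r) - 2 * exp r * (1 - r) + 1"
      unfolding m by (simp add: exp_quad_mean_def) (simp add: algebra_simps)
  qed
  show "has_bochner_integral Q (\<lambda>\<omega>. inv_linear \<sigma> (t - s) (\<omega> t - \<omega> s)) (exp r * (\<sigma> * (t - s)))"
  proof (rule increment_exp_quad_sum[OF st])
    show "inv_linear \<sigma> (t - s) w = exp_quad \<sigma> 0 (exp (r / 2)) 0 w + exp_quad 0 0 0 0 w + exp_quad 0 0 0 0 w" for w
      unfolding inv_linear_def exp_quad_def e by simp
  qed (use m(1) in \<open>simp add: exp_quad_mean_def mult.assoc[symmetric]\<close>)
  show "has_bochner_integral Q (\<lambda>\<omega>. (inv_linear \<sigma> (t - s) (\<omega> t - \<omega> s))\<^sup>2)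
      (exp (3 * r) * (1 + 4 * r) * (t - s))"
  proof (rule increment_exp_quad_sum[OF st])
    show "(inv_linear \<sigma> (t - s) w)\<^sup>2 = exp_quad (2 * \<sigma>) 0 0 (exp r) w + exp_quad 0 0 0 0 w + exp_quad 0 0 0 0 w" for w
      unfolding inv_linear_def exp_quad_def e e2 by (simp add: power2_eq_square algebra_simps)
    have "exp_quad_mean (2 * \<sigma>) 0 0 (exp r) (t - s)
      = exp ((2 * \<sigma>)\<^sup>2 * (t - s) / 2) * exp r * ((1 + 4 * r) * (t - s))"
      by (simp add: exp_quad_mean_def r_def algebra_simps power2_eq_square)
    then show "exp_quad_mean (2 * \<sigma>) 0 0 (exp r) (t - s) + exp_quad_mean 0 0 0 0 (t - s) + exp_quad_mean 0 0 0 0 (t - s)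
      = exp (3 * r) * (1 + 4 * r) * (t - s)"
      unfolding m by (simp add: exp_quad_mean_def)
  qed
qed

end

text \<open>Taylor expansion at 0: \<open>exp r - 1 - r\<close> and the second moment of
  \<open>inv_remainder\<close> behave like \<open>r\<^sup>2 / 2\<close>, the mean of
  \<open>inv_remainder\<close> like \<open>- r\<^sup>2 / 2\<close>, and the last two expressions
  tend to 1. The constants 1 and 2 in the bounds leave room on a neighbourhood of 0.\<close>

lemma small_moment_bounds:
  obtains \<rho> :: real where "0 < \<rho>"
    and "\<And>r. 0 < r \<Longrightarrow> r < \<rho> \<Longrightarrow> exp r - 1 - r \<le> r\<^sup>2"
    and "\<And>r. 0 < r \<Longrightarrow> r < \<rho> \<Longrightarrow> \<bar>exp r * (1 - r) - 1\<bar> \<le> r\<^sup>2"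
    and "\<And>r. 0 < r \<Longrightarrow> r < \<rho> \<Longrightarrow> exp (3 * r) * ((1 - 2 * r)\<^sup>2 + r) - 2 * exp r * (1 - r) + 1 \<le> r\<^sup>2"
    and "\<And>r. 0 < r \<Longrightarrow> r < \<rho> \<Longrightarrow> exp r \<le> 2"
    and "\<And>r. 0 < r \<Longrightarrow> r < \<rho> \<Longrightarrow> exp (3 * r) * (1 + 4 * r) \<le> 2"
proof -
  have "\<forall>\<^sub>F r::real in at_right 0. exp r - 1 - r \<le> r\<^sup>2" by real_asymp
  moreover have "\<forall>\<^sub>F r::real in at_right 0. exp r * (1 - r) - 1 \<le> r\<^sup>2" by real_asymp
  moreover have "\<forall>\<^sub>F r::real in at_right 0. - (exp r * (1 - r) - 1) \<le> r\<^sup>2" by real_asymp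
  moreover have "\<forall>\<^sub>F r::real in at_right 0. exp (3 * r) * ((1 - 2 * r)\<^sup>2 + r) - 2 * exp r * (1 - r) + 1 \<le> r\<^sup>2"
    by real_asymp
  moreover have "\<forall>\<^sub>F r::real in at_right 0. exp r \<le> 2" by real_asymp
  moreover have "\<forall>\<^sub>F r::real in at_right 0. exp (3 * r) * (1 + 4 * r) \<le> 2" by real_asymp
  ultimately have "\<forall>\<^sub>F r::real in at_right 0. exp r - 1 - r \<le> r\<^sup>2 \<and> \<bar>exp r * (1 - r) - 1\<bar> \<le> r\<^sup>2 \<and>
    exp (3 * r) * ((1 - 2 * r)\<^sup>2 + r) - 2 * exp r * (1 - r) + 1 \<le> r\<^sup>2 \<and>
    exp r \<le> 2 \<and> exp (3 * r) * (1 + 4 * r) \<le> 2"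
    by eventually_elim (simp add: abs_le_iff)
  then obtain \<rho> :: real where "0 < \<rho>" "\<And>r. 0 < r \<Longrightarrow> r < \<rho> \<Longrightarrow> exp r - 1 - r \<le> r\<^sup>2 \<and> \<bar>exp r * (1 - r) - 1\<bar> \<le> r\<^sup>2 \<and>
    exp (3 * r) * ((1 - 2 * r)\<^sup>2 + r) - 2 * exp r * (1 - r) + 1 \<le> r\<^sup>2 \<and>
    exp r \<le> 2 \<and> exp (3 * r) * (1 + 4 * r) \<le> 2"
    unfolding eventually_at_right_field by auto
  then show ?thesis by (intro that[of \<rho>]) blast+
qed

section \<open>A maximal inequality\<close>

context wiener_measure
begin

lemma increment_measurable_F:
  assumes "0 \<le> s" "s \<le> t" "\<phi> \<in> borel_measurable borel"
  shows "(\<lambda>\<omega>. \<phi> (\<omega> t - \<omega> s)) \<in> borel_measurable (F t)"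
  by (intro measurable_compose[OF _ assms(3)] borel_measurable_diff measurable_coordinate_F) (use assms in auto)

text \<open>
  Stopping the sum before either the quadratic variation or the sum itself becomes large leaves a
  square integrable martingale, so only Chebyshev's inequality is needed.
\<close>

lemma martingale_sum_maximal:
  fixes \<tau> v :: "nat \<Rightarrow> real" and a :: "nat \<Rightarrow> (real \<Rightarrow> real) \<Rightarrow> real" and \<phi> :: "nat \<Rightarrow> real \<Rightarrow> real"
  assumes \<tau>: "0 \<le> \<tau> 0" "\<And>i. i < n \<Longrightarrow> \<tau> i < \<tau> (Suc i)"
    and a: "\<And>i. i < n \<Longrightarrow> a i \<in> borel_measurable (F (\<tau> i))"
    and \<phi>: "\<And>i. i < n \<Longrightarrow> \<phi> i \<in> borel_measurable borel"
    and m1: "\<And>i. i < n \<Longrightarrow> has_bochner_integral Q (\<lambda>\<omega>. \<phi> i (\<omega> (\<tau> (Suc i)) - \<omega> (\<tau> i))) 0"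
    and m2: "\<And>i. i < n \<Longrightarrow> integrable Q (\<lambda>\<omega>. (\<phi> i (\<omega> (\<tau> (Suc i)) - \<omega> (\<tau> i)))\<^sup>2)"
      "\<And>i. i < n \<Longrightarrow> Q.expectation (\<lambda>\<omega>. (\<phi> i (\<omega> (\<tau> (Suc i)) - \<omega> (\<tau> i)))\<^sup>2) \<le> v i"
    and v: "\<And>i. i < n \<Longrightarrow> 0 < v i"
    and \<epsilon>: "0 < \<epsilon>" and \<delta>: "0 < \<delta>"
  shows "Q.prob {\<omega>\<in>path_space. \<exists>j\<le>n. \<epsilon> < \<bar>\<Sum>i<j. a i \<omega> * \<phi> i (\<omega> (\<tau> (Suc i)) - \<omega> (\<tau> i))\<bar>}
    \<le> Q.prob {\<omega>\<in>path_space. \<delta> < (\<Sum>i<n. (a i \<omega>)\<^sup>2 * v i)} + \<delta> / \<epsilon>\<^sup>2"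
proof -
  define \<zeta> where "\<zeta> i \<omega> = \<phi> i (\<omega> (\<tau> (Suc i)) - \<omega> (\<tau> i))" for i \<omega>
  define S where "S j \<omega> = (\<Sum>i<j. a i \<omega> * \<zeta> i \<omega>)" for j \<omega>
  define V where "V j \<omega> = (\<Sum>i<j. (a i \<omega>)\<^sup>2 * v i)" for j \<omega>
  \<comment> \<open>\<open>V\<close> is taken one index further than \<open>S\<close> because
    \<open>a j\<close> is known at time \<open>\<tau> j\<close> while the increment with index
    \<open>j\<close> is not. Thus \<open>ok j\<close> is an event of the past at
    \<open>\<tau> j\<close>, and the stopping acts before the quadratic variation exceeds
    \<open>\<delta>\<close>.\<close>
  define ok where "ok j \<omega> \<longleftrightarrow> (\<forall>l\<in>{..j}. \<bar>S l \<omega>\<bar> \<le> \<epsilon>) \<and> V (Suc j) \<omega> \<le> \<delta>" for j \<omega>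
  define b where "b j \<omega> = (if ok j \<omega> then a j \<omega> else 0)" for j \<omega>
  define S' where "S' j \<omega> = (\<Sum>i<j. b i \<omega> * \<zeta> i \<omega>)" for j \<omega>
  have \<tau>_mono: "\<tau> i \<le> \<tau> j" if "i \<le> j" "j \<le> n" for i j
    by (rule grid_mono[of n \<tau>, OF \<tau>(2) that])
  have \<tau>_nonneg: "0 \<le> \<tau> i" if "i \<le> n" for i using \<tau>_mono[of 0 i] \<tau>(1) that by auto
  have \<zeta>m: "\<zeta> i \<in> borel_measurable (F (\<tau> j))" if "i < j" "j \<le> n" for i j
  proof -
    have "\<zeta> i \<in> borel_measurable (F (\<tau> (Suc i)))"
      unfolding \<zeta>_def[abs_def]
      by (intro increment_measurable_F \<phi> \<tau>_nonneg) (use that \<tau>(2)[of i] in auto)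
    then show ?thesis using \<tau>_mono[of "Suc i" j] that by (auto intro: measurable_F_mono)
  qed
  have am: "a i \<in> borel_measurable (F (\<tau> j))" if "i \<le> j" "j < n" for i j
    using measurable_F_mono[OF a[of i] \<tau>_mono[of i j]] that by auto
  have am': "a i \<in> borel_measurable (F (\<tau> j))" if "i < j" "j \<le> n" for i j
    using measurable_F_mono[OF a[of i] \<tau>_mono[of i j]] that by auto
  have Sm: "S j \<in> borel_measurable (F (\<tau> k))" if "j \<le> k" "k \<le> n" for j k
    unfolding S_def[abs_def]
    by (intro borel_measurable_sum borel_measurable_times \<zeta>m am') (use that in auto)
  have Vm: "V (Suc j) \<in> borel_measurable (F (\<tau> j))" if "j < n" for j
    unfolding V_def[abs_def]
    by (intro borel_measurable_sum borel_measurable_times borel_measurable_power borel_measurable_const am) (use that in auto)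
  have okm: "{\<omega>\<in>space (F (\<tau> j)). ok j \<omega>} \<in> sets (F (\<tau> j))" if j: "j < n" for j
    unfolding ok_def
  proof (intro sets.sets_Collect_conj sets.sets_Collect_finite_All)
    show "{x \<in> space (F (\<tau> j)). \<bar>S i x\<bar> \<le> \<epsilon>} \<in> sets (F (\<tau> j))" if "i \<in> {..j}" for i
      using Sm[of i j] that j by (intro borel_measurable_le borel_measurable_abs borel_measurable_const) auto
    show "{x \<in> space (F (\<tau> j)). V (Suc j) x \<le> \<delta>} \<in> sets (F (\<tau> j))"
      by (intro borel_measurable_le Vm borel_measurable_const j)
  qed auto
  have bm: "b j \<in> borel_measurable (F (\<tau> j))" if "j < n" for j
    unfolding b_def[abs_def] by (intro measurable_If okm a borel_measurable_const that)
  have bmQ: "b j \<in> borel_measurable Q" if "j < n" for j by (rule measurable_F_Q[OF bm[OF that]])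
  have V_mono: "V i \<omega> \<le> V j \<omega>" if "i \<le> j" "j \<le> n" for i j \<omega>
    unfolding V_def by (rule sum_mono2) (use that less_imp_le[OF v] in \<open>auto intro!: mult_nonneg_nonneg\<close>)
  have ok_mono: "ok i \<omega>" if "ok j \<omega>" "i \<le> j" "j < n" for i j \<omega>
    using that V_mono[of "Suc i" "Suc j" \<omega>] by (auto simp: ok_def)
  have S'_S: "S' j \<omega> = S j \<omega>" if "ok j \<omega>" "j < n" for j \<omega>
    unfolding S'_def S_def
    by (rule sum.cong) (use ok_mono[OF that(1) _ that(2)] in \<open>auto simp: b_def\<close>)
  \<comment> \<open>Where \<open>b j\<close> is nonzero, the sum has not yet left the band of width
    \<open>\<epsilon>\<close>. This makes the cross term integrable without moment assumptions on
    \<open>a\<close>.\<close>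
  have S'b: "\<bar>S' j \<omega> * b j \<omega>\<bar> \<le> \<epsilon> * \<bar>b j \<omega>\<bar>" if "j < n" for j \<omega>
    using S'_S[of j \<omega>] that by (auto simp: b_def ok_def abs_mult intro!: mult_right_mono)
  have bV: "(b j \<omega>)\<^sup>2 * v j \<le> \<delta>" if "j < n" for j \<omega>
  proof (cases "ok j \<omega>")
    case True
    have "0 \<le> V j \<omega>" using V_mono[of 0 j \<omega>] that by (simp add: V_def)
    then show ?thesis using True by (simp add: b_def ok_def V_def)
  qed (use \<delta> in \<open>simp add: b_def\<close>)
  \<comment> \<open>Since \<open>v j\<close> is positive, the bound on the stopped quadratic
    variation also bounds each stopped coefficient.\<close>
  have b_bd: "\<bar>b j \<omega>\<bar> \<le> sqrt (\<delta> / v j)" if "j < n" for j \<omega>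
    using bV[OF that, of \<omega>] v[OF that] by (intro real_le_rsqrt) (simp add: field_simps)
  have ib: "integrable Q (b j)" if "j < n" for j
    by (rule Q.integrable_const_bound[where B = "sqrt (\<delta> / v j)"]) (use b_bd bmQ that in auto)
  have ib2: "integrable Q (\<lambda>\<omega>. (b j \<omega>)\<^sup>2)" if "j < n" for j
  proof (rule Q.integrable_const_bound[where B = "\<delta> / v j"])
    show "AE x in Q. norm ((b j x)\<^sup>2) \<le> \<delta> / v j" using bV[OF that] v[OF that] by (auto simp: field_simps)
    show "(\<lambda>\<omega>. (b j \<omega>)\<^sup>2) \<in> borel_measurable Q" by (intro borel_measurable_power bmQ that)
  qed
  have S'm: "S' j \<in> borel_measurable (F (\<tau> k))" if "j \<le> k" "k \<le> n" for j k
    unfolding S'_def[abs_def]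
  proof (intro borel_measurable_sum borel_measurable_times)
    fix i assume i: "i \<in> {..<j}"
    show "b i \<in> borel_measurable (F (\<tau> k))" using measurable_F_mono[OF bm[of i] \<tau>_mono[of i k]] i that by auto
    show "\<zeta> i \<in> borel_measurable (F (\<tau> k))" using \<zeta>m[of i k] i that by auto
  qed
  have iSb: "integrable Q (\<lambda>\<omega>. S' j \<omega> * b j \<omega>)" if "j < n" for j
  proof (rule Bochner_Integration.integrable_bound[where f = "\<lambda>\<omega>. \<epsilon> * \<bar>b j \<omega>\<bar>"])
    show "integrable Q (\<lambda>\<omega>. \<epsilon> * \<bar>b j \<omega>\<bar>)" using ib[OF that] by simp
    show "(\<lambda>\<omega>. S' j \<omega> * b j \<omega>) \<in> borel_measurable Q"
      by (intro borel_measurable_times bmQ that measurable_F_Q[OF S'm[of j j]]) (use that in auto)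
    show "AE x in Q. norm (S' j x * b j x) \<le> norm (\<epsilon> * \<bar>b j x\<bar>)"
      using S'b[OF that] \<epsilon> by (simp add: abs_mult)
  qed
  \<comment> \<open>Orthogonality of the increments: \<open>S' j * b j\<close> belongs to the past
    at \<open>\<tau> j\<close> and the function of the next increment is centred, so the mixed term
    has mean zero.\<close>
  have second: "integrable Q (\<lambda>\<omega>. (S' j \<omega>)\<^sup>2) \<and>
      Q.expectation (\<lambda>\<omega>. (S' j \<omega>)\<^sup>2) \<le> Q.expectation (\<lambda>\<omega>. \<Sum>i<j. (b i \<omega>)\<^sup>2 * v i)" if "j \<le> n" for j
    using that
  proof (induction j)
    case 0 then show ?case by (simp add: S'_def)
  next
    case (Suc j)
    then have j: "j < n" and IH: "integrable Q (\<lambda>\<omega>. (S' j \<omega>)\<^sup>2)"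
      "Q.expectation (\<lambda>\<omega>. (S' j \<omega>)\<^sup>2) \<le> Q.expectation (\<lambda>\<omega>. \<Sum>i<j. (b i \<omega>)\<^sup>2 * v i)" by auto
    note st = \<tau>_nonneg[of j] \<tau>(2)[OF j]
    have st0: "0 \<le> \<tau> j" using st(1) j by simp
    have Sbm: "(\<lambda>\<omega>. S' j \<omega> * b j \<omega>) \<in> borel_measurable (F (\<tau> j))"
      using S'm[of j j] bm[OF j] j by (intro borel_measurable_times) auto
    have i\<zeta>: "integrable Q (\<lambda>\<omega>. \<phi> j (\<omega> (\<tau> (Suc j)) - \<omega> (\<tau> j)))"
      using m1[OF j] by (rule integrable.intros)
    note c1 = expectation_mult_increment[OF st0 st(2) Sbm \<phi>[OF j] iSb[OF j] i\<zeta>]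
    have cross: "Q.expectation (\<lambda>\<omega>. S' j \<omega> * b j \<omega> * \<zeta> j \<omega>) = 0" "integrable Q (\<lambda>\<omega>. S' j \<omega> * b j \<omega> * \<zeta> j \<omega>)"
      using c1 has_bochner_integral_integral_eq[OF m1[OF j]] by (simp_all add: \<zeta>_def)
    have b2m: "(\<lambda>\<omega>. (b j \<omega>)\<^sup>2) \<in> borel_measurable (F (\<tau> j))" by (intro borel_measurable_power bm j)
    have \<phi>2: "(\<lambda>w. (\<phi> j w)\<^sup>2) \<in> borel_measurable borel" by (intro borel_measurable_power \<phi> j)
    note c2 = expectation_mult_increment[OF st0 st(2) b2m \<phi>2 ib2[OF j] m2(1)[OF j]]
    have sq: "Q.expectation (\<lambda>\<omega>. (b j \<omega>)\<^sup>2 * (\<zeta> j \<omega>)\<^sup>2) \<le> Q.expectation (\<lambda>\<omega>. (b j \<omega>)\<^sup>2 * v j)"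
      "integrable Q (\<lambda>\<omega>. (b j \<omega>)\<^sup>2 * (\<zeta> j \<omega>)\<^sup>2)"
      using c2 m2(2)[OF j] by (auto simp: \<zeta>_def intro!: mult_left_mono)
    have eq: "(S' (Suc j) \<omega>)\<^sup>2 = (S' j \<omega>)\<^sup>2 + 2 * (S' j \<omega> * b j \<omega> * \<zeta> j \<omega>) + (b j \<omega>)\<^sup>2 * (\<zeta> j \<omega>)\<^sup>2" for \<omega>
      by (simp add: S'_def power2_eq_square algebra_simps)
    have int: "integrable Q (\<lambda>\<omega>. (S' (Suc j) \<omega>)\<^sup>2)"
      unfolding eq by (intro Bochner_Integration.integrable_add IH sq integrable_mult_right cross)
    have "Q.expectation (\<lambda>\<omega>. (S' (Suc j) \<omega>)\<^sup>2)
      = Q.expectation (\<lambda>\<omega>. (S' j \<omega>)\<^sup>2) + Q.expectation (\<lambda>\<omega>. (b j \<omega>)\<^sup>2 * (\<zeta> j \<omega>)\<^sup>2)"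
      unfolding eq using IH(1) cross sq(2) by simp
    also have "\<dots> \<le> Q.expectation (\<lambda>\<omega>. \<Sum>i<j. (b i \<omega>)\<^sup>2 * v i) + Q.expectation (\<lambda>\<omega>. (b j \<omega>)\<^sup>2 * v j)"
      using IH(2) sq(1) by simp
    also have "\<dots> = Q.expectation (\<lambda>\<omega>. (\<Sum>i<j. (b i \<omega>)\<^sup>2 * v i) + (b j \<omega>)\<^sup>2 * v j)"
      by (rule Bochner_Integration.integral_add[symmetric]) (use ib2 j in auto)
    finally show ?case using int by simp
  qed
  \<comment> \<open>The stopped quadratic variation is bounded on every path: it equals
    \<open>V\<close> as long as \<open>ok\<close> holds, and afterwards nothing is added.\<close>
  have sumb: "(\<Sum>i<j. (b i \<omega>)\<^sup>2 * v i) \<le> \<delta>" if "j \<le> n" for j \<omega>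
    using that
  proof (induction j)
    case (Suc j)
    show ?case
    proof (cases "ok j \<omega>")
      case True
      have "(\<Sum>i<Suc j. (b i \<omega>)\<^sup>2 * v i) = V (Suc j) \<omega>"
        unfolding V_def by (rule sum.cong) (use ok_mono[OF True] Suc in \<open>auto simp: b_def less_Suc_eq_le\<close>)
      then show ?thesis using True by (simp add: ok_def)
    qed (use Suc in \<open>simp add: b_def\<close>)
  qed (use \<delta> in simp)
  have E: "Q.expectation (\<lambda>\<omega>. (S' n \<omega>)\<^sup>2) \<le> \<delta>"
  proof -
    have "Q.expectation (\<lambda>\<omega>. \<Sum>i<n. (b i \<omega>)\<^sup>2 * v i) \<le> \<delta>"
      by (rule Q.integral_le_const) (use ib2 sumb in auto)
    then show ?thesis using second[of n] by simp
  qed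
  define A where "A = {\<omega>\<in>space Q. \<epsilon>\<^sup>2 \<le> (S' n \<omega>)\<^sup>2}"
  define B where "B = {\<omega>\<in>path_space. \<delta> < (\<Sum>i<n. (a i \<omega>)\<^sup>2 * v i)}"
  have S'Q: "S' n \<in> borel_measurable Q" by (rule measurable_F_Q[OF S'm[of n n]]) auto
  have "Q.prob A \<le> Q.expectation (\<lambda>\<omega>. (S' n \<omega>)\<^sup>2) / \<epsilon>\<^sup>2"
    unfolding A_def by (rule integral_Markov_inequality_measure[where A = "space Q"]) (use second[of n] \<epsilon> in auto)
  also have "\<dots> \<le> \<delta> / \<epsilon>\<^sup>2" using E \<epsilon> by (intro divide_right_mono) auto
  finally have PA: "Q.prob A \<le> \<delta> / \<epsilon>\<^sup>2" .
  have As: "A \<in> sets Q" unfolding A_def by (intro borel_measurable_le borel_measurable_power borel_measurable_const S'Q)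
  have "V n \<in> borel_measurable Q"
    unfolding V_def[abs_def]
    by (intro borel_measurable_sum borel_measurable_times borel_measurable_power borel_measurable_const measurable_F_Q[OF a]) auto
  then have "{\<omega>\<in>space Q. \<delta> < V n \<omega>} \<in> sets Q" by (intro borel_measurable_less borel_measurable_const)
  then have Bs: "B \<in> sets Q" by (simp add: B_def V_def space_wiener)
  have "{\<omega>\<in>path_space. \<exists>j\<le>n. \<epsilon> < \<bar>S j \<omega>\<bar>} \<subseteq> B \<union> A"
  proof safe
    fix \<omega> j assume \<omega>: "\<omega> \<in> path_space" and j: "j \<le> n" "\<epsilon> < \<bar>S j \<omega>\<bar>" and nA: "\<omega> \<notin> A"
    show "\<omega> \<in> B"
    proof (rule ccontr)
      assume "\<omega> \<notin> B"
      then have Vn: "V n \<omega> \<le> \<delta>" using \<omega> by (auto simp: B_def V_def)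
      \<comment> \<open>At the first exceedance \<open>k\<close>, every earlier index is
        \<open>ok\<close> and none from \<open>k\<close> on is. The stopped sum is therefore frozen
        at \<open>S k\<close>, and its final value alone reveals the exceedance.\<close>
      define k where "k = (LEAST j. \<epsilon> < \<bar>S j \<omega>\<bar>)"
      have k: "\<epsilon> < \<bar>S k \<omega>\<bar>" "k \<le> j" unfolding k_def using j(2) by (auto intro: LeastI Least_le)
      have before: "\<bar>S l \<omega>\<bar> \<le> \<epsilon>" if "l < k" for l using not_less_Least[OF that[unfolded k_def]] by simp
      have "S' n \<omega> = (\<Sum>i<k. b i \<omega> * \<zeta> i \<omega>)"
        unfolding S'_def
      proof (rule sum.mono_neutral_right)
        have "\<not> ok i \<omega>" if "k \<le> i" for i
        proof
          assume "ok i \<omega>"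
          then have "\<bar>S k \<omega>\<bar> \<le> \<epsilon>" using that by (simp add: ok_def)
          then show False using k(1) by simp
        qed
        then show "\<forall>i\<in>{..<n} - {..<k}. b i \<omega> * \<zeta> i \<omega> = 0"
          by (auto simp: b_def)
      qed (use k j in auto)
      also have "\<dots> = S k \<omega>"
        unfolding S_def
      proof (rule sum.cong)
        fix i assume i: "i \<in> {..<k}"
        have "V (Suc i) \<omega> \<le> \<delta>" using V_mono[of "Suc i" n \<omega>] Vn i k j by auto
        then have "ok i \<omega>" using before i by (auto simp: ok_def)
        then show "b i \<omega> * \<zeta> i \<omega> = a i \<omega> * \<zeta> i \<omega>" by (simp add: b_def)
      qed simp
      finally have "\<epsilon> \<le> \<bar>S' n \<omega>\<bar>" using k by simp
      then have "\<epsilon>\<^sup>2 \<le> (S' n \<omega>)\<^sup>2" using \<epsilon> power_mono[of \<epsilon> "\<bar>S' n \<omega>\<bar>" 2] by simp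
      then show False using nA \<omega> by (simp add: A_def space_wiener)
    qed
  qed
  then have "Q.prob {\<omega>\<in>path_space. \<exists>j\<le>n. \<epsilon> < \<bar>S j \<omega>\<bar>} \<le> Q.prob (B \<union> A)"
    using As Bs by (intro Q.finite_measure_mono) auto
  also have "\<dots> \<le> Q.prob B + Q.prob A" by (rule measure_Un_le[OF Bs As])
  finally have "Q.prob {\<omega>\<in>path_space. \<exists>j\<le>n. \<epsilon> < \<bar>S j \<omega>\<bar>} \<le> Q.prob B + \<delta> / \<epsilon>\<^sup>2"
    using PA by linarith
  then show ?thesis by (simp only: S_def \<zeta>_def B_def)
qed

end

section \<open>Measurability and simple integrals\<close>

lemma sigma_finite_restrict_lborel: "sigma_finite_measure (restrict_space lborel {0..t::real})"
  by (rule sigma_finite_measure_restrict_space) (auto intro: lborel.sigma_finite_measure_axioms)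

context wiener_measure
begin

text \<open>Dominated convergence for the indicators. This is the passage from estimates on almost
  every path, valid for all large \<open>k\<close>, to convergence in probability.\<close>

lemma prob_tendsto_0:
  assumes S: "\<And>k. S k \<in> sets Q" and ev: "AE \<omega> in P. eventually (\<lambda>k. \<omega> \<notin> S k) sequentially"
  shows "(\<lambda>k. Q.prob (S k)) \<longlonglongrightarrow> 0"
proof -
  have "(\<lambda>k. Q.expectation (\<lambda>\<omega>. indicator (S k) \<omega> :: real)) \<longlonglongrightarrow> Q.expectation (\<lambda>\<omega>. 0)"
  proof (rule integral_dominated_convergence[where w = "\<lambda>_. 1"])
    show "AE \<omega> in Q. (\<lambda>k. indicator (S k) \<omega> :: real) \<longlonglongrightarrow> 0"
      using AE_completion[OF ev]
    proof eventually_elim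
      case (elim \<omega>)
      then show ?case by (intro tendsto_eventually) (auto elim: eventually_mono)
    qed
  qed (use S in \<open>auto simp: indicator_def\<close>)
  moreover have "S k \<inter> space P = S k" for k using sets.sets_into_space[OF S[of k]] by auto
  ultimately show ?thesis by simp
qed

lemma prob_subset_tendsto_0:
  assumes sub: "eventually (\<lambda>k. S k \<subseteq> A k) sequentially" and A: "\<And>k. A k \<in> sets Q"
    and lim: "(\<lambda>k. Q.prob (A k)) \<longlonglongrightarrow> 0"
  shows "(\<lambda>k. Q.prob (S k)) \<longlonglongrightarrow> 0"
proof (rule tendsto_sandwich[OF _ _ tendsto_const lim])
  show "\<forall>\<^sub>F k in sequentially. Q.prob (S k) \<le> Q.prob (A k)"
    using sub by eventually_elim (rule Q.finite_measure_mono[OF _ A])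
qed simp

lemma prob_Un_tendsto_0:
  assumes "\<And>k. A k \<in> sets Q" "\<And>k. B k \<in> sets Q"
    and "(\<lambda>k. Q.prob (A k)) \<longlonglongrightarrow> 0" "(\<lambda>k. Q.prob (B k)) \<longlonglongrightarrow> 0"
  shows "(\<lambda>k. Q.prob (A k \<union> B k)) \<longlonglongrightarrow> 0"
proof (rule tendsto_sandwich[OF _ _ tendsto_const])
  show "(\<lambda>k. Q.prob (A k) + Q.prob (B k)) \<longlonglongrightarrow> 0" using tendsto_add[OF assms(3,4)] by simp
  show "\<forall>\<^sub>F k in sequentially. Q.prob (A k \<union> B k) \<le> Q.prob (A k) + Q.prob (B k)"
    using assms by (intro always_eventually allI measure_Un_le)
qed simp

text \<open>By continuity the times at which \<open>\<epsilon>\<close> is exceeded form a relatively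
  open subset of \<open>K\<close>, so a countable dense subset of \<open>K\<close> detects
  them.\<close>

lemma sets_exists_greater:
  fixes f :: "(real \<Rightarrow> real) \<Rightarrow> real \<Rightarrow> real"
  assumes f: "\<And>q. q \<in> K \<Longrightarrow> (\<lambda>\<omega>. f \<omega> q) \<in> borel_measurable Q"
    and c: "\<And>\<omega>. \<omega> \<in> path_space \<Longrightarrow> continuous_on K (f \<omega>)"
  shows "{\<omega>\<in>path_space. \<exists>q\<in>K. \<epsilon> < f \<omega> q} \<in> sets Q"
proof -
  obtain D where D: "countable D" "D \<subseteq> K" "K \<subseteq> closure D" by (rule separable)
  have "(\<exists>q\<in>K. \<epsilon> < f \<omega> q) \<longleftrightarrow> (\<exists>q\<in>D. \<epsilon> < f \<omega> q)" if \<omega>: "\<omega> \<in> path_space" for \<omega>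
  proof
    assume "\<exists>q\<in>K. \<epsilon> < f \<omega> q"
    then obtain q where q: "q \<in> K" "\<epsilon> < f \<omega> q" by blast
    obtain U where U: "open U" "U \<inter> K = f \<omega> -` {\<epsilon><..} \<inter> K"
      using c[OF \<omega>] open_greaterThan[of \<epsilon>] by (metis continuous_on_open_invariant)
    have "q \<in> U" using U(2) q by auto
    moreover have "q \<in> closure D" using D q by auto
    ultimately obtain q' where "q' \<in> D" "q' \<in> U" using U(1) by (metis closure_iff_nhds_not_empty disjoint_iff subset_refl)
    then show "\<exists>q\<in>D. \<epsilon> < f \<omega> q" using U(2) D(2) by blast
  qed (use D in auto)
  then have eq: "{\<omega>\<in>path_space. \<exists>q\<in>K. \<epsilon> < f \<omega> q} = (\<Union>q\<in>D. {\<omega>\<in>space Q. \<epsilon> < f \<omega> q})"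
    by (auto simp: space_wiener)
  show ?thesis
    unfolding eq using D f by (intro sets.countable_UN'' borel_measurable_less borel_measurable_const) auto
qed

text \<open>Approximation by the value at the last grid point before \<open>s\<close>. It never
  looks beyond \<open>s\<close>, and it involves countably many times, at each of which adaptedness
  applies.\<close>

lemma progressively_measurable_continuous:
  assumes X: "adapted P X" "continuous_process X"
  shows "progressively_measurable P X"
  unfolding progressively_measurable_def
proof safe
  fix t :: real assume t: "0 \<le> t"
  define grid where "grid n s = real_of_int \<lfloor>real (Suc n) * s\<rfloor> / real (Suc n)" for n s
  show "(\<lambda>(\<omega>, s). X \<omega> s) \<in> borel_measurable (F t \<Otimes>\<^sub>M restrict_space borel {0..t})"
  proof (rule borel_measurable_LIMSEQ_real)
    fix p assume "p \<in> space (F t \<Otimes>\<^sub>M restrict_space borel {0..t})"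
    then obtain \<omega> s where p: "p = (\<omega>, s)" "\<omega> \<in> path_space" "0 \<le> s" "s \<le> t"
      by (auto simp: space_pair_measure space_restrict_space)
    have g: "0 \<le> grid n s" "grid n s \<le> s" "s - 1 / real (Suc n) \<le> grid n s" for n
    proof -
      show "0 \<le> grid n s" using p by (simp add: grid_def)
      have "real_of_int \<lfloor>real (Suc n) * s\<rfloor> \<le> s * real (Suc n)" using of_int_floor_le[of "real (Suc n) * s"] by (simp only: mult.commute)
      then show "grid n s \<le> s" unfolding grid_def by (subst pos_divide_le_eq) auto
      have "real (Suc n) * s - 1 \<le> real_of_int \<lfloor>real (Suc n) * s\<rfloor>" by linarith
      then have "(real (Suc n) * s - 1) / real (Suc n) \<le> grid n s" unfolding grid_def by (intro divide_right_mono) auto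
      then show "s - 1 / real (Suc n) \<le> grid n s" by (simp add: diff_divide_distrib del: of_nat_Suc)
    qed
    have "(\<lambda>n. grid n s) \<longlonglongrightarrow> s"
    proof (rule tendsto_sandwich[OF _ _ _ tendsto_const])
      show "(\<lambda>n. s - 1 / real (Suc n)) \<longlonglongrightarrow> s"
        using tendsto_diff[OF tendsto_const[of s] LIMSEQ_inverse_real_of_nat] by (simp add: divide_inverse)
      show "\<forall>\<^sub>F n in sequentially. s - 1 / real (Suc n) \<le> grid n s" by (intro always_eventually allI g)
      show "\<forall>\<^sub>F n in sequentially. grid n s \<le> s" by (intro always_eventually allI g)
    qed
    moreover have "continuous_on {0..} (X \<omega>)" using X(2) p by (auto simp: continuous_process_def)
    ultimately have "(\<lambda>n. X \<omega> (grid n s)) \<longlonglongrightarrow> X \<omega> s"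
    proof (intro continuous_on_tendsto_compose[where f = "X \<omega>" and s = "{0..}"])
      show "s \<in> {0..}" using p(3) by simp
      show "\<forall>\<^sub>F n in sequentially. grid n s \<in> {0..}" using g(1) by simp
    qed
    \<comment> \<open>Clamping to \<open>{0..t}\<close> changes nothing for these \<open>s\<close>,
      but it makes the term measurable at time \<open>t\<close> for every integer value of the
      floor, as composition with a countably valued function requires.\<close>
    then have "(\<lambda>n. X \<omega> (max 0 (min t (grid n s)))) \<longlonglongrightarrow> X \<omega> s"
    proof -
      have "max 0 (min t (grid n s)) = grid n s" for n using g(1,2)[of n] p(4) by linarith
      then show ?thesis using \<open>(\<lambda>n. X \<omega> (grid n s)) \<longlonglongrightarrow> X \<omega> s\<close> by simp
    qed
    then show "(\<lambda>n. (\<lambda>(\<omega>, s). X \<omega> (max 0 (min t (grid n s)))) p) \<longlonglongrightarrow> (case p of (\<omega>, s) \<Rightarrow> X \<omega> s)"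
      by (simp add: p)
  next
    fix n
    have *: "(\<lambda>p. X (fst p) (max 0 (min t (real_of_int i / real (Suc n))))) \<in> borel_measurable (F t \<Otimes>\<^sub>M restrict_space borel {0..t})" for i
    proof -
      have "(\<lambda>\<omega>. X \<omega> (max 0 (min t (real_of_int i / real (Suc n))))) \<in> borel_measurable (F t)"
        by (rule measurable_F_mono[of _ "max 0 (min t (real_of_int i / real (Suc n)))"])
           (use X(1) t in \<open>simp_all add: adapted_def del: of_nat_Suc\<close>)
      then show ?thesis by (rule measurable_compose[OF measurable_fst])
    qed
    have fl: "(\<lambda>p. \<lfloor>real (Suc n) * snd p\<rfloor>) \<in> measurable (F t \<Otimes>\<^sub>M restrict_space borel {0..t}) (count_space UNIV)"
    proof -
      have "(\<lambda>s::real. \<lfloor>real (Suc n) * s\<rfloor>) \<in> measurable (restrict_space borel {0..t}) (count_space UNIV)"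
        by (intro measurable_restrict_space1) measurable
      then show ?thesis by (rule measurable_compose[OF measurable_snd])
    qed
    have "(\<lambda>p. X (fst p) (max 0 (min t (real_of_int \<lfloor>real (Suc n) * snd p\<rfloor> / real (Suc n)))))
        \<in> borel_measurable (F t \<Otimes>\<^sub>M restrict_space borel {0..t})"
      by (rule measurable_compose_countable[OF * fl])
    then show "(\<lambda>(\<omega>, s). X \<omega> (max 0 (min t (grid n s)))) \<in> borel_measurable (F t \<Otimes>\<^sub>M restrict_space borel {0..t})"
      by (simp add: grid_def split_beta')
  qed
qed

lemma borel_measurable_restrict_lborel_iff:
  "borel_measurable (M \<Otimes>\<^sub>M restrict_space borel {0..t}) = borel_measurable (M \<Otimes>\<^sub>M restrict_space lborel {0..t::real})"
  by (intro measurable_cong_sets sets_pair_measure_cong refl) (simp add: sets_restrict_space)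

lemma adapted_primitive:
  assumes h: "progressively_measurable P h" and t: "0 \<le> t"
  shows "(\<lambda>\<omega>. primitive (h \<omega>) t) \<in> borel_measurable (F t)"
proof -
  interpret R: sigma_finite_measure "restrict_space lborel {0..t}" by (rule sigma_finite_restrict_lborel)
  have "(\<lambda>(\<omega>, s). h \<omega> s) \<in> borel_measurable (F t \<Otimes>\<^sub>M restrict_space lborel {0..t})"
    using h t by (simp add: progressively_measurable_def borel_measurable_restrict_lborel_iff)
  then have "(\<lambda>\<omega>. \<integral>s. h \<omega> s \<partial>restrict_space lborel {0..t}) \<in> borel_measurable (F t)"
    by (rule R.borel_measurable_lebesgue_integral)
  then show ?thesis by (simp add: primitive_def set_lebesgue_integral_def integral_restrict_space)
qed

lemma progressive_section:
  assumes h: "progressively_measurable P h" and \<omega>: "\<omega> \<in> path_space" and t: "0 \<le> t"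
  shows "(\<lambda>s. indicator {0..t} s * h \<omega> s) \<in> borel_measurable lborel"
proof -
  have "(\<lambda>(\<omega>, s). h \<omega> s) \<in> borel_measurable (F t \<Otimes>\<^sub>M restrict_space borel {0..t})"
    using h t by (simp add: progressively_measurable_def)
  from measurable_Pair2[OF this, of \<omega>] \<omega> have "h \<omega> \<in> borel_measurable (restrict_space borel {0..t})" by simp
  then show ?thesis by (subst (asm) borel_measurable_restrict_space_iff) (auto simp: mult.commute)
qed

lemma sets_nn_integral_greater:
  fixes h :: "(real \<Rightarrow> real) \<Rightarrow> real \<Rightarrow> real"
  assumes h: "(\<lambda>(\<omega>, s). h \<omega> s) \<in> borel_measurable (Q \<Otimes>\<^sub>M restrict_space borel {0..t})"
  shows "{\<omega>\<in>path_space. e < (\<integral>\<^sup>+ s\<in>{0..t}. ennreal ((h \<omega> s)\<^sup>2) \<partial>lborel)} \<in> sets Q"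
proof -
  interpret R: sigma_finite_measure "restrict_space lborel {0..t}" by (rule sigma_finite_restrict_lborel)
  have "(\<lambda>(\<omega>, s). h \<omega> s) \<in> borel_measurable (Q \<Otimes>\<^sub>M restrict_space lborel {0..t})"
    using h by (simp add: borel_measurable_restrict_lborel_iff)
  then have "(\<lambda>p. ennreal (((\<lambda>(\<omega>, s). h \<omega> s) p)\<^sup>2)) \<in> borel_measurable (Q \<Otimes>\<^sub>M restrict_space lborel {0..t})"
    by (intro measurable_compose[OF _ measurable_ennreal] borel_measurable_power)
  then have "(\<lambda>\<omega>. \<integral>\<^sup>+s. ennreal ((h \<omega> s)\<^sup>2) \<partial>restrict_space lborel {0..t}) \<in> borel_measurable Q"
    by (intro R.borel_measurable_nn_integral) (simp add: split_beta')
  then have "(\<lambda>\<omega>. \<integral>\<^sup>+ s\<in>{0..t}. ennreal ((h \<omega> s)\<^sup>2) \<partial>lborel) \<in> borel_measurable Q"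
    by (simp add: nn_integral_restrict_space)
  then have "{\<omega>\<in>space Q. e < (\<integral>\<^sup>+ s\<in>{0..t}. ennreal ((h \<omega> s)\<^sup>2) \<partial>lborel)} \<in> sets Q"
    by (intro borel_measurable_less borel_measurable_const)
  then show ?thesis by (simp add: space_wiener)
qed

lemma simple_integrand_less: "simple_integrand P n \<tau> \<xi> \<Longrightarrow> i < n \<Longrightarrow> \<tau> i < \<tau> (Suc i)"
  by (simp add: simple_integrand_def)

lemma simple_integrand_coeff:
  assumes "simple_integrand P n \<tau> \<xi>" "i < n" "\<tau> i \<le> t"
  shows "\<xi> i \<in> borel_measurable (F t)"
  by (rule measurable_F_mono[OF _ assms(3)]) (use assms(1,2) in \<open>simp add: simple_integrand_def\<close>)

lemma simple_integrand_mono: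
  assumes "simple_integrand P n \<tau> \<xi>" "i \<le> j" "j \<le> n" shows "\<tau> i \<le> \<tau> j"
  by (rule grid_mono[of n \<tau>, OF simple_integrand_less[OF assms(1)] assms(2,3)])

lemma simple_integrand_nonneg:
  assumes "simple_integrand P n \<tau> \<xi>" "i \<le> n" shows "0 \<le> \<tau> i"
  using simple_integrand_mono[OF assms(1), of 0 i] assms by (auto simp: simple_integrand_def)

text \<open>By \<open>gap\<close> no partition point lies strictly between \<open>s\<close> and
  \<open>t\<close>, so the simple process is constant on \<open>{s<..t}\<close>. Its value is read
  at the right end because the intervals that define it are open on the left.\<close>

lemma simple_integral_increment:
  assumes S: "simple_integrand P n \<tau> \<xi>" and st: "s < t"
    and gap: "\<And>i. i \<le> n \<Longrightarrow> \<tau> i \<le> s \<or> t \<le> \<tau> i"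
  shows "simple_integral n \<tau> \<xi> \<omega> t - simple_integral n \<tau> \<xi> \<omega> s
    = simple_process n \<tau> \<xi> \<omega> t * (\<omega> t - \<omega> s)"
proof -
  have "\<xi> i \<omega> * (\<omega> (min (\<tau> (Suc i)) t) - \<omega> (min (\<tau> i) t)) - \<xi> i \<omega> * (\<omega> (min (\<tau> (Suc i)) s) - \<omega> (min (\<tau> i) s))
      = \<xi> i \<omega> * indicator {\<tau> i<..\<tau> (Suc i)} t * (\<omega> t - \<omega> s)" if i: "i < n" for i
  proof -
    note lt = simple_integrand_less[OF S i]
    consider "\<tau> (Suc i) \<le> s" | "t \<le> \<tau> i" | "\<tau> i \<le> s" "t \<le> \<tau> (Suc i)"
      using gap[of i] gap[of "Suc i"] i by linarith
    then show ?thesis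
    proof cases
      case 1 then show ?thesis using lt st by (simp add: min_def)
    next
      case 2 then show ?thesis using lt st by (simp add: min_def)
    next
      case 3 then show ?thesis using lt st by (auto simp: min_def indicator_def algebra_simps)
    qed
  qed
  then show ?thesis
    unfolding simple_integral_def simple_process_def sum_subtractf[symmetric] sum_distrib_right
    by (intro sum.cong) auto
qed

lemma simple_integral_0:
  assumes S: "simple_integrand P n \<tau> \<xi>"
  shows "simple_integral n \<tau> \<xi> \<omega> 0 = 0"
proof -
  have "min (\<tau> i) 0 = 0" if "i \<le> n" for i using simple_integrand_nonneg[OF S that] by simp
  then show ?thesis unfolding simple_integral_def by (intro sum.neutral) auto
qed

text \<open>Predictability: an interval that contributes at \<open>t\<close> begins before
  \<open>t\<close>, hence by \<open>gap\<close> not after \<open>s\<close>, where its coefficient is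
  already known.\<close>

lemma simple_process_measurable:
  assumes S: "simple_integrand P n \<tau> \<xi>" and gap: "\<And>i. i \<le> n \<Longrightarrow> \<tau> i \<le> s \<or> t \<le> \<tau> i"
  shows "(\<lambda>\<omega>. simple_process n \<tau> \<xi> \<omega> t) \<in> borel_measurable (F s)"
  unfolding simple_process_def
proof (rule borel_measurable_sum)
  fix i assume i: "i \<in> {..<n}"
  show "(\<lambda>\<omega>. \<xi> i \<omega> * indicator {\<tau> i<..\<tau> (Suc i)} t) \<in> borel_measurable (F s)"
  proof (cases "\<tau> i < t")
    case True
    then have "\<xi> i \<in> borel_measurable (F s)"
      by (intro simple_integrand_coeff[OF S]) (use gap[of i] i in auto)
    then show ?thesis by (intro borel_measurable_times borel_measurable_const)
  next
    case False
    then have "(\<lambda>\<omega>. \<xi> i \<omega> * indicator {\<tau> i<..\<tau> (Suc i)} t) = (\<lambda>\<omega>. 0)" by auto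
    then show ?thesis by (simp only: borel_measurable_const)
  qed
qed

lemma simple_integral_adapted:
  assumes S: "simple_integrand P n \<tau> \<xi>" and t: "0 \<le> t"
  shows "(\<lambda>\<omega>. simple_integral n \<tau> \<xi> \<omega> t) \<in> borel_measurable (F t)"
  unfolding simple_integral_def
proof (rule borel_measurable_sum)
  fix i assume i: "i \<in> {..<n}"
  have lt: "\<tau> i < \<tau> (Suc i)" "0 \<le> \<tau> i" using i simple_integrand_nonneg[OF S, of i] simple_integrand_less[OF S, of i] by auto
  show "(\<lambda>\<omega>. \<xi> i \<omega> * (\<omega> (min (\<tau> (Suc i)) t) - \<omega> (min (\<tau> i) t))) \<in> borel_measurable (F t)"
  proof (cases "\<tau> i < t")
    case True
    then have "\<xi> i \<in> borel_measurable (F t)"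
      by (intro simple_integrand_coeff[OF S]) (use i in auto)
    then show ?thesis
      by (intro borel_measurable_times borel_measurable_diff measurable_coordinate_F) (use lt t in auto)
  next
    case False
    then have "(\<lambda>\<omega>. \<xi> i \<omega> * (\<omega> (min (\<tau> (Suc i)) t) - \<omega> (min (\<tau> i) t))) = (\<lambda>\<omega>. 0)"
      using lt by (auto simp: min_def)
    then show ?thesis by (simp only: borel_measurable_const)
  qed
qed

lemma continuous_simple_integral:
  assumes S: "simple_integrand P n \<tau> \<xi>" and \<omega>: "\<omega> \<in> path_space"
  shows "continuous_on {0..} (simple_integral n \<tau> \<xi> \<omega>)"
proof -
  have c: "continuous_on {0..} (\<lambda>t. \<omega> (min a t))" if "0 \<le> a" for a
    by (rule continuous_on_compose2[where g = \<omega> and t = "{0..}"])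
       (use \<omega> that in \<open>auto simp: path_space_def intro!: continuous_intros\<close>)
  show ?thesis
    unfolding simple_integral_def[abs_def]
    by (intro continuous_intros c) (use simple_integrand_nonneg[OF S] in auto)
qed

lemma sets_simple_integral_sup:
  assumes S: "simple_integrand P n \<tau> \<xi>" and I: "adapted P I" "continuous_process I"
  shows "{\<omega>\<in>path_space. \<exists>t\<in>{0..T}. \<epsilon> < \<bar>simple_integral n \<tau> \<xi> \<omega> t - I \<omega> t\<bar>} \<in> sets Q"
proof (rule sets_exists_greater)
  fix t assume t: "t \<in> {0..T}"
  show "(\<lambda>\<omega>. \<bar>simple_integral n \<tau> \<xi> \<omega> t - I \<omega> t\<bar>) \<in> borel_measurable Q"
  proof (intro borel_measurable_abs borel_measurable_diff)
    show "(\<lambda>\<omega>. simple_integral n \<tau> \<xi> \<omega> t) \<in> borel_measurable Q"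
      by (rule measurable_F_Q[OF simple_integral_adapted[OF S]]) (use t in auto)
    show "(\<lambda>\<omega>. I \<omega> t) \<in> borel_measurable Q"
      by (rule measurable_F_Q[of _ t]) (use t I(1) in \<open>simp add: adapted_def\<close>)
  qed
next
  fix \<omega> assume \<omega>: "\<omega> \<in> path_space"
  then have "continuous_on {0..} (I \<omega>)" using I by (auto simp: continuous_process_def)
  then have "continuous_on {0..} (\<lambda>t. \<bar>simple_integral n \<tau> \<xi> \<omega> t - I \<omega> t\<bar>)"
    by (intro continuous_intros continuous_simple_integral[OF S \<omega>])
  then show "continuous_on {0..T} (\<lambda>t. \<bar>simple_integral n \<tau> \<xi> \<omega> t - I \<omega> t\<bar>)"
    by (rule continuous_on_subset) auto
qed

lemma sets_simple_process_error:
  assumes S: "simple_integrand P n \<tau> \<xi>" and H: "progressively_measurable P H" and T: "0 \<le> T"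
  shows "{\<omega>\<in>path_space. e < (\<integral>\<^sup>+ s\<in>{0..T}. ennreal ((simple_process n \<tau> \<xi> \<omega> s - H \<omega> s)\<^sup>2) \<partial>lborel)} \<in> sets Q"
proof (rule sets_nn_integral_greater)
  have "(\<lambda>(\<omega>, s). H \<omega> s) \<in> borel_measurable (F T \<Otimes>\<^sub>M restrict_space borel {0..T})"
    using H T by (simp add: progressively_measurable_def)
  then have H: "(\<lambda>(\<omega>, s). H \<omega> s) \<in> borel_measurable (Q \<Otimes>\<^sub>M restrict_space borel {0..T})"
    by (rule measurable_pair_coarser) (simp_all add: sets_F_Q space_wiener)
  have \<xi>: "(\<lambda>p. \<xi> i (fst p) * indicator {\<tau> i<..\<tau> (Suc i)} (snd p)) \<in> borel_measurable (Q \<Otimes>\<^sub>M restrict_space borel {0..T})"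
    if "i < n" for i
  proof (rule borel_measurable_times)
    show "(\<lambda>p. \<xi> i (fst p)) \<in> borel_measurable (Q \<Otimes>\<^sub>M restrict_space borel {0..T})"
      by (rule measurable_compose[OF measurable_fst measurable_F_Q[OF simple_integrand_coeff[OF S that order_refl]]])
    have "(\<lambda>s. indicator {\<tau> i<..\<tau> (Suc i)} s :: real) \<in> borel_measurable (restrict_space borel {0..T})"
      by (intro measurable_restrict_space1) measurable
    then show "(\<lambda>p. indicator {\<tau> i<..\<tau> (Suc i)} (snd p) :: real) \<in> borel_measurable (Q \<Otimes>\<^sub>M restrict_space borel {0..T})"
      by (rule measurable_compose[OF measurable_snd])
  qed
  have "(\<lambda>p. (\<Sum>i<n. \<xi> i (fst p) * indicator {\<tau> i<..\<tau> (Suc i)} (snd p)) - (\<lambda>(\<omega>, s). H \<omega> s) p)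
      \<in> borel_measurable (Q \<Otimes>\<^sub>M restrict_space borel {0..T})"
    by (intro borel_measurable_diff H borel_measurable_sum \<xi>) auto
  then show "(\<lambda>(\<omega>, s). simple_process n \<tau> \<xi> \<omega> s - H \<omega> s) \<in> borel_measurable (Q \<Otimes>\<^sub>M restrict_space borel {0..T})"
    by (simp add: simple_process_def split_beta')
qed

end

section \<open>The product rule\<close>

text \<open>The stochastic exponential of \<open>- \<sigma> W\<close>, which solves the equation
  without drift from the initial value 1.\<close>

definition exp_martingale :: "real \<Rightarrow> (real \<Rightarrow> real) \<Rightarrow> real \<Rightarrow> real" where
  "exp_martingale \<sigma> \<omega> t = exp (- \<sigma> * \<omega> t - \<sigma>\<^sup>2 * t / 2)"

lemma exp_martingale_pos: "0 < exp_martingale \<sigma> \<omega> t"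
  by (simp add: exp_martingale_def)

lemma continuous_exp_martingale: "\<omega> \<in> path_space \<Longrightarrow> continuous_on {0..} (exp_martingale \<sigma> \<omega>)"
  unfolding exp_martingale_def[abs_def] path_space_def by (auto intro!: continuous_intros)

context wiener_measure
begin

text \<open>The threshold for the quadratic variation in the maximal inequality is free, so it is
  enough that the quadratic variation tends to 0 on almost every path; its expectation is never
  estimated.\<close>

lemma martingale_sum_tendsto_0:
  fixes n :: "nat \<Rightarrow> nat" and \<tau> v :: "nat \<Rightarrow> nat \<Rightarrow> real"
    and a :: "nat \<Rightarrow> nat \<Rightarrow> (real \<Rightarrow> real) \<Rightarrow> real" and \<phi> :: "nat \<Rightarrow> nat \<Rightarrow> real \<Rightarrow> real"
  assumes \<tau>: "\<And>k. 0 \<le> \<tau> k 0" "\<And>k i. i < n k \<Longrightarrow> \<tau> k i < \<tau> k (Suc i)"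
    and a: "\<And>k i. i < n k \<Longrightarrow> a k i \<in> borel_measurable (F (\<tau> k i))"
    and \<phi>: "\<And>k i. i < n k \<Longrightarrow> \<phi> k i \<in> borel_measurable borel"
    and m1: "\<And>k i. i < n k \<Longrightarrow> has_bochner_integral Q (\<lambda>\<omega>. \<phi> k i (\<omega> (\<tau> k (Suc i)) - \<omega> (\<tau> k i))) 0"
    and m2: "\<And>k i. i < n k \<Longrightarrow> integrable Q (\<lambda>\<omega>. (\<phi> k i (\<omega> (\<tau> k (Suc i)) - \<omega> (\<tau> k i)))\<^sup>2)"
      "\<And>k i. i < n k \<Longrightarrow> Q.expectation (\<lambda>\<omega>. (\<phi> k i (\<omega> (\<tau> k (Suc i)) - \<omega> (\<tau> k i)))\<^sup>2) \<le> v k i"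
    and v: "\<And>k i. i < n k \<Longrightarrow> 0 < v k i"
    and lim: "AE \<omega> in P. (\<lambda>k. \<Sum>i<n k. (a k i \<omega>)\<^sup>2 * v k i) \<longlonglongrightarrow> 0"
    and \<epsilon>: "0 < \<epsilon>"
  shows "(\<lambda>k. Q.prob {\<omega>\<in>path_space. \<exists>j\<le>n k. \<epsilon> < \<bar>\<Sum>i<j. a k i \<omega> * \<phi> k i (\<omega> (\<tau> k (Suc i)) - \<omega> (\<tau> k i))\<bar>})
    \<longlonglongrightarrow> 0"
proof (rule LIMSEQ_I)
  fix r :: real assume r: "0 < r"
  \<comment> \<open>Chosen so that the Chebyshev term \<open>\<delta> / \<epsilon>\<^sup>2\<close>
    is half of the tolerance \<open>r\<close>.\<close>
  define \<delta> where "\<delta> = r * \<epsilon>\<^sup>2 / 2"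
  have \<delta>: "0 < \<delta>" "\<delta> / \<epsilon>\<^sup>2 = r / 2" using r \<epsilon> by (simp_all add: \<delta>_def)
  define S where "S k = {\<omega>\<in>path_space. \<delta> < (\<Sum>i<n k. (a k i \<omega>)\<^sup>2 * v k i)}" for k
  have "S k \<in> sets Q" for k
  proof -
    have "(\<lambda>\<omega>. \<Sum>i<n k. (a k i \<omega>)\<^sup>2 * v k i) \<in> borel_measurable Q"
      by (intro borel_measurable_sum borel_measurable_times borel_measurable_power borel_measurable_const
          measurable_F_Q[OF a]) auto
    then have "{\<omega>\<in>space Q. \<delta> < (\<Sum>i<n k. (a k i \<omega>)\<^sup>2 * v k i)} \<in> sets Q"
      by (intro borel_measurable_less borel_measurable_const)
    then show ?thesis by (simp add: S_def space_wiener)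
  qed
  moreover have "AE \<omega> in P. eventually (\<lambda>k. \<omega> \<notin> S k) sequentially"
    using lim
  proof eventually_elim
    case (elim \<omega>)
    from order_tendstoD(2)[OF elim \<delta>(1)] show ?case by eventually_elim (auto simp: S_def)
  qed
  ultimately have "(\<lambda>k. Q.prob (S k)) \<longlonglongrightarrow> 0" by (rule prob_tendsto_0)
  then have "\<forall>\<^sub>F k in sequentially. Q.prob (S k) < r / 2" using r by (intro order_tendstoD) auto
  then obtain N where N: "\<And>k. N \<le> k \<Longrightarrow> Q.prob (S k) < r / 2" by (auto simp: eventually_sequentially)
  show "\<exists>N. \<forall>k\<ge>N. norm (Q.prob {\<omega>\<in>path_space. \<exists>j\<le>n k. \<epsilon> < \<bar>\<Sum>i<j. a k i \<omega> * \<phi> k i (\<omega> (\<tau> k (Suc i)) - \<omega> (\<tau> k i))\<bar>} - 0) < r"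
  proof (intro exI[of _ N] allI impI)
    fix k assume "N \<le> k"
    then show "norm (Q.prob {\<omega>\<in>path_space. \<exists>j\<le>n k. \<epsilon> < \<bar>\<Sum>i<j. a k i \<omega> * \<phi> k i (\<omega> (\<tau> k (Suc i)) - \<omega> (\<tau> k i))\<bar>} - 0) < r"
    proof -
      have "Q.prob {\<omega>\<in>path_space. \<exists>j\<le>n k. \<epsilon> < \<bar>\<Sum>i<j. a k i \<omega> * \<phi> k i (\<omega> (\<tau> k (Suc i)) - \<omega> (\<tau> k i))\<bar>}
          \<le> Q.prob (S k) + \<delta> / \<epsilon>\<^sup>2"
        unfolding S_def 
        using martingale_sum_maximal[where \<tau> = "\<tau> k" and n = "n k" and a = "a k" and \<phi> = "\<phi> k" and v = "v k",
          OF \<tau>(1) \<tau>(2) a \<phi> m1 m2(1) m2(2) v \<epsilon> \<delta>(1)] .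
      also have "\<dots> < r" using N[OF \<open>N \<le> k\<close>] unfolding \<delta>(2) by linarith
      finally show ?thesis by (simp only: diff_zero real_norm_def abs_of_nonneg[OF measure_nonneg])
    qed
  qed
qed

lemma simple_process_eq:
  assumes S: "simple_integrand P n \<tau> \<xi>" and i: "i < n" and s: "\<tau> i < s" "s \<le> \<tau> (Suc i)"
  shows "simple_process n \<tau> \<xi> \<omega> s = \<xi> i \<omega>"
proof -
  have "simple_process n \<tau> \<xi> \<omega> s = (\<Sum>j<n. if j = i then \<xi> i \<omega> else 0)"
    unfolding simple_process_def
  proof (rule sum.cong)
    fix j assume j: "j \<in> {..<n}"
    consider "j < i" | "j = i" | "i < j" by linarith
    then show "\<xi> j \<omega> * indicator {\<tau> j<..\<tau> (Suc j)} s = (if j = i then \<xi> i \<omega> else 0)"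
    proof cases
      case 1
      then have "\<tau> (Suc j) \<le> \<tau> i" using simple_integrand_mono[OF S, of "Suc j" i] i by auto
      then have "s \<notin> {\<tau> j<..\<tau> (Suc j)}" using s by auto
      then show ?thesis using 1 by simp
    next
      case 3
      then have "\<tau> (Suc i) \<le> \<tau> j" using simple_integrand_mono[OF S, of "Suc i" j] j by auto
      then have "s \<notin> {\<tau> j<..\<tau> (Suc j)}" using s by auto
      then show ?thesis using 3 by simp
    next
      case 2
      then have "s \<in> {\<tau> j<..\<tau> (Suc j)}" using s by auto
      then show ?thesis using 2 by simp
    qed
  qed simp
  then show ?thesis using i by simp
qed

lemma simple_integral_grid:
  assumes S: "simple_integrand P n \<tau> \<xi>" and j: "\<And>i. i < j \<Longrightarrow> p i < p (Suc i)" and p0: "p 0 = 0"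
    and gap: "\<And>i l. i < j \<Longrightarrow> l \<le> n \<Longrightarrow> \<tau> l \<le> p i \<or> p (Suc i) \<le> \<tau> l"
  shows "simple_integral n \<tau> \<xi> \<omega> (p j) = (\<Sum>i<j. simple_process n \<tau> \<xi> \<omega> (p (Suc i)) * (\<omega> (p (Suc i)) - \<omega> (p i)))"
proof -
  have "simple_integral n \<tau> \<xi> \<omega> (p j) - simple_integral n \<tau> \<xi> \<omega> (p 0)
      = (\<Sum>i<j. simple_integral n \<tau> \<xi> \<omega> (p (Suc i)) - simple_integral n \<tau> \<xi> \<omega> (p i))"
    by (rule sum_lessThan_telescope[symmetric])
  also have "\<dots> = (\<Sum>i<j. simple_process n \<tau> \<xi> \<omega> (p (Suc i)) * (\<omega> (p (Suc i)) - \<omega> (p i)))"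
  proof (rule sum.cong)
    fix i assume "i \<in> {..<j}"
    then have i: "i < j" by simp
    show "simple_integral n \<tau> \<xi> \<omega> (p (Suc i)) - simple_integral n \<tau> \<xi> \<omega> (p i)
      = simple_process n \<tau> \<xi> \<omega> (p (Suc i)) * (\<omega> (p (Suc i)) - \<omega> (p i))"
      by (rule simple_integral_increment[OF S j[OF i] gap[OF i]])
  qed simp
  finally show ?thesis by (simp add: p0 simple_integral_0[OF S])
qed

lemma exp_martingale_adapted:
  assumes "0 \<le> t" shows "(\<lambda>\<omega>. exp_martingale \<sigma> \<omega> t) \<in> borel_measurable (F t)"
proof -
  have [measurable]: "(\<lambda>\<omega>. \<omega> t) \<in> borel_measurable (F t)" by (rule measurable_coordinate_F) (use assms in auto)
  show ?thesis unfolding exp_martingale_def by measurable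
qed

text \<open>
  The product rule for \<open>M G\<close>, where \<open>dM = - \<sigma> M dW\<close> and \<open>dG = g dt\<close>: over a grid interval of
  length \<open>h\<close>, the increment of \<open>M G\<close> minus its two infinitesimal contributions is \<open>M G\<close> times
  \<^const>\<open>exp_remainder\<close>, of conditional mean zero and variance of order \<open>h\<^sup>2\<close>, plus a term
  controlled by the oscillation of \<open>M\<close>.
\<close>

lemma ito_integral_exp_martingale_product:
  assumes \<sigma>: "0 < \<sigma>"
    and G: "adapted P G" "continuous_process G"
    and g: "AE \<omega> in P. \<forall>T\<ge>0. set_integrable lborel {0..T} (g \<omega>) \<and> G \<omega> T = G \<omega> 0 + primitive (g \<omega>) T"
    and I: "adapted P I" "continuous_process I"
    and I_eq: "AE \<omega> in P. \<forall>t\<ge>0. I \<omega> t = exp_martingale \<sigma> \<omega> t * G \<omega> t - G \<omega> 0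
      - primitive (\<lambda>s. exp_martingale \<sigma> \<omega> s * g \<omega> s) t"
  shows "ito_integral P (\<lambda>\<omega> s. - (\<sigma> * (exp_martingale \<sigma> \<omega> s * G \<omega> s))) I"
proof -
  define M where "M = exp_martingale \<sigma>"
  define X where "X \<omega> t = M \<omega> t * G \<omega> t" for \<omega> t
  define H where "H \<omega> t = - (\<sigma> * X \<omega> t)" for \<omega> t
  have cM: "continuous_on {0..T} (M \<omega>)" if "\<omega> \<in> path_space" for \<omega> T
    by (rule continuous_on_subset[OF continuous_exp_martingale[OF that, of \<sigma>, folded M_def]]) auto
  have cG: "continuous_on {0..T} (G \<omega>)" if "\<omega> \<in> path_space" for \<omega> T
    using G(2) that continuous_on_subset[of "{0..}" "G \<omega>" "{0..T}"] by (simp add: continuous_process_def)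
  have cI: "continuous_on {0..T} (I \<omega>)" if "\<omega> \<in> path_space" for \<omega> T
    using I(2) that continuous_on_subset[of "{0..}" "I \<omega>" "{0..T}"] by (simp add: continuous_process_def)
  have cW: "continuous_on {0..T} \<omega>" if "\<omega> \<in> path_space" for \<omega> T
    using that continuous_on_subset[of "{0..}" \<omega> "{0..T}"] by (simp add: path_space_def)
  have cH: "continuous_process H"
    using G(2) continuous_exp_martingale[where \<sigma> = \<sigma>, folded M_def]
    unfolding continuous_process_def H_def[abs_def] X_def by (auto intro!: continuous_intros)
  have cHT: "continuous_on {0..T} (H \<omega>)" if "\<omega> \<in> path_space" for \<omega> T
    using cH that continuous_on_subset[of "{0..}" "H \<omega>" "{0..T}"] by (simp add: continuous_process_def)
  have Xm: "(\<lambda>\<omega>. X \<omega> t) \<in> borel_measurable (F t)" if "0 \<le> t" for t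
    unfolding X_def M_def
    using exp_martingale_adapted[OF that] G(1) that by (intro borel_measurable_times) (auto simp: adapted_def)
  have aH: "adapted P H"
    unfolding adapted_def H_def using Xm by (intro allI impI borel_measurable_uminus borel_measurable_times) auto
  have pH: "progressively_measurable P H" by (rule progressively_measurable_continuous[OF aH cH])
  have H2: "(\<integral>\<^sup>+ s\<in>{0..T}. ennreal ((H \<omega> s)\<^sup>2) \<partial>lborel) < \<infinity>" if \<omega>: "\<omega> \<in> path_space" for \<omega> T
  proof -
    have "set_integrable lborel {0..T} (\<lambda>s. (H \<omega> s)\<^sup>2)"
      by (intro set_integrable_Icc_continuous continuous_on_power cHT \<omega>)
    then have "(\<integral>\<^sup>+ s. ennreal (norm (indicator {0..T} s *\<^sub>R (H \<omega> s)\<^sup>2)) \<partial>lborel) < \<infinity>"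
      unfolding set_integrable_def integrable_iff_bounded by blast
    also have "(\<lambda>s. ennreal (norm (indicator {0..T} s *\<^sub>R (H \<omega> s)\<^sup>2))) = (\<lambda>s. ennreal ((H \<omega> s)\<^sup>2) * indicator {0..T} s)"
      by (auto simp: indicator_def)
    finally show ?thesis .
  qed
  obtain \<rho> :: real where \<rho>: "0 < \<rho>" and small: "\<And>r. 0 < r \<Longrightarrow> r < \<rho> \<Longrightarrow> exp r - 1 - r \<le> r\<^sup>2"
    using small_moment_bounds by metis
  \<comment> \<open>The shift \<open>k0\<close> puts \<open>\<sigma>\<^sup>2\<close> times the mesh
    below \<open>\<rho>\<close> for every \<open>k\<close>, where the moment bound applies.\<close>
  obtain k0 :: nat where k0: "\<sigma>\<^sup>2 / \<rho> < real k0" using reals_Archimedean2 by blast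
  \<comment> \<open>The mesh is \<open>1 / N k\<close> and there are \<open>N k * N k\<close>
    intervals: the grid becomes finer and at the same time covers \<open>{0..N k}\<close>, hence
    eventually every fixed horizon.\<close>
  define N where "N k = real (k + Suc k0)" for k
  define n where "n k = (k + Suc k0) * (k + Suc k0)" for k
  define \<tau> where "\<tau> k i = real i / N k" for k i
  \<comment> \<open>Simple integrands have to be bounded, so the left-end values are cut off at
    level \<open>k\<close>. On a given path and a bounded time interval the cut-off is eventually
    inactive.\<close>
  define \<xi> where "\<xi> k i \<omega> = max (- real k) (min (real k) (H \<omega> (\<tau> k i)))" for k i \<omega>
  have N: "0 < N k" "real k < N k" for k by (auto simp: N_def)
  have Nn: "real (n k) = N k * N k" for k unfolding n_def N_def by (rule of_nat_mult)
  have \<tau>0: "0 \<le> \<tau> k i" for k i using N(1)[of k] by (simp add: \<tau>_def)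
  have \<tau>S: "\<tau> k (Suc i) - \<tau> k i = 1 / N k" for k i by (simp add: \<tau>_def diff_divide_distrib[symmetric])
  have \<tau>inc: "\<tau> k i < \<tau> k (Suc i)" for k i
  proof -
    have "0 < 1 / N k" using N(1)[of k] by simp
    then show ?thesis using \<tau>S[of k i] by linarith
  qed
  have \<sigma>h: "0 < \<sigma>\<^sup>2 * (1 / N k)" "\<sigma>\<^sup>2 * (1 / N k) < \<rho>" for k
  proof -
    show "0 < \<sigma>\<^sup>2 * (1 / N k)" using \<sigma> N(1) by simp
    have "\<sigma>\<^sup>2 / \<rho> < N k" using k0 by (simp add: N_def)
    then show "\<sigma>\<^sup>2 * (1 / N k) < \<rho>" using \<rho> N(1)[of k] by (simp add: field_simps)
  qed
  have h_lim: "(\<lambda>k. 1 / N k) \<longlonglongrightarrow> 0"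
    unfolding N_def using LIMSEQ_ignore_initial_segment[OF LIMSEQ_inverse_real_of_nat, of k0]
    by (simp add: inverse_eq_divide)
  have simp: "simple_integrand P (n k) (\<tau> k) (\<xi> k)" for k
    unfolding simple_integrand_def
  proof (intro conjI allI impI exI[of _ "real k"] ballI)
    show "0 \<le> \<tau> k 0" by (rule \<tau>0)
    show "\<tau> k i < \<tau> k (Suc i)" for i by (rule \<tau>inc)
    show "\<xi> k i \<in> borel_measurable (F (\<tau> k i))" for i
    proof -
      have [measurable]: "(\<lambda>\<omega>. H \<omega> (\<tau> k i)) \<in> borel_measurable (F (\<tau> k i))"
        using aH \<tau>0[of k i] by (auto simp: adapted_def)
      show ?thesis unfolding \<xi>_def[abs_def] by measurable
    qed
    show "\<bar>\<xi> k i \<omega>\<bar> \<le> real k" for i \<omega> by (auto simp: \<xi>_def)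
  qed
  have ev_N: "\<forall>\<^sub>F k in sequentially. T < real k" for T :: real
    using filterlim_real_sequentially by (auto simp: filterlim_at_top_dense)
  have ev_h: "\<forall>\<^sub>F k in sequentially. 1 / N k < d" if "0 < d" for d
    by (rule order_tendstoD(2)[OF h_lim that])
  have \<xi>_eq: "\<forall>\<^sub>F k in sequentially. \<forall>i. \<tau> k i \<le> T \<longrightarrow> \<xi> k i \<omega> = H \<omega> (\<tau> k i)" if \<omega>: "\<omega> \<in> path_space" for \<omega> T
  proof -
    obtain B where B: "\<And>r. r \<in> {0..T} \<Longrightarrow> \<bar>H \<omega> r\<bar> \<le> B" using bounded_Icc[OF cHT[OF \<omega>]] by metis
    show ?thesis
      using ev_N[of B]
    proof eventually_elim
      case (elim k)
      show ?case
      proof (intro allI impI)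
        fix i assume "\<tau> k i \<le> T"
        then have "\<bar>H \<omega> (\<tau> k i)\<bar> \<le> real k" using B[of "\<tau> k i"] elim \<tau>0[of k i] by auto
        then show "\<xi> k i \<omega> = H \<omega> (\<tau> k i)" by (auto simp: \<xi>_def)
      qed
    qed
  qed
  have integrand: "(\<lambda>k. Q.prob {\<omega> \<in> path_space. ennreal \<epsilon> <
      (\<integral>\<^sup>+ s\<in>{0..T}. ennreal ((simple_process (n k) (\<tau> k) (\<xi> k) \<omega> s - H \<omega> s)\<^sup>2) \<partial>lborel)}) \<longlonglongrightarrow> 0"
    if T: "0 < T" and \<epsilon>: "0 < \<epsilon>" for T \<epsilon> :: real
  proof (rule prob_tendsto_0)
    show "{\<omega> \<in> path_space. ennreal \<epsilon> <
      (\<integral>\<^sup>+ s\<in>{0..T}. ennreal ((simple_process (n k) (\<tau> k) (\<xi> k) \<omega> s - H \<omega> s)\<^sup>2) \<partial>lborel)} \<in> sets Q" for k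
      by (rule sets_simple_process_error[OF simp pH]) (use T in simp)
    show "AE \<omega> in P. \<forall>\<^sub>F k in sequentially. \<omega> \<notin> {\<omega> \<in> path_space. ennreal \<epsilon> <
      (\<integral>\<^sup>+ s\<in>{0..T}. ennreal ((simple_process (n k) (\<tau> k) (\<xi> k) \<omega> s - H \<omega> s)\<^sup>2) \<partial>lborel)}"
    proof (rule AE_I2)
      fix \<omega> assume "\<omega> \<in> space P"
      then have \<omega>: "\<omega> \<in> path_space" by (simp add: space_wiener)
      \<comment> \<open>A uniform error \<open>e\<close> contributes at most
        \<open>e\<^sup>2 * T = \<epsilon>\<close> to the integrated squared error.\<close>
      define e where "e = sqrt (\<epsilon> / T)"
      have e: "0 < e" "e\<^sup>2 * T = \<epsilon>" using T \<epsilon> by (auto simp: e_def)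
      obtain d where d: "0 < d" "\<And>s t. s \<in> {0..T} \<Longrightarrow> t \<in> {0..T} \<Longrightarrow> \<bar>s - t\<bar> \<le> d \<Longrightarrow> \<bar>H \<omega> s - H \<omega> t\<bar> \<le> e"
        using uniformly_continuous_Icc[OF cHT[OF \<omega>] e(1)] by metis
      show "\<forall>\<^sub>F k in sequentially. \<omega> \<notin> {\<omega> \<in> path_space. ennreal \<epsilon> <
        (\<integral>\<^sup>+ s\<in>{0..T}. ennreal ((simple_process (n k) (\<tau> k) (\<xi> k) \<omega> s - H \<omega> s)\<^sup>2) \<partial>lborel)}"
        using ev_N[of T] ev_h[OF d(1)] \<xi>_eq[OF \<omega>, of T]
      proof eventually_elim
        case (elim k)
        have bd: "\<bar>simple_process (n k) (\<tau> k) (\<xi> k) \<omega> s - H \<omega> s\<bar> \<le> e" if s: "0 < s" "s \<le> T" for s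
        proof -
          \<comment> \<open>The intervals are open on the left, so the one containing
            \<open>s\<close> is found with the ceiling, not with the floor.\<close>
          define i where "i = nat (\<lceil>s * N k\<rceil> - 1)"
          have pos: "0 < s * N k" using s N(1) by simp
          then have "0 < \<lceil>s * N k\<rceil>" by simp
          then have ri: "real i = real_of_int \<lceil>s * N k\<rceil> - 1" by (simp add: i_def)
          have i1: "real i < s * N k" "s * N k \<le> real i + 1" using ri by linarith+
          have "s * N k < N k * N k" using s elim(1) N[of k] by (intro mult_strict_right_mono) auto
          then have "real i < real (n k)" using i1 Nn[of k] by linarith
          then have i: "i < n k" by simp
          have ti: "\<tau> k i < s" "s \<le> \<tau> k (Suc i)"
            using i1 N(1)[of k] by (simp_all add: \<tau>_def field_simps)
          have "simple_process (n k) (\<tau> k) (\<xi> k) \<omega> s = H \<omega> (\<tau> k i)"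
            using simple_process_eq[OF simp i ti] elim(3) ti s by simp
          moreover have "\<bar>\<tau> k i - s\<bar> \<le> d" using ti \<tau>S[of k i] elim(2) by linarith
          ultimately show ?thesis using d(2)[of "\<tau> k i" s] s ti \<tau>0[of k i] by simp
        qed
        have "(\<integral>\<^sup>+ s\<in>{0..T}. ennreal ((simple_process (n k) (\<tau> k) (\<xi> k) \<omega> s - H \<omega> s)\<^sup>2) \<partial>lborel)
          \<le> (\<integral>\<^sup>+ s\<in>{0..T}. ennreal (e\<^sup>2) \<partial>lborel)"
        \<comment> \<open>Time 0 lies in no interval of the simple process; it is discarded as a
          null set.\<close>
        proof (rule nn_integral_mono_AE, rule AE_mp[OF AE_lborel_singleton[of 0]], rule AE_I2, rule impI)
          fix s :: real assume "s \<noteq> 0"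
          then show "ennreal ((simple_process (n k) (\<tau> k) (\<xi> k) \<omega> s - H \<omega> s)\<^sup>2) * indicator {0..T} s
            \<le> ennreal (e\<^sup>2) * indicator {0..T} s"
            using power_mono[OF bd[of s], of 2] by (auto simp: indicator_def intro!: ennreal_leI)
        qed
        also have "\<dots> = ennreal \<epsilon>"
          using T e by (simp add: nn_integral_cmult_indicator ennreal_mult[symmetric])
        finally show ?case by auto
      qed
    qed
  qed
  have "(\<lambda>k. Q.prob {\<omega> \<in> path_space.
      \<exists>t\<in>{0..T}. \<epsilon>' < \<bar>simple_integral (n k) (\<tau> k) (\<xi> k) \<omega> t - I \<omega> t\<bar>}) \<longlonglongrightarrow> 0"
    if T: "0 < T" and \<epsilon>': "0 < \<epsilon>'" for T \<epsilon>' :: real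
  proof -
    define \<epsilon> where "\<epsilon> = \<epsilon>' / 3"
    have \<epsilon>: "0 < \<epsilon>" "\<epsilon>' = 3 * \<epsilon>" using \<epsilon>' by (auto simp: \<epsilon>_def)
    define J where "J k \<omega> = simple_integral (n k) (\<tau> k) (\<xi> k) \<omega>" for k \<omega>
    define m where "m k = nat \<lfloor>T * N k\<rfloor>" for k
    define \<zeta> where "\<zeta> k i \<omega> = X \<omega> (\<tau> k i) * exp_remainder \<sigma> (1 / N k) (\<omega> (\<tau> k (Suc i)) - \<omega> (\<tau> k i))" for k i \<omega>
    have m: "real (m k) \<le> T * N k" for k using T N(1)[of k] by (simp add: m_def)
    have \<tau>T: "\<tau> k j \<le> T" if "j \<le> m k" for j k
      using m[of k] that N(1)[of k] by (simp add: \<tau>_def pos_divide_le_eq order_trans[of "real j" "real (m k)"])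
    \<comment> \<open>The tolerance \<open>3 * \<epsilon>\<close> is spent in steps: passing from
      all times in \<open>U\<close> to grid times in \<open>V\<close> costs
      \<open>\<epsilon>\<close>, discarding the drift error between \<open>V\<close> and
      \<open>R\<close> costs another, and the martingale sum in \<open>R\<close> keeps the
      last.\<close>
    define U where "U k = {\<omega>\<in>path_space. \<exists>t\<in>{0..T}. 3 * \<epsilon> < \<bar>J k \<omega> t - I \<omega> t\<bar>}" for k
    define V where "V k = {\<omega>\<in>path_space. \<exists>j\<in>{..m k}. 2 * \<epsilon> < \<bar>J k \<omega> (\<tau> k j) - I \<omega> (\<tau> k j)\<bar>}" for k
    define R where "R k = {\<omega>\<in>path_space. \<exists>j\<le>m k. \<epsilon> < \<bar>\<Sum>i<j. \<zeta> k i \<omega>\<bar>}" for k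
    have Us: "U k \<in> sets Q" for k
      unfolding U_def J_def by (rule sets_simple_integral_sup[OF simp I])
    have Vs: "V k \<in> sets Q" for k
    proof -
      have "{\<omega>\<in>space Q. \<exists>j\<in>{..m k}. 2 * \<epsilon> < \<bar>J k \<omega> (\<tau> k j) - I \<omega> (\<tau> k j)\<bar>} \<in> sets Q"
      proof (rule sets.sets_Collect_finite_Ex)
        fix j
        have "(\<lambda>\<omega>. \<bar>J k \<omega> (\<tau> k j) - I \<omega> (\<tau> k j)\<bar>) \<in> borel_measurable Q"
        proof (intro borel_measurable_abs borel_measurable_diff)
          show "(\<lambda>\<omega>. J k \<omega> (\<tau> k j)) \<in> borel_measurable Q"
            unfolding J_def by (rule measurable_F_Q[OF simple_integral_adapted[OF simp \<tau>0]])
          show "(\<lambda>\<omega>. I \<omega> (\<tau> k j)) \<in> borel_measurable Q"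
            by (rule measurable_F_Q[of _ "\<tau> k j"]) (use I(1) \<tau>0 in \<open>simp add: adapted_def\<close>)
        qed
        then show "{\<omega>\<in>space Q. 2 * \<epsilon> < \<bar>J k \<omega> (\<tau> k j) - I \<omega> (\<tau> k j)\<bar>} \<in> sets Q"
          by (intro borel_measurable_less borel_measurable_const)
      qed simp
      then show ?thesis by (simp add: V_def space_wiener)
    qed
    have \<zeta>Q: "\<zeta> k i \<in> borel_measurable Q" for k i
      unfolding \<zeta>_def[abs_def]
    proof (rule borel_measurable_times)
      show "(\<lambda>\<omega>. X \<omega> (\<tau> k i)) \<in> borel_measurable Q" by (rule measurable_F_Q[OF Xm[OF \<tau>0]])
      show "(\<lambda>\<omega>. exp_remainder \<sigma> (1 / N k) (\<omega> (\<tau> k (Suc i)) - \<omega> (\<tau> k i))) \<in> borel_measurable Q"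
        by (rule measurable_F_Q[OF increment_measurable_F[OF \<tau>0 less_imp_le[OF \<tau>inc]]])
           (unfold exp_remainder_def, measurable)
    qed
    have Rs: "R k \<in> sets Q" for k
    proof -
      have "{\<omega>\<in>space Q. \<exists>j\<in>{..m k}. \<epsilon> < \<bar>\<Sum>i<j. \<zeta> k i \<omega>\<bar>} \<in> sets Q"
        by (intro sets.sets_Collect_finite_Ex borel_measurable_less borel_measurable_const borel_measurable_abs
            borel_measurable_sum \<zeta>Q) auto
      moreover have "R k = {\<omega>\<in>space Q. \<exists>j\<in>{..m k}. \<epsilon> < \<bar>\<Sum>i<j. \<zeta> k i \<omega>\<bar>}" by (auto simp: R_def space_wiener)
      ultimately show ?thesis by simp
    qed
    have R_lim: "(\<lambda>k. Q.prob (R k)) \<longlonglongrightarrow> 0"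
      unfolding R_def \<zeta>_def
    proof (rule martingale_sum_tendsto_0[where v = "\<lambda>k i. (\<sigma>\<^sup>2 * (1 / N k))\<^sup>2"
          and a = "\<lambda>k i \<omega>. X \<omega> (\<tau> k i)" and \<phi> = "\<lambda>k i. exp_remainder \<sigma> (1 / N k)"])
      fix k i
      show "(\<lambda>\<omega>. X \<omega> (\<tau> k i)) \<in> borel_measurable (F (\<tau> k i))" by (rule Xm[OF \<tau>0])
      show "exp_remainder \<sigma> (1 / N k) \<in> borel_measurable borel"
        unfolding exp_remainder_def[abs_def] by measurable
      note mom = exp_remainder_moments[OF \<tau>0[of k i] \<tau>inc[of k i], of \<sigma>, unfolded \<tau>S]
      show "has_bochner_integral Q (\<lambda>\<omega>. exp_remainder \<sigma> (1 / N k) (\<omega> (\<tau> k (Suc i)) - \<omega> (\<tau> k i))) 0" by (rule mom)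
      show "integrable Q (\<lambda>\<omega>. (exp_remainder \<sigma> (1 / N k) (\<omega> (\<tau> k (Suc i)) - \<omega> (\<tau> k i)))\<^sup>2)"
        by (rule integrable.intros[OF mom(2)])
      show "Q.expectation (\<lambda>\<omega>. (exp_remainder \<sigma> (1 / N k) (\<omega> (\<tau> k (Suc i)) - \<omega> (\<tau> k i)))\<^sup>2) \<le> (\<sigma>\<^sup>2 * (1 / N k))\<^sup>2"
        unfolding has_bochner_integral_integral_eq[OF mom(2)] by (rule small[OF \<sigma>h])
      show "0 < (\<sigma>\<^sup>2 * (1 / N k))\<^sup>2" using \<sigma>h(1) by (rule zero_less_power)
    next
      show "AE \<omega> in P. (\<lambda>k. \<Sum>i<m k. (X \<omega> (\<tau> k i))\<^sup>2 * (\<sigma>\<^sup>2 * (1 / N k))\<^sup>2) \<longlonglongrightarrow> 0"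
      proof (rule AE_I2)
        fix \<omega> assume "\<omega> \<in> space P"
        then have \<omega>: "\<omega> \<in> path_space" by (simp add: space_wiener)
        have "continuous_on {0..T} (X \<omega>)" unfolding X_def[abs_def] by (intro continuous_on_mult cM cG \<omega>)
        then obtain B where B: "0 < B" "\<And>r. r \<in> {0..T} \<Longrightarrow> \<bar>X \<omega> r\<bar> \<le> B" using bounded_Icc by metis
        \<comment> \<open>At most \<open>T * N k\<close> terms of order
          \<open>(1 / N k)\<^sup>2\<close> add up to order \<open>1 / N k\<close>.\<close>
        have bd: "(\<Sum>i<m k. (X \<omega> (\<tau> k i))\<^sup>2 * (\<sigma>\<^sup>2 * (1 / N k))\<^sup>2) \<le> B\<^sup>2 * \<sigma>^4 * T * (1 / N k)" for k
        proof -
          have "(\<Sum>i<m k. (X \<omega> (\<tau> k i))\<^sup>2 * (\<sigma>\<^sup>2 * (1 / N k))\<^sup>2) \<le> (\<Sum>i<m k. B\<^sup>2 * (\<sigma>\<^sup>2 * (1 / N k))\<^sup>2)"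
          proof (intro sum_mono mult_right_mono)
            fix i assume "i \<in> {..<m k}"
            then have "\<bar>X \<omega> (\<tau> k i)\<bar> \<le> B" using \<tau>T[of i k] \<tau>0[of k i] by (intro B) auto
            from power_mono[OF this, of 2] show "(X \<omega> (\<tau> k i))\<^sup>2 \<le> B\<^sup>2" by simp
          qed simp
          also have "\<dots> = real (m k) * (B\<^sup>2 * (\<sigma>\<^sup>2 * (1 / N k))\<^sup>2)" by simp
          also have "\<dots> \<le> (T * N k) * (B\<^sup>2 * (\<sigma>\<^sup>2 * (1 / N k))\<^sup>2)" using m by (intro mult_right_mono) auto
          also have "\<dots> = B\<^sup>2 * \<sigma>^4 * T * (1 / N k)"
            using N(1)[of k] by (simp add: field_simps power2_eq_square power4_eq_xxxx)
          finally show ?thesis .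
        qed
        show "(\<lambda>k. \<Sum>i<m k. (X \<omega> (\<tau> k i))\<^sup>2 * (\<sigma>\<^sup>2 * (1 / N k))\<^sup>2) \<longlonglongrightarrow> 0"
        proof (rule tendsto_sandwich[OF _ _ tendsto_const])
          show "(\<lambda>k. B\<^sup>2 * \<sigma>^4 * T * (1 / N k)) \<longlonglongrightarrow> 0" using tendsto_mult_right_zero[OF h_lim] by simp
          show "\<forall>\<^sub>F k in sequentially. 0 \<le> (\<Sum>i<m k. (X \<omega> (\<tau> k i))\<^sup>2 * (\<sigma>\<^sup>2 * (1 / N k))\<^sup>2)"
            by (intro always_eventually allI sum_nonneg) auto
        qed (intro always_eventually allI bd)
      qed
    qed (use \<tau>0 \<tau>inc \<epsilon> in auto)
    have UV: "(\<lambda>k. Q.prob (U k - V k)) \<longlonglongrightarrow> 0"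
    proof (rule prob_tendsto_0)
      show "U k - V k \<in> sets Q" for k using Us Vs by (rule sets.Diff)
      show "AE \<omega> in P. \<forall>\<^sub>F k in sequentially. \<omega> \<notin> U k - V k"
      proof (rule AE_I2)
        fix \<omega> assume "\<omega> \<in> space P"
        then have \<omega>: "\<omega> \<in> path_space" by (simp add: space_wiener)
        obtain B where B: "0 < B" "\<And>r. r \<in> {0..T} \<Longrightarrow> \<bar>H \<omega> r\<bar> \<le> B" using bounded_Icc[OF cHT[OF \<omega>]] by metis
        \<comment> \<open>Between grid points the simple integral moves by at most
          \<open>B * (\<epsilon> / (2 * B))\<close> and \<open>I\<close> by at most
          \<open>\<epsilon> / 2\<close>, together \<open>\<epsilon>\<close>.\<close>
        obtain d1 where d1: "0 < d1" "\<And>s t. s \<in> {0..T} \<Longrightarrow> t \<in> {0..T} \<Longrightarrow> \<bar>s - t\<bar> \<le> d1 \<Longrightarrow> \<bar>\<omega> s - \<omega> t\<bar> \<le> \<epsilon> / (2 * B)"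
          using uniformly_continuous_Icc[OF cW[OF \<omega>], of "\<epsilon> / (2 * B)" T] \<epsilon> B(1) by auto
        obtain d2 where d2: "0 < d2" "\<And>s t. s \<in> {0..T} \<Longrightarrow> t \<in> {0..T} \<Longrightarrow> \<bar>s - t\<bar> \<le> d2 \<Longrightarrow> \<bar>I \<omega> s - I \<omega> t\<bar> \<le> \<epsilon> / 2"
          using uniformly_continuous_Icc[OF cI[OF \<omega>], of "\<epsilon> / 2" T] \<epsilon> by auto
        show "\<forall>\<^sub>F k in sequentially. \<omega> \<notin> U k - V k"
          using ev_N[of T] ev_h[OF d1(1)] ev_h[OF d2(1)] \<xi>_eq[OF \<omega>, of T]
        proof eventually_elim
          case (elim k)
          show ?case
          proof
            assume UV: "\<omega> \<in> U k - V k"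
            then obtain t where t: "0 \<le> t" "t \<le> T" "3 * \<epsilon> < \<bar>J k \<omega> t - I \<omega> t\<bar>" by (auto simp: U_def)
            define j where "j = nat \<lfloor>t * N k\<rfloor>"
            have tN: "0 \<le> t * N k" using t N(1)[of k] by simp
            then have j: "real j \<le> t * N k" "t * N k < real j + 1" unfolding j_def by linarith+
            have "t * N k \<le> T * N k" using t N(1)[of k] by (intro mult_right_mono) auto
            then have jm: "j \<le> m k" unfolding j_def m_def by (intro nat_mono floor_mono)
            have "T * N k < N k * N k" using elim(1) N[of k] by (intro mult_strict_right_mono) auto
            then have "real j < real (n k)" using j \<open>t * N k \<le> T * N k\<close> Nn[of k] by linarith
            then have jn: "j < n k" by simp
            have tj: "\<tau> k j \<le> t" "t < \<tau> k (Suc j)" using j N(1)[of k] by (simp_all add: \<tau>_def field_simps)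
            have near: "\<bar>t - \<tau> k j\<bar> \<le> d1" "\<bar>t - \<tau> k j\<bar> \<le> d2" using tj \<tau>S[of k j] elim(2,3) by linarith+
            have in_T: "t \<in> {0..T}" "\<tau> k j \<in> {0..T}" using t tj \<tau>0[of k j] by auto
            have J: "\<bar>J k \<omega> t - J k \<omega> (\<tau> k j)\<bar> \<le> \<epsilon> / 2"
            proof (cases "\<tau> k j = t")
              case False
              then have lt: "\<tau> k j < t" using tj by simp
              have gap: "\<tau> k i \<le> \<tau> k j \<or> t \<le> \<tau> k i" for i
              proof (cases "i \<le> j")
                case True then show ?thesis using N(1)[of k] by (simp add: \<tau>_def divide_right_mono)
              next
                case False
                then have "\<tau> k (Suc j) \<le> \<tau> k i" using N(1)[of k] unfolding \<tau>_def by (intro divide_right_mono) auto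
                then show ?thesis using tj by simp
              qed
              have "J k \<omega> t - J k \<omega> (\<tau> k j) = H \<omega> (\<tau> k j) * (\<omega> t - \<omega> (\<tau> k j))"
                unfolding J_def simple_integral_increment[OF simp lt gap]
                using simple_process_eq[OF simp jn lt less_imp_le[OF tj(2)]] elim(4) tj(1) t(2) by simp
              also have "\<bar>\<dots>\<bar> \<le> B * (\<epsilon> / (2 * B))"
                unfolding abs_mult using B(2)[OF in_T(2)] d1(2)[OF in_T near(1)] B(1) by (intro mult_mono) auto
              also have "\<dots> = \<epsilon> / 2" using B(1) by simp
              finally show ?thesis .
            qed (use \<epsilon> in simp)
            have "\<bar>J k \<omega> (\<tau> k j) - I \<omega> (\<tau> k j)\<bar> \<le> 2 * \<epsilon>" using UV \<omega> jm by (auto simp: V_def not_less)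
            then show False using J d2(2)[OF in_T near(2)] t(3) by linarith
          qed
        qed
      qed
    qed
    have VR: "(\<lambda>k. Q.prob (V k - R k)) \<longlonglongrightarrow> 0"
    proof (rule prob_tendsto_0)
      show "V k - R k \<in> sets Q" for k using Vs Rs by (rule sets.Diff)
      show "AE \<omega> in P. \<forall>\<^sub>F k in sequentially. \<omega> \<notin> V k - R k"
        using g I_eq AE_space
      proof eventually_elim
        case (elim \<omega>)
        from elim(3) have \<omega>: "\<omega> \<in> path_space" by (simp add: space_wiener)
        have gi: "set_integrable lborel {0..T} (g \<omega>)" and GT: "\<And>t. 0 \<le> t \<Longrightarrow> G \<omega> t = G \<omega> 0 + primitive (g \<omega>) t"
          using elim(1) less_imp_le[OF T] by blast+
        have It: "\<And>t. 0 \<le> t \<Longrightarrow> I \<omega> t = X \<omega> t - G \<omega> 0 - primitive (\<lambda>s. M \<omega> s * g \<omega> s) t"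
          using elim(2) unfolding X_def M_def by blast
        define A where "A = primitive (\<lambda>s. \<bar>g \<omega> s\<bar>) T"
        have A: "0 \<le> A" unfolding A_def by (rule primitive_nonneg) simp
        define e where "e = \<epsilon> / (A + 1)"
        have e: "0 < e" "e * A \<le> \<epsilon>" using \<epsilon> A by (auto simp: e_def field_simps)
        obtain d where d: "0 < d" "\<And>s t. s \<in> {0..T} \<Longrightarrow> t \<in> {0..T} \<Longrightarrow> \<bar>s - t\<bar> \<le> d \<Longrightarrow> \<bar>M \<omega> s - M \<omega> t\<bar> \<le> e"
          using uniformly_continuous_Icc[OF cM[OF \<omega>] e(1)] by metis
        show ?case
          using ev_N[of T] ev_h[OF d(1)] \<xi>_eq[OF \<omega>, of T]
        proof eventually_elim
          case (elim k)
          show ?case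
          proof
            assume VR: "\<omega> \<in> V k - R k"
            then obtain j where j: "j \<le> m k" "2 * \<epsilon> < \<bar>J k \<omega> (\<tau> k j) - I \<omega> (\<tau> k j)\<bar>" by (auto simp: V_def)
            have Rj: "\<bar>\<Sum>i<j. \<zeta> k i \<omega>\<bar> \<le> \<epsilon>" using VR \<omega> j(1) by (auto simp: R_def not_less)
            have "T * N k < N k * N k" using elim(1) N[of k] by (intro mult_strict_right_mono) auto
            then have "real (m k) < real (n k)" using m[of k] Nn[of k] by linarith
            then have mn: "m k < n k" by simp
            define p where "p = \<tau> k"
            have p: "0 \<le> p i" "p i < p (Suc i)" "p (Suc i) - p i = 1 / N k" for i using \<tau>0 \<tau>inc \<tau>S by (auto simp: p_def)
            have p0: "p 0 = 0" by (simp add: p_def \<tau>_def)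
            have pT: "p (Suc i) \<le> T" if "i < j" for i using \<tau>T[of "Suc i" k] that j(1) by (simp add: p_def)
            have gap: "\<tau> k l \<le> p i \<or> p (Suc i) \<le> \<tau> k l" for i l
              using N(1)[of k] by (cases "l \<le> i") (auto simp: p_def \<tau>_def intro!: divide_right_mono)
            have J: "J k \<omega> (p j) = (\<Sum>i<j. H \<omega> (p i) * (\<omega> (p (Suc i)) - \<omega> (p i)))"
              unfolding J_def
            proof (subst simple_integral_grid[OF simp p(2) p0 gap], rule sum.cong)
              fix i assume i: "i \<in> {..<j}"
              have "p i \<le> T" using pT[of i] p(2)[of i] i by simp
              then have "simple_process (n k) (\<tau> k) (\<xi> k) \<omega> (p (Suc i)) = H \<omega> (p i)"
                using simple_process_eq[OF simp, of i k "p (Suc i)" \<omega>] i j(1) mn elim(3) p(2)[of i] by (simp add: p_def)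
              then show "simple_process (n k) (\<tau> k) (\<xi> k) \<omega> (p (Suc i)) * (\<omega> (p (Suc i)) - \<omega> (p i))
                = H \<omega> (p i) * (\<omega> (p (Suc i)) - \<omega> (p i))" by simp
            qed simp
            define K where "K = primitive (\<lambda>s. M \<omega> s * g \<omega> s)"
            define \<eta> where "\<eta> i = M \<omega> (p (Suc i)) * (primitive (g \<omega>) (p (Suc i)) - primitive (g \<omega>) (p i))
              - (K (p (Suc i)) - K (p i))" for i
            \<comment> \<open>An exact identity: the increment of \<open>M G\<close> is the left-end
              value of \<open>G\<close> times the increment of \<open>M\<close>, plus the right-end
              value of \<open>M\<close> times the increment of \<open>G\<close>. The right-end
              factor looks ahead, which does no harm because \<open>\<eta>\<close> is estimated path
              by path.\<close>
            have inc: "I \<omega> (p (Suc i)) - I \<omega> (p i) = \<zeta> k i \<omega> + H \<omega> (p i) * (\<omega> (p (Suc i)) - \<omega> (p i)) + \<eta> i" for i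
            proof -
              have "M \<omega> (p (Suc i)) = M \<omega> (p i) * exp (- \<sigma> * (\<omega> (p (Suc i)) - \<omega> (p i)) - \<sigma>\<^sup>2 * (p (Suc i) - p i) / 2)"
                unfolding M_def exp_martingale_def exp_add[symmetric] by (simp add: algebra_simps diff_divide_distrib)
              then have E: "M \<omega> (p i) * exp_remainder \<sigma> (1 / N k) (\<omega> (p (Suc i)) - \<omega> (p i))
                = M \<omega> (p (Suc i)) - M \<omega> (p i) + \<sigma> * M \<omega> (p i) * (\<omega> (p (Suc i)) - \<omega> (p i))"
                unfolding p(3) exp_remainder_def by (simp add: algebra_simps)
              have "\<zeta> k i \<omega> = G \<omega> (p i) * (M \<omega> (p i) * exp_remainder \<sigma> (1 / N k) (\<omega> (p (Suc i)) - \<omega> (p i)))"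
                by (simp add: \<zeta>_def X_def p_def)
              moreover have "I \<omega> (p (Suc i)) - I \<omega> (p i) = X \<omega> (p (Suc i)) - X \<omega> (p i) - (K (p (Suc i)) - K (p i))"
                using It[OF p(1)[of i]] It[OF p(1)[of "Suc i"]] by (simp add: K_def)
              moreover have "primitive (g \<omega>) (p (Suc i)) - primitive (g \<omega>) (p i) = G \<omega> (p (Suc i)) - G \<omega> (p i)"
                using GT[OF p(1)[of i]] GT[OF p(1)[of "Suc i"]] by simp
              then have "\<eta> i = M \<omega> (p (Suc i)) * (G \<omega> (p (Suc i)) - G \<omega> (p i)) - (K (p (Suc i)) - K (p i))"
                by (simp only: \<eta>_def)
              ultimately show ?thesis unfolding E H_def X_def by (simp add: algebra_simps)
            qed
            have I0: "I \<omega> (p 0) = 0" using It[of 0] \<omega> by (simp add: p0 X_def M_def exp_martingale_def path_space_def)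
            have "I \<omega> (p j) - I \<omega> (p 0) = (\<Sum>i<j. I \<omega> (p (Suc i)) - I \<omega> (p i))" by (rule sum_lessThan_telescope[symmetric])
            also have "\<dots> = (\<Sum>i<j. \<zeta> k i \<omega>) + J k \<omega> (p j) + (\<Sum>i<j. \<eta> i)"
              unfolding inc J by (simp add: sum.distrib)
            finally have eq: "J k \<omega> (p j) - I \<omega> (p j) = - (\<Sum>i<j. \<zeta> k i \<omega>) - (\<Sum>i<j. \<eta> i)" using I0 by simp
            have "\<bar>\<Sum>i<j. \<eta> i\<bar> \<le> (\<Sum>i<j. \<bar>\<eta> i\<bar>)" by (rule sum_abs)
            also have "\<dots> \<le> (\<Sum>i<j. e * (primitive (\<lambda>s. \<bar>g \<omega> s\<bar>) (p (Suc i)) - primitive (\<lambda>s. \<bar>g \<omega> s\<bar>) (p i)))"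
            proof (rule sum_mono)
              fix i assume i: "i \<in> {..<j}"
              show "\<bar>\<eta> i\<bar> \<le> e * (primitive (\<lambda>s. \<bar>g \<omega> s\<bar>) (p (Suc i)) - primitive (\<lambda>s. \<bar>g \<omega> s\<bar>) (p i))"
                unfolding \<eta>_def K_def
              proof (rule primitive_riemann_stieltjes[OF gi cM[OF \<omega>] p(1) less_imp_le[OF p(2)]])
                show "p (Suc i) \<le> T" using pT i by simp
                fix r assume r: "p i \<le> r" "r \<le> p (Suc i)"
                have "\<bar>p (Suc i) - r\<bar> \<le> d" using r p(3)[of i] elim(2) by linarith
                then show "\<bar>M \<omega> (p (Suc i)) - M \<omega> r\<bar> \<le> e"
                  using r p(1)[of i] p(1)[of "Suc i"] pT[of i] i by (intro d(2)) auto
              qed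
            qed
            also have "\<dots> = e * (primitive (\<lambda>s. \<bar>g \<omega> s\<bar>) (p j) - primitive (\<lambda>s. \<bar>g \<omega> s\<bar>) (p 0))"
              unfolding sum_distrib_left[symmetric] by (subst sum_lessThan_telescope) simp
            also have "\<dots> \<le> e * A"
            proof -
              have "primitive (\<lambda>s. \<bar>g \<omega> s\<bar>) (p j) \<le> A"
                unfolding A_def by (rule primitive_mono[OF set_integrable_abs[OF gi]]) (use p(1) \<tau>T[OF j(1)] in \<open>auto simp: p_def\<close>)
              then show ?thesis using e(1) by (simp add: p0)
            qed
            finally have "\<bar>\<Sum>i<j. \<eta> i\<bar> \<le> \<epsilon>" using e(2) by linarith
            then show False using eq Rj j(2) unfolding p_def by linarith
          qed
        qed
      qed
    qed
    have "(\<lambda>k. Q.prob (U k)) \<longlonglongrightarrow> 0"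
    proof (rule prob_subset_tendsto_0)
      show "\<forall>\<^sub>F k in sequentially. U k \<subseteq> ((U k - V k) \<union> (V k - R k)) \<union> R k" by (intro always_eventually) blast
      show "((U k - V k) \<union> (V k - R k)) \<union> R k \<in> sets Q" for k using Us Vs Rs by (intro sets.Un sets.Diff)
      show "(\<lambda>k. Q.prob (((U k - V k) \<union> (V k - R k)) \<union> R k)) \<longlonglongrightarrow> 0"
        by (intro prob_Un_tendsto_0 sets.Un sets.Diff Us Vs Rs UV VR R_lim)
    qed
    then show ?thesis by (simp add: U_def J_def \<epsilon>(2))
  qed
  then show ?thesis
    unfolding ito_integral_def
    using pH H2 I simp integrand AE_space[of P]
    by (intro conjI exI[of _ n] exI[of _ \<tau>] exI[of _ \<xi>])
       (auto simp: H_def[abs_def] X_def M_def space_wiener elim!: eventually_mono)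
qed

end

section \<open>Grids and approximating integrands\<close>

text \<open>Equidistant points and the points of \<open>A\<close> in \<open>{0..T}\<close> are
  merged and sorted. A given partition may stop before \<open>T\<close> or run beyond it, so the
  last condition speaks about all of \<open>A\<close>: none of its points lies strictly inside a
  cell.\<close>

lemma refine_grid:
  fixes A :: "real set" and T \<delta> :: real
  assumes A: "finite A" and T: "0 < T" and \<delta>: "0 < \<delta>"
  obtains r :: nat and p :: "nat \<Rightarrow> real" where "p 0 = 0" "p r = T"
    "\<And>i. i < r \<Longrightarrow> p i < p (Suc i)" "\<And>i. i < r \<Longrightarrow> p (Suc i) - p i \<le> \<delta>"
    "\<And>i a. i < r \<Longrightarrow> a \<in> A \<Longrightarrow> a \<le> p i \<or> p (Suc i) \<le> a"
proof -
  obtain N :: nat where N0: "T / \<delta> < real N" using reals_Archimedean2 by blast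
  have "0 < T / \<delta>" using T \<delta> by simp
  then have N: "0 < real N" using N0 by linarith
  moreover have "T / real N \<le> \<delta>" using N N0 \<delta> by (simp add: field_simps)
  ultimately have N: "0 < real N" "T / real N \<le> \<delta>" by auto
  define D where "D = ({0..T} \<inter> A) \<union> (\<lambda>i. T * real i / real N) ` {..N}"
  have D: "finite D" "0 \<in> D" "T \<in> D" "\<And>a. a \<in> D \<Longrightarrow> 0 \<le> a \<and> a \<le> T"
  proof -
    show "finite D" using A by (simp add: D_def)
    show "0 \<in> D" unfolding D_def by (rule UnI2, rule image_eqI[of _ _ 0]) auto
    show "T \<in> D" unfolding D_def by (rule UnI2, rule image_eqI[of _ _ N]) (use N in auto)
    fix a assume "a \<in> D"
    then consider "a \<in> {0..T}" | i where "i \<le> N" "a = T * real i / real N" by (auto simp: D_def)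
    then show "0 \<le> a \<and> a \<le> T"
    proof cases
      case 2
      then have "T * real i \<le> T * real N" using T by (intro mult_left_mono) auto
      then show ?thesis using 2 N T by (simp add: pos_divide_le_eq)
    qed simp
  qed
  define l where "l = sorted_list_of_set D"
  have setl: "set l = D" unfolding l_def by (rule set_sorted_list_of_set[OF D(1)])
  have sl: "sorted_wrt (<) l" unfolding l_def by (rule strict_sorted_list_of_set)
  define r where "r = length l - 1"
  have len: "length l = Suc r" using setl D(2) by (cases l) (auto simp: r_def)
  have mono: "l ! i < l ! j" if "i < j" "j \<le> r" for i j
    using sl that len by (simp add: sorted_wrt_iff_nth_less)
  have inD: "l ! i \<in> D" if "i \<le> r" for i using nth_mem[of i l] that len setl by simp
  have index: "\<exists>i\<le>r. l ! i = a" if "a \<in> D" for a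
    using that len setl by (auto simp: in_set_conv_nth less_Suc_eq_le)
  have gap: "a \<le> l ! i \<or> l ! Suc i \<le> a" if "i < r" "a \<in> D" for i a
  proof -
    obtain k where k: "k \<le> r" "l ! k = a" using index[OF \<open>a \<in> D\<close>] by blast
    show ?thesis
    proof (cases "k \<le> i")
      case True
      then show ?thesis using mono[of k i] k that by (cases "k = i") auto
    next
      case False
      then show ?thesis using mono[of "Suc i" k] k that by (cases "k = Suc i") auto
    qed
  qed
  show ?thesis
  proof (rule that[of "\<lambda>i. l ! i" r])
    obtain i where i: "i \<le> r" "l ! i = 0" using index[OF D(2)] by blast
    show "l ! 0 = 0" using mono[of 0 i] i D(4)[OF inD[of 0]] by (cases "i = 0") auto
    obtain j where j: "j \<le> r" "l ! j = T" using index[OF D(3)] by blast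
    show "l ! r = T" using mono[of j r] j D(4)[OF inD[of r]] by (cases "j = r") auto
    show "l ! i < l ! Suc i" if "i < r" for i using mono[of i "Suc i"] that by simp
    show "a \<le> l ! i \<or> l ! Suc i \<le> a" if "i < r" "a \<in> A" for i a
    proof (cases "a \<in> {0..T}")
      case True
      then show ?thesis using gap[of i a] that by (simp add: D_def)
    next
      case False
      then show ?thesis using D(4)[OF inD[of i]] D(4)[OF inD[of "Suc i"]] that by auto
    qed
    show "l ! Suc i - l ! i \<le> \<delta>" if i: "i < r" for i
    proof (rule ccontr)
      assume "\<not> ?thesis"
      then have big: "\<delta> < l ! Suc i - l ! i" by simp
      \<comment> \<open>The first equidistant point beyond \<open>l ! i\<close> has the index
        \<open>Suc j\<close>; a cell longer than \<open>\<delta>\<close> would contain it strictly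
        inside.\<close>
      define j where "j = nat \<lfloor>l ! i * real N / T\<rfloor>"
      have li: "0 \<le> l ! i" "l ! Suc i \<le> T" using D(4)[OF inD[of i]] D(4)[OF inD[of "Suc i"]] i by auto
      have nn: "0 \<le> l ! i * real N / T" using li T N by simp
      have j: "real j \<le> l ! i * real N / T" "l ! i * real N / T < real j + 1" unfolding j_def using nn by linarith+
      define a where "a = T * real (Suc j) / real N"
      have a1: "l ! i < a" using j(2) T N by (simp add: a_def field_simps)
      have "T * real j / real N \<le> l ! i" using j(1) T N by (simp add: field_simps)
      moreover have "a = T * real j / real N + T / real N" by (simp add: a_def add_divide_distrib algebra_simps)
      ultimately have a2: "a < l ! Suc i" using big N(2) by linarith
      then have "a < T" using li(2) by linarith
      then have "T * real (Suc j) < T * real N" using N(1) unfolding a_def by (simp only: pos_divide_less_eq)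
      then have "Suc j < N" using T by simp
      then have "a \<in> D" unfolding D_def a_def by (intro UnI2 imageI) simp
      then show False using gap[OF i, of a] a1 a2 by auto
    qed
  qed
qed

context wiener_measure
begin

lemma simple_process_const:
  assumes gap: "\<And>l. l \<le> n \<Longrightarrow> \<tau> l \<le> a \<or> b \<le> \<tau> l" and s: "a < s" "s \<le> b"
  shows "simple_process n \<tau> \<xi> \<omega> s = simple_process n \<tau> \<xi> \<omega> b"
  unfolding simple_process_def
proof (rule sum.cong)
  fix l assume "l \<in> {..<n}"
  then have "\<tau> l < s \<longleftrightarrow> \<tau> l < b" "s \<le> \<tau> (Suc l) \<longleftrightarrow> b \<le> \<tau> (Suc l)"
    using gap[of l] gap[of "Suc l"] s by auto
  then show "\<xi> l \<omega> * indicator {\<tau> l<..\<tau> (Suc l)} s = \<xi> l \<omega> * indicator {\<tau> l<..\<tau> (Suc l)} b"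
    by (simp add: indicator_def)
qed simp

text \<open>On a cell the simple process is constant, so its distance from the left-end value of
  \<open>H\<close> may be averaged over the cell and split, by
  \<open>(u + v)\<^sup>2 \<le> 2 * u\<^sup>2 + 2 * v\<^sup>2\<close>, into the integrated error and
  the oscillation of \<open>H\<close>. This turns the time integral in the definition of the Ito
  integral into a grid sum.\<close>

lemma simple_process_error_sum:
  fixes H :: "real \<Rightarrow> real"
  assumes p: "p 0 = 0" "p r = T" "\<And>i. i < r \<Longrightarrow> p i < p (Suc i)"
    and gap: "\<And>i l. i < r \<Longrightarrow> l \<le> n \<Longrightarrow> \<tau> l \<le> p i \<or> p (Suc i) \<le> \<tau> l"
    and H: "continuous_on {0..T} H"
    and err: "(\<integral>\<^sup>+ s\<in>{0..T}. ennreal ((simple_process n \<tau> \<xi> \<omega> s - H s)\<^sup>2) \<partial>lborel) \<le> ennreal \<eta>" and \<eta>: "0 \<le> \<eta>"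
    and osc: "\<And>i s. i < r \<Longrightarrow> p i \<le> s \<Longrightarrow> s \<le> p (Suc i) \<Longrightarrow> \<bar>H s - H (p i)\<bar> \<le> e"
  shows "(\<Sum>i<r. (simple_process n \<tau> \<xi> \<omega> (p (Suc i)) - H (p i))\<^sup>2 * (p (Suc i) - p i)) \<le> 2 * \<eta> + 2 * e\<^sup>2 * T"
proof -
  define f where "f s = (simple_process n \<tau> \<xi> \<omega> s - H s)\<^sup>2" for s
  have pmono: "p i \<le> p j" if "i \<le> j" "j \<le> r" for i j
    by (rule grid_mono[of r p, OF p(3) that])
  have pT: "0 \<le> p i" "p i \<le> T" if "i \<le> r" for i using pmono[of 0 i] pmono[of i r] p(1,2) that by auto
  have T: "0 \<le> T" using pT[of 0] p(1) by simp
  have "(\<lambda>s. (indicator {0..T} s * simple_process n \<tau> \<xi> \<omega> s - indicator {0..T} s * H s)\<^sup>2) \<in> borel_measurable lborel"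
  proof -
    have "simple_process n \<tau> \<xi> \<omega> \<in> borel_measurable borel" unfolding simple_process_def[abs_def] by measurable
    moreover have "(\<lambda>s. indicator {0..T} s * H s) \<in> borel_measurable borel"
      using borel_measurable_continuous_on_indicator[OF _ H] by simp
    ultimately show ?thesis by measurable
  qed
  also have "(\<lambda>s. (indicator {0..T} s * simple_process n \<tau> \<xi> \<omega> s - indicator {0..T} s * H s)\<^sup>2) = (\<lambda>s. indicator {0..T} s *\<^sub>R f s)"
    by (auto simp: indicator_def f_def)
  finally have fm: "(\<lambda>s. indicator {0..T} s *\<^sub>R f s) \<in> borel_measurable lborel" .
  have nn: "(\<integral>\<^sup>+ s. ennreal (indicator {0..T} s *\<^sub>R f s) \<partial>lborel) = (\<integral>\<^sup>+ s\<in>{0..T}. ennreal (f s) \<partial>lborel)"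
    by (rule nn_integral_cong) (auto simp: indicator_def)
  have f_int: "set_integrable lborel {0..T} f"
    unfolding set_integrable_def
  proof (rule integrableI_nonneg[OF fm])
    show "AE s in lborel. 0 \<le> indicator {0..T} s *\<^sub>R f s" by (auto simp: f_def)
    show "(\<integral>\<^sup>+ s. ennreal (indicator {0..T} s *\<^sub>R f s) \<partial>lborel) < \<infinity>"
      unfolding nn infinity_ennreal_def using le_less_trans[OF err ennreal_less_top] by (simp only: f_def)
  qed
  have "ennreal (primitive f T) = (\<integral>\<^sup>+ s. ennreal (indicator {0..T} s *\<^sub>R f s) \<partial>lborel)"
    unfolding primitive_def set_lebesgue_integral_def
    by (rule nn_integral_eq_integral[symmetric]) (use f_int in \<open>auto simp: set_integrable_def f_def\<close>)
  then have "ennreal (primitive f T) \<le> ennreal \<eta>" unfolding nn using err by (simp add: f_def)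
  then have pf: "primitive f T \<le> \<eta>" using \<eta> by (simp add: ennreal_le_iff)
  have "(simple_process n \<tau> \<xi> \<omega> (p (Suc i)) - H (p i))\<^sup>2 * (p (Suc i) - p i)
      \<le> 2 * (primitive f (p (Suc i)) - primitive f (p i)) + 2 * e\<^sup>2 * (p (Suc i) - p i)" if i: "i < r" for i
  proof -
    define c where "c = simple_process n \<tau> \<xi> \<omega> (p (Suc i)) - H (p i)"
    have st: "0 \<le> p i" "p i \<le> p (Suc i)" "p (Suc i) \<le> T" using pT[of i] pT[of "Suc i"] p(3)[OF i] i by auto
    have sub: "{p i<..p (Suc i)} \<subseteq> {0..T}" using st by auto
    have fi: "set_integrable lborel {p i<..p (Suc i)} f" by (rule set_integrable_subset[OF f_int _ sub]) simp
    have ci: "set_integrable lborel {p i<..p (Suc i)} (\<lambda>s. q)" for q :: real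
    proof -
      have "integrable lborel (indicator {p i<..p (Suc i)} :: real \<Rightarrow> real)"
        by (rule integrable_real_indicator) (use st in auto)
      then show ?thesis unfolding set_integrable_def by simp
    qed
    have meas: "(LINT s:{p i<..p (Suc i)}|lborel. q) = q * (p (Suc i) - p i)" for q
      using st by (simp add: set_lebesgue_integral_def)
    have "c\<^sup>2 * (p (Suc i) - p i) = (LINT s:{p i<..p (Suc i)}|lborel. c\<^sup>2)" by (simp only: meas)
    also have "\<dots> \<le> (LINT s:{p i<..p (Suc i)}|lborel. 2 * f s + 2 * e\<^sup>2)"
    proof (rule set_integral_mono)
      show "set_integrable lborel {p i<..p (Suc i)} (\<lambda>s. c\<^sup>2)" by (rule ci)
      show "set_integrable lborel {p i<..p (Suc i)} (\<lambda>s. 2 * f s + 2 * e\<^sup>2)"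
        by (intro set_integral_add set_integrable_mult_right fi ci)
      fix s assume s: "s \<in> {p i<..p (Suc i)}"
      have "simple_process n \<tau> \<xi> \<omega> s = simple_process n \<tau> \<xi> \<omega> (p (Suc i))"
        by (rule simple_process_const[OF gap[OF i]]) (use s in auto)
      then have c: "c = (simple_process n \<tau> \<xi> \<omega> s - H s) + (H s - H (p i))" by (simp add: c_def)
      have "(H s - H (p i))\<^sup>2 \<le> e\<^sup>2" using osc[OF i, of s] s by (simp add: power2_le_iff_abs_le[symmetric] abs_le_square_iff[symmetric] order_trans[OF _ abs_ge_self])
      moreover have "(u + v)\<^sup>2 \<le> 2 * u\<^sup>2 + 2 * v\<^sup>2" for u v :: real
        using zero_le_power2[of "u - v"] by (simp add: power2_eq_square algebra_simps)
      ultimately show "c\<^sup>2 \<le> 2 * f s + 2 * e\<^sup>2"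
        unfolding c f_def by (meson add_left_mono mult_left_mono order_trans zero_le_numeral)
    qed
    also have "\<dots> = 2 * (primitive f (p (Suc i)) - primitive f (p i)) + 2 * e\<^sup>2 * (p (Suc i) - p i)"
      using fi ci by (subst set_integral_add(2)) (auto simp: meas primitive_diff[OF f_int st])
    finally show ?thesis by (simp add: c_def)
  qed
  then have "(\<Sum>i<r. (simple_process n \<tau> \<xi> \<omega> (p (Suc i)) - H (p i))\<^sup>2 * (p (Suc i) - p i))
    \<le> (\<Sum>i<r. 2 * (primitive f (p (Suc i)) - primitive f (p i)) + 2 * e\<^sup>2 * (p (Suc i) - p i))"
    by (intro sum_mono) simp
  also have "\<dots> = 2 * primitive f T + 2 * e\<^sup>2 * T"
    unfolding sum.distrib sum_distrib_left[symmetric]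
    by (subst (1 2) sum_lessThan_telescope) (simp add: p)
  finally show ?thesis using pf by simp
qed

text \<open>The threshold \<open>1 / (m + 1)\<close> is paired with a probability below
  \<open>(1 / 2) ^ m\<close>. These are summable, so Borel-Cantelli applies, with a threshold that
  shrinks along the subsequence.\<close>

lemma in_probability_subsequence:
  assumes E: "\<And>\<epsilon> k. 0 < \<epsilon> \<Longrightarrow> E \<epsilon> k \<in> sets Q"
    and lim: "\<And>\<epsilon>. 0 < \<epsilon> \<Longrightarrow> (\<lambda>k. Q.prob (E \<epsilon> k)) \<longlonglongrightarrow> 0"
  obtains \<kappa> :: "nat \<Rightarrow> nat" where "AE \<omega> in P. \<forall>\<^sub>F m in sequentially. \<omega> \<notin> E (1 / real (Suc m)) (\<kappa> m)"
proof -
  have "\<exists>k. Q.prob (E (1 / real (Suc m)) k) < (1 / 2) ^ m" for m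
  proof -
    have "\<forall>\<^sub>F k in sequentially. Q.prob (E (1 / real (Suc m)) k) < (1 / 2) ^ m"
      by (rule order_tendstoD(2)[OF lim]) auto
    then show ?thesis by (auto simp: eventually_sequentially)
  qed
  then obtain \<kappa> where \<kappa>: "\<And>m. Q.prob (E (1 / real (Suc m)) (\<kappa> m)) < (1 / 2) ^ m" by metis
  have "AE \<omega> in Q. \<forall>\<^sub>F m in sequentially. \<omega> \<in> space Q - E (1 / real (Suc m)) (\<kappa> m)"
  proof (rule borel_cantelli_AE1)
    show "E (1 / real (Suc m)) (\<kappa> m) \<in> sets Q" for m by (rule E) simp
    show "emeasure Q (E (1 / real (Suc m)) (\<kappa> m)) < \<infinity>" for m by (simp add: Q.emeasure_eq_measure)
    show "summable (\<lambda>m. Q.prob (E (1 / real (Suc m)) (\<kappa> m)))"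
      by (rule summable_comparison_test'[OF summable_geometric[of "1/2::real"], of 0])
         (use \<kappa> less_imp_le in \<open>auto simp: abs_of_nonneg[OF measure_nonneg]\<close>)
  qed
  then have "AE \<omega> in Q. \<forall>\<^sub>F m in sequentially. \<omega> \<notin> E (1 / real (Suc m)) (\<kappa> m)"
    by eventually_elim (auto elim: eventually_mono)
  then show ?thesis using that by (simp add: AE_completion_iff)
qed

end

lemma abs_sum_mult_le:
  fixes a c q :: "nat \<Rightarrow> real"
  assumes "\<And>i. i < r \<Longrightarrow> \<bar>a i\<bar> \<le> A" "\<And>i. i < r \<Longrightarrow> \<bar>c i\<bar> \<le> q i"
  shows "\<bar>\<Sum>i<r. a i * c i\<bar> \<le> A * (\<Sum>i<r. q i)"
proof -
  have "\<bar>\<Sum>i<r. a i * c i\<bar> \<le> (\<Sum>i<r. \<bar>a i * c i\<bar>)" by (rule sum_abs)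
  also have "\<dots> \<le> (\<Sum>i<r. A * q i)"
  proof (rule sum_mono)
    fix i assume "i \<in> {..<r}"
    then have "\<bar>a i\<bar> \<le> A" "\<bar>c i\<bar> \<le> q i" using assms[of i] by auto
    then show "\<bar>a i * c i\<bar> \<le> A * q i" unfolding abs_mult by (intro mult_mono) auto
  qed
  finally show ?thesis by (simp add: sum_distrib_left)
qed

text \<open>
  The discrete form of \<open>d(Y L) = L b dt\<close> along one path: after subtracting the centred sums, which
  are martingales, everything else vanishes as the mesh tends to zero. The numbers \<open>c\<close> and \<open>c'\<close>
  stand for the means of \<^const>\<open>inv_remainder\<close> and \<^const>\<open>inv_linear\<close> at the increments of \<open>W\<close>.
\<close>

lemma quotient_path_limits:
  fixes W Y I b :: "real \<Rightarrow> real" and \<sigma> T y0 :: real and r :: "nat \<Rightarrow> nat"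
    and p h c c' :: "nat \<Rightarrow> nat \<Rightarrow> real" and J :: "nat \<Rightarrow> real \<Rightarrow> real" and \<delta> \<epsilon> :: "nat \<Rightarrow> real"
  assumes \<sigma>: "0 < \<sigma>" and T: "0 < T"
    and cont: "continuous_on {0..T} W" "continuous_on {0..T} Y" "continuous_on {0..T} I"
    and W0: "W 0 = 0"
    and b: "set_integrable lborel {0..T} b"
    and eq: "\<And>t. 0 \<le> t \<Longrightarrow> t \<le> T \<Longrightarrow> Y t = y0 + primitive b t + I t"
    and p: "\<And>m. p m 0 = 0" "\<And>m. p m (r m) = T" "\<And>m i. i < r m \<Longrightarrow> p m i < p m (Suc i)"
    and mesh: "\<And>m i. i < r m \<Longrightarrow> p m (Suc i) - p m i \<le> \<delta> m" "\<delta> \<longlonglongrightarrow> 0"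
    and J0: "\<And>m. J m 0 = 0"
    and J: "\<And>m i. i < r m \<Longrightarrow> J m (p m (Suc i)) - J m (p m i) = h m i * (W (p m (Suc i)) - W (p m i))"
    and Jerr: "\<forall>\<^sub>F m in sequentially. \<forall>t\<in>{0..T}. \<bar>J m t - I t\<bar> \<le> \<epsilon> m" "\<epsilon> \<longlonglongrightarrow> 0"
    and herr: "(\<lambda>m. \<Sum>i<r m. (h m i + \<sigma> * Y (p m i))\<^sup>2 * (p m (Suc i) - p m i)) \<longlonglongrightarrow> 0"
    and c: "\<And>m i. i < r m \<Longrightarrow> \<bar>c m i\<bar> \<le> (\<sigma>\<^sup>2 * (p m (Suc i) - p m i))\<^sup>2"
    and c': "\<And>m i. i < r m \<Longrightarrow> \<bar>c' m i\<bar> \<le> 2 * \<sigma> * (p m (Suc i) - p m i)"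
  defines "L \<equiv> \<lambda>t. exp (\<sigma> * W t + \<sigma>\<^sup>2 * t / 2)"
    and "y \<equiv> \<lambda>m i. Y (p m i) - I (p m i) + J m (p m i)"
  defines "d \<equiv> \<lambda>m i. h m i + \<sigma> * y m i"
  shows "(\<lambda>m. \<Sum>i<r m. (L (p m i) * y m i)\<^sup>2 * (\<sigma>\<^sup>2 * (p m (Suc i) - p m i))\<^sup>2) \<longlonglongrightarrow> 0" (is ?A)
    and "(\<lambda>m. \<Sum>i<r m. (L (p m i) * d m i)\<^sup>2 * (2 * (p m (Suc i) - p m i))) \<longlonglongrightarrow> 0" (is ?B)
    and "(\<lambda>m. Y T * L T - y0 - primitive (\<lambda>s. L s * b s) T
      - (\<Sum>i<r m. L (p m i) * y m i * (inv_remainder \<sigma> (p m (Suc i) - p m i) (W (p m (Suc i)) - W (p m i)) - c m i))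
      - (\<Sum>i<r m. L (p m i) * d m i * (inv_linear \<sigma> (p m (Suc i) - p m i) (W (p m (Suc i)) - W (p m i)) - c' m i)))
      \<longlonglongrightarrow> 0" (is ?C)
proof -
  define h' where "h' m i = p m (Suc i) - p m i" for m i
  have cL: "continuous_on {0..T} L" unfolding L_def by (intro continuous_intros cont) auto
  obtain LB where LB: "0 < LB" "\<And>t. t \<in> {0..T} \<Longrightarrow> \<bar>L t\<bar> \<le> LB" using bounded_Icc[OF cL] by metis
  obtain YB where YB: "0 < YB" "\<And>t. t \<in> {0..T} \<Longrightarrow> \<bar>Y t\<bar> \<le> YB" using bounded_Icc[OF cont(2)] by metis
  have pmono: "p m i \<le> p m j" if "i \<le> j" "j \<le> r m" for m i j
    by (rule grid_mono[of "r m" "p m", OF p(3) that])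
  have pT: "p m i \<in> {0..T}" if "i \<le> r m" for m i
    using pmono[of 0 i m] pmono[of i "r m" m] p(1,2)[of m] that by auto
  have h'0: "0 < h' m i" if "i < r m" for m i using p(3)[OF that] by (simp add: h'_def)
  have h'\<delta>: "h' m i \<le> \<delta> m" if "i < r m" for m i using mesh(1)[OF that] by (simp add: h'_def)
  have sum_h': "(\<Sum>i<r m. h' m i) = T" for m
    unfolding h'_def by (subst sum_lessThan_telescope) (simp add: p)
  have sq: "(\<Sum>i<r m. (h' m i)\<^sup>2) \<le> T * \<delta> m" for m
  proof -
    have "(\<Sum>i<r m. (h' m i)\<^sup>2) \<le> (\<Sum>i<r m. h' m i * \<delta> m)"
    proof (rule sum_mono)
      fix i assume "i \<in> {..<r m}"
      then show "(h' m i)\<^sup>2 \<le> h' m i * \<delta> m"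
        unfolding power2_eq_square using h'0[of i m] h'\<delta>[of i m] by (intro mult_left_mono) auto
    qed
    then show ?thesis unfolding sum_distrib_right[symmetric] sum_h' .
  qed
  \<comment> \<open>The 1 absorbs the distance between \<open>J\<close> and \<open>I\<close>, which
    is eventually below 1; so for large \<open>m\<close> the values \<open>y\<close> are bounded
    along the grid.\<close>
  define A where "A = LB * (YB + 1)"
  have ev1: "\<forall>\<^sub>F m in sequentially. \<epsilon> m < 1" by (rule order_tendstoD(2)[OF Jerr(2)]) simp
  have ybd: "\<forall>\<^sub>F m in sequentially. \<forall>i\<le>r m. \<bar>L (p m i) * y m i\<bar> \<le> A"
    using Jerr(1) ev1
  proof eventually_elim
    case (elim m)
    show ?case
    proof (intro allI impI)
      fix i assume "i \<le> r m"
      then have i: "p m i \<in> {0..T}" by (rule pT)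
      have "\<bar>J m (p m i) - I (p m i)\<bar> \<le> 1" using elim i by force
      then have "\<bar>y m i\<bar> \<le> YB + 1" using YB(2)[OF i] unfolding y_def by linarith
      then show "\<bar>L (p m i) * y m i\<bar> \<le> A"
        unfolding A_def abs_mult using LB(1) LB(2)[OF i] by (intro mult_mono) auto
    qed
  qed
  have A0: "0 \<le> A" using LB YB by (simp add: A_def)
  show ?A
    unfolding h'_def[symmetric]
  proof (rule tendsto_sandwich[OF _ _ tendsto_const])
    show "(\<lambda>m. A\<^sup>2 * (\<sigma>\<^sup>2)\<^sup>2 * (T * \<delta> m)) \<longlonglongrightarrow> 0" by (intro tendsto_mult_right_zero mesh)
    show "\<forall>\<^sub>F m in sequentially. 0 \<le> (\<Sum>i<r m. (L (p m i) * y m i)\<^sup>2 * (\<sigma>\<^sup>2 * h' m i)\<^sup>2)"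
      by (intro always_eventually allI sum_nonneg) auto
    show "\<forall>\<^sub>F m in sequentially. (\<Sum>i<r m. (L (p m i) * y m i)\<^sup>2 * (\<sigma>\<^sup>2 * h' m i)\<^sup>2) \<le> A\<^sup>2 * (\<sigma>\<^sup>2)\<^sup>2 * (T * \<delta> m)"
      using ybd
    proof eventually_elim
      case (elim m)
      have "(\<Sum>i<r m. (L (p m i) * y m i)\<^sup>2 * (\<sigma>\<^sup>2 * h' m i)\<^sup>2) \<le> (\<Sum>i<r m. A\<^sup>2 * (\<sigma>\<^sup>2 * h' m i)\<^sup>2)"
      proof (intro sum_mono mult_right_mono)
        fix i assume "i \<in> {..<r m}"
        then have "\<bar>L (p m i) * y m i\<bar> \<le> A" using elim by auto
        from power_mono[OF this, of 2] show "(L (p m i) * y m i)\<^sup>2 \<le> A\<^sup>2" by simp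
      qed simp
      also have "\<dots> = A\<^sup>2 * (\<sigma>\<^sup>2)\<^sup>2 * (\<Sum>i<r m. (h' m i)\<^sup>2)" by (simp add: power_mult_distrib sum_distrib_left mult.assoc)
      also have "\<dots> \<le> A\<^sup>2 * (\<sigma>\<^sup>2)\<^sup>2 * (T * \<delta> m)" by (intro mult_left_mono sq) auto
      finally show ?case .
    qed
  qed
  \<comment> \<open>\<open>d\<close> compares the simple integrand with
    \<open>- \<sigma> * y\<close>, while the assumption compares it with
    \<open>- \<sigma> * Y\<close>. The two differ by \<open>\<sigma> * (J - I)\<close>, which is
    uniformly small.\<close>
  define D where "D m = (\<Sum>i<r m. (d m i)\<^sup>2 * h' m i)" for m
  have D0: "0 \<le> D m" for m unfolding D_def using h'0 by (intro sum_nonneg mult_nonneg_nonneg) (auto intro: less_imp_le)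
  have D_lim: "D \<longlonglongrightarrow> 0"
  proof (rule tendsto_sandwich[OF _ _ tendsto_const])
    have "(\<lambda>m. 2 * (\<Sum>i<r m. (h m i + \<sigma> * Y (p m i))\<^sup>2 * h' m i) + 2 * \<sigma>\<^sup>2 * T * (\<epsilon> m)\<^sup>2) \<longlonglongrightarrow> 2 * 0 + 2 * \<sigma>\<^sup>2 * T * 0\<^sup>2"
      by (intro tendsto_intros herr[folded h'_def] Jerr(2))
    then show "(\<lambda>m. 2 * (\<Sum>i<r m. (h m i + \<sigma> * Y (p m i))\<^sup>2 * h' m i) + 2 * \<sigma>\<^sup>2 * T * (\<epsilon> m)\<^sup>2) \<longlonglongrightarrow> 0" by simp
    show "\<forall>\<^sub>F m in sequentially. 0 \<le> D m" using D0 by simp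
    show "\<forall>\<^sub>F m in sequentially. D m \<le> 2 * (\<Sum>i<r m. (h m i + \<sigma> * Y (p m i))\<^sup>2 * h' m i) + 2 * \<sigma>\<^sup>2 * T * (\<epsilon> m)\<^sup>2"
      using Jerr(1)
    proof eventually_elim
      case (elim m)
      have "D m \<le> (\<Sum>i<r m. (2 * (h m i + \<sigma> * Y (p m i))\<^sup>2 + 2 * \<sigma>\<^sup>2 * (\<epsilon> m)\<^sup>2) * h' m i)"
        unfolding D_def
      proof (intro sum_mono mult_right_mono)
        fix i assume i: "i \<in> {..<r m}"
        show "0 \<le> h' m i" using h'0[of i m] i by simp
        define u where "u = h m i + \<sigma> * Y (p m i)"
        define w where "w = \<sigma> * (J m (p m i) - I (p m i))"
        have dm: "d m i = u + w" by (simp add: d_def y_def u_def w_def algebra_simps)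
        have "(d m i)\<^sup>2 \<le> 2 * u\<^sup>2 + 2 * w\<^sup>2"
          using zero_le_power2[of "u - w"] unfolding dm by (simp add: power2_eq_square algebra_simps)
        moreover have "w\<^sup>2 \<le> \<sigma>\<^sup>2 * (\<epsilon> m)\<^sup>2"
        proof -
          have "\<bar>J m (p m i) - I (p m i)\<bar> \<le> \<epsilon> m" using elim pT[of i m] i by auto
          from power_mono[OF this, of 2] have "(J m (p m i) - I (p m i))\<^sup>2 \<le> (\<epsilon> m)\<^sup>2" by simp
          then show ?thesis unfolding w_def power_mult_distrib by (intro mult_left_mono) auto
        qed
        ultimately show "(d m i)\<^sup>2 \<le> 2 * (h m i + \<sigma> * Y (p m i))\<^sup>2 + 2 * \<sigma>\<^sup>2 * (\<epsilon> m)\<^sup>2"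
          unfolding u_def by linarith
      qed
      also have "\<dots> = 2 * (\<Sum>i<r m. (h m i + \<sigma> * Y (p m i))\<^sup>2 * h' m i) + 2 * \<sigma>\<^sup>2 * (\<epsilon> m)\<^sup>2 * (\<Sum>i<r m. h' m i)"
        by (simp add: distrib_right sum.distrib sum_distrib_left mult.assoc)
      also have "\<dots> = 2 * (\<Sum>i<r m. (h m i + \<sigma> * Y (p m i))\<^sup>2 * h' m i) + 2 * \<sigma>\<^sup>2 * T * (\<epsilon> m)\<^sup>2"
        unfolding sum_h' by simp
      finally show ?case .
    qed
  qed
  show ?B
    unfolding h'_def[symmetric]
  proof (rule tendsto_sandwich[OF _ _ tendsto_const])
    show "(\<lambda>m. 2 * LB\<^sup>2 * D m) \<longlonglongrightarrow> 0" by (intro tendsto_mult_right_zero D_lim)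
    show "\<forall>\<^sub>F m in sequentially. 0 \<le> (\<Sum>i<r m. (L (p m i) * d m i)\<^sup>2 * (2 * h' m i))"
      using h'0 by (intro always_eventually allI sum_nonneg mult_nonneg_nonneg) (auto intro: less_imp_le)
    show "\<forall>\<^sub>F m in sequentially. (\<Sum>i<r m. (L (p m i) * d m i)\<^sup>2 * (2 * h' m i)) \<le> 2 * LB\<^sup>2 * D m"
    proof (intro always_eventually allI)
      fix m
      have "(\<Sum>i<r m. (L (p m i) * d m i)\<^sup>2 * (2 * h' m i)) \<le> (\<Sum>i<r m. LB\<^sup>2 * (d m i)\<^sup>2 * (2 * h' m i))"
      proof (intro sum_mono mult_right_mono)
        fix i assume i: "i \<in> {..<r m}"
        show "0 \<le> 2 * h' m i" using h'0[of i m] i by simp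
        have "\<bar>L (p m i)\<bar> \<le> LB" using LB(2) pT[of i m] i by simp
        from power_mono[OF this, of 2] show "(L (p m i) * d m i)\<^sup>2 \<le> LB\<^sup>2 * (d m i)\<^sup>2"
          unfolding power_mult_distrib by (intro mult_right_mono) auto
      qed
      also have "\<dots> = 2 * LB\<^sup>2 * D m" unfolding D_def sum_distrib_left by (rule sum.cong) auto
      finally show "(\<Sum>i<r m. (L (p m i) * d m i)\<^sup>2 * (2 * h' m i)) \<le> 2 * LB\<^sup>2 * D m" .
    qed
  qed
  \<comment> \<open>The bias \<open>c\<close> is of second order in the step, so bounded
    coefficients suffice.\<close>
  have S1: "(\<lambda>m. \<Sum>i<r m. L (p m i) * y m i * c m i) \<longlonglongrightarrow> 0"
  proof (rule tendsto_rabs_zero_cancel, rule tendsto_sandwich[OF _ _ tendsto_const])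
    show "(\<lambda>m. A * ((\<sigma>\<^sup>2)\<^sup>2 * (T * \<delta> m))) \<longlonglongrightarrow> 0" by (intro tendsto_mult_right_zero mesh)
    show "\<forall>\<^sub>F m in sequentially. \<bar>\<Sum>i<r m. L (p m i) * y m i * c m i\<bar> \<le> A * ((\<sigma>\<^sup>2)\<^sup>2 * (T * \<delta> m))"
      using ybd
    proof eventually_elim
      case (elim m)
      have "\<bar>\<Sum>i<r m. L (p m i) * y m i * c m i\<bar> \<le> A * (\<Sum>i<r m. (\<sigma>\<^sup>2 * h' m i)\<^sup>2)"
        unfolding h'_def by (rule abs_sum_mult_le) (use elim c in auto)
      also have "(\<Sum>i<r m. (\<sigma>\<^sup>2 * h' m i)\<^sup>2) = (\<sigma>\<^sup>2)\<^sup>2 * (\<Sum>i<r m. (h' m i)\<^sup>2)"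
        by (simp add: power_mult_distrib sum_distrib_left)
      also have "A * \<dots> \<le> A * ((\<sigma>\<^sup>2)\<^sup>2 * (T * \<delta> m))" by (intro mult_left_mono sq A0) auto
      finally show ?case .
    qed
  qed simp
  \<comment> \<open>The bias \<open>c'\<close> is only of first order, so the smallness must come
    from \<open>d\<close>: Cauchy-Schwarz bounds the sum by a multiple of
    \<open>sqrt (T * D m)\<close>.\<close>
  have S2: "(\<lambda>m. \<Sum>i<r m. L (p m i) * d m i * c' m i) \<longlonglongrightarrow> 0"
  proof (rule tendsto_rabs_zero_cancel, rule tendsto_sandwich[OF _ _ tendsto_const])
    have "(\<lambda>m. LB * (2 * \<sigma>) * sqrt (T * D m)) \<longlonglongrightarrow> LB * (2 * \<sigma>) * sqrt (T * 0)"
      by (intro tendsto_intros D_lim)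
    then show "(\<lambda>m. LB * (2 * \<sigma>) * sqrt (T * D m)) \<longlonglongrightarrow> 0" by simp
    show "\<forall>\<^sub>F m in sequentially. \<bar>\<Sum>i<r m. L (p m i) * d m i * c' m i\<bar> \<le> LB * (2 * \<sigma>) * sqrt (T * D m)"
    proof (intro always_eventually allI)
      fix m
      have "(\<Sum>i<r m. \<bar>d m i\<bar> * h' m i)\<^sup>2 = (\<Sum>i<r m. (\<bar>d m i\<bar> * sqrt (h' m i)) * sqrt (h' m i))\<^sup>2"
        by (intro arg_cong[where f = "\<lambda>x. x\<^sup>2"] sum.cong) (use h'0 in \<open>auto simp: mult.assoc less_imp_le\<close>)
      also have "\<dots> \<le> (\<Sum>i<r m. (\<bar>d m i\<bar> * sqrt (h' m i))\<^sup>2) * (\<Sum>i<r m. (sqrt (h' m i))\<^sup>2)"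
        by (rule Cauchy_Schwarz_ineq_sum)
      also have "(\<Sum>i<r m. (\<bar>d m i\<bar> * sqrt (h' m i))\<^sup>2) = D m"
        unfolding D_def by (rule sum.cong) (use h'0 in \<open>auto simp: power_mult_distrib less_imp_le\<close>)
      also have "(\<Sum>i<r m. (sqrt (h' m i))\<^sup>2) = T"
        unfolding sum_h'[of m, symmetric] by (rule sum.cong) (use h'0 in \<open>auto simp: less_imp_le\<close>)
      finally have CS: "(\<Sum>i<r m. \<bar>d m i\<bar> * h' m i) \<le> sqrt (T * D m)"
        by (intro real_le_rsqrt) (simp add: mult.commute)
      have "\<bar>\<Sum>i<r m. L (p m i) * (d m i * c' m i)\<bar> \<le> LB * (\<Sum>i<r m. 2 * \<sigma> * (\<bar>d m i\<bar> * h' m i))"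
      proof (rule abs_sum_mult_le)
        fix i assume i: "i < r m"
        show "\<bar>L (p m i)\<bar> \<le> LB" using LB(2) pT[of i m] i by simp
        show "\<bar>d m i * c' m i\<bar> \<le> 2 * \<sigma> * (\<bar>d m i\<bar> * h' m i)"
          using mult_left_mono[OF c'[OF i], of "\<bar>d m i\<bar>"] by (simp add: abs_mult h'_def algebra_simps)
      qed
      also have "\<dots> = LB * (2 * \<sigma>) * (\<Sum>i<r m. \<bar>d m i\<bar> * h' m i)"
        by (simp add: sum_distrib_left mult.assoc)
      also have "\<dots> \<le> LB * (2 * \<sigma>) * sqrt (T * D m)" using LB(1) \<sigma> by (intro mult_left_mono CS) auto
      finally show "\<bar>\<Sum>i<r m. L (p m i) * d m i * c' m i\<bar> \<le> LB * (2 * \<sigma>) * sqrt (T * D m)" by (simp add: mult.assoc)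
    qed
  qed simp
  define R where "R m = (\<Sum>i<r m. L (p m (Suc i)) * (primitive b (p m (Suc i)) - primitive b (p m i)))" for m
  define K where "K = primitive (\<lambda>s. L s * b s)"
  have S3: "(\<lambda>m. R m - K T) \<longlonglongrightarrow> 0"
  proof (rule LIMSEQ_I)
    fix e :: real assume e: "0 < e"
    define V where "V = primitive (\<lambda>s. \<bar>b s\<bar>) T"
    have V: "0 \<le> V" unfolding V_def by (rule primitive_nonneg) simp
    define e' where "e' = e / (2 * (V + 1))"
    have e': "0 < e'" "e' * V < e"
    proof -
      show "0 < e'" using e V by (simp add: e'_def)
      have "e' * V = e * (V / (2 * (V + 1)))" by (simp add: e'_def)
      also have "\<dots> < e * 1" using e V by (intro mult_strict_left_mono) (auto simp: field_simps)
      finally show "e' * V < e" by simp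
    qed
    obtain q where q: "0 < q" "\<And>s t. s \<in> {0..T} \<Longrightarrow> t \<in> {0..T} \<Longrightarrow> \<bar>s - t\<bar> \<le> q \<Longrightarrow> \<bar>L s - L t\<bar> \<le> e'"
      using uniformly_continuous_Icc[OF cL e'(1)] by metis
    have "\<forall>\<^sub>F m in sequentially. \<delta> m < q" by (rule order_tendstoD(2)[OF mesh(2) q(1)])
    then obtain M where M: "\<And>m. M \<le> m \<Longrightarrow> \<delta> m < q" unfolding eventually_sequentially by blast
    show "\<exists>M. \<forall>m\<ge>M. norm (R m - K T - 0) < e"
    proof (intro exI[of _ M] allI impI)
      fix m assume m: "M \<le> m"
      have KT: "K T = (\<Sum>i<r m. K (p m (Suc i)) - K (p m i))"
        by (subst sum_lessThan_telescope) (simp add: p K_def)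
      define z where "z i = L (p m (Suc i)) * (primitive b (p m (Suc i)) - primitive b (p m i)) - (K (p m (Suc i)) - K (p m i))" for i
      have "R m - K T = (\<Sum>i<r m. z i)"
        unfolding R_def KT z_def sum_subtractf ..
      then have "\<bar>R m - K T\<bar> \<le> (\<Sum>i<r m. \<bar>z i\<bar>)"
        by (simp only: sum_abs)
      also have "\<dots> \<le> (\<Sum>i<r m. e' * (primitive (\<lambda>s. \<bar>b s\<bar>) (p m (Suc i)) - primitive (\<lambda>s. \<bar>b s\<bar>) (p m i)))"
      proof (rule sum_mono)
        fix i assume "i \<in> {..<r m}"
        then have i: "i < r m" by simp
        show "\<bar>z i\<bar> \<le> e' * (primitive (\<lambda>s. \<bar>b s\<bar>) (p m (Suc i)) - primitive (\<lambda>s. \<bar>b s\<bar>) (p m i))"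
          unfolding z_def K_def
        proof (rule primitive_riemann_stieltjes[OF b cL])
          show "0 \<le> p m i" "p m i \<le> p m (Suc i)" "p m (Suc i) \<le> T"
            using pT[of i m] pT[of "Suc i" m] p(3)[OF i] i by auto
          fix s assume s: "p m i \<le> s" "s \<le> p m (Suc i)"
          have "\<bar>p m (Suc i) - s\<bar> \<le> q" using s mesh(1)[OF i] M[OF m] by linarith
          then show "\<bar>L (p m (Suc i)) - L s\<bar> \<le> e'"
            using s pT[of i m] pT[of "Suc i" m] i by (intro q(2)) auto
        qed
      qed
      also have "\<dots> = e' * V"
        unfolding sum_distrib_left[symmetric] by (subst sum_lessThan_telescope) (simp add: p V_def)
      finally show "norm (R m - K T - 0) < e" using e'(2) by (simp only: diff_zero real_norm_def)
    qed
  qed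
  have S4: "(\<lambda>m. (I T - J m T) * L T) \<longlonglongrightarrow> 0"
  proof (rule tendsto_mult_left_zero, rule tendsto_rabs_zero_cancel, rule tendsto_sandwich[OF _ _ tendsto_const Jerr(2)])
    show "\<forall>\<^sub>F m in sequentially. \<bar>I T - J m T\<bar> \<le> \<epsilon> m"
      using Jerr(1) by eventually_elim (use T in \<open>auto simp: abs_minus_commute\<close>)
  qed simp
  \<comment> \<open>No limit is involved here. Summing the one-step changes of \<open>y * L\<close>
    expresses the quantity of the last claim through the four terms just shown to vanish.\<close>
  have exact: "Y T * L T - y0 - K T
      - (\<Sum>i<r m. L (p m i) * y m i * (inv_remainder \<sigma> (h' m i) (W (p m (Suc i)) - W (p m i)) - c m i))
      - (\<Sum>i<r m. L (p m i) * d m i * (inv_linear \<sigma> (h' m i) (W (p m (Suc i)) - W (p m i)) - c' m i))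
    = (I T - J m T) * L T + (R m - K T) + (\<Sum>i<r m. L (p m i) * y m i * c m i) + (\<Sum>i<r m. L (p m i) * d m i * c' m i)" for m
  proof -
    have step: "y m (Suc i) * L (p m (Suc i)) - y m i * L (p m i)
        = L (p m (Suc i)) * (primitive b (p m (Suc i)) - primitive b (p m i))
        + L (p m i) * y m i * inv_remainder \<sigma> (h' m i) (W (p m (Suc i)) - W (p m i))
        + L (p m i) * d m i * inv_linear \<sigma> (h' m i) (W (p m (Suc i)) - W (p m i))" if i: "i < r m" for i
    proof -
      define w where "w = W (p m (Suc i)) - W (p m i)"
      define E where "E = exp (\<sigma> * w + \<sigma>\<^sup>2 * h' m i / 2)"
      have LE: "L (p m (Suc i)) = L (p m i) * E"
        unfolding L_def E_def exp_add[symmetric] w_def h'_def by (simp add: algebra_simps diff_divide_distrib)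
      define B where "B = primitive b (p m (Suc i)) - primitive b (p m i)"
      \<comment> \<open>The reason for introducing \<open>y\<close>: its increment is exactly the
        drift plus \<open>h * w\<close>, whereas the increment of \<open>Y\<close> contains the
        stochastic integral itself.\<close>
      have "y m (Suc i) = y m i + B + h m i * w"
        using eq[of "p m i"] eq[of "p m (Suc i)"] J[OF i] pT[of i m] pT[of "Suc i" m] i
        unfolding y_def B_def w_def by simp
      then show ?thesis
        unfolding w_def[symmetric] B_def[symmetric] LE inv_remainder_def inv_linear_def E_def[symmetric] d_def
        by (simp add: algebra_simps)
    qed
    have y0: "y m 0 * L (p m 0) = y0" using eq[of 0] T by (simp add: y_def p J0 L_def W0)
    have "y m (r m) * L (p m (r m)) - y m 0 * L (p m 0) = (\<Sum>i<r m. y m (Suc i) * L (p m (Suc i)) - y m i * L (p m i))"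
      by (rule sum_lessThan_telescope[symmetric])
    also have "\<dots> = R m + (\<Sum>i<r m. L (p m i) * y m i * inv_remainder \<sigma> (h' m i) (W (p m (Suc i)) - W (p m i)))
      + (\<Sum>i<r m. L (p m i) * d m i * inv_linear \<sigma> (h' m i) (W (p m (Suc i)) - W (p m i)))"
      unfolding R_def sum.distrib[symmetric] by (rule sum.cong) (use step in auto)
    finally have "y m (r m) * L T - y0 = R m
      + (\<Sum>i<r m. L (p m i) * y m i * inv_remainder \<sigma> (h' m i) (W (p m (Suc i)) - W (p m i)))
      + (\<Sum>i<r m. L (p m i) * d m i * inv_linear \<sigma> (h' m i) (W (p m (Suc i)) - W (p m i)))"
      unfolding y0 p(2) .
    moreover have "y m (r m) = Y T - I T + J m T" by (simp add: y_def p)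
    ultimately show ?thesis
      unfolding right_diff_distrib sum_subtractf by (simp add: algebra_simps)
  qed
  show ?C
    unfolding h'_def[symmetric] K_def[symmetric] exact
    using tendsto_add[OF tendsto_add[OF tendsto_add[OF S4 S3] S1] S2] by simp
qed

section \<open>Quotients by the exponential martingale\<close>

context wiener_measure
begin

text \<open>Centring only lowers the second moment, so bounds on raw second moments may serve as the
  weights of the maximal inequality.\<close>

lemma centered_moments:
  fixes X :: "(real \<Rightarrow> real) \<Rightarrow> real" and c s :: real
  assumes X: "has_bochner_integral Q X c" and X2: "has_bochner_integral Q (\<lambda>\<omega>. (X \<omega>)\<^sup>2) s"
  shows "has_bochner_integral Q (\<lambda>\<omega>. X \<omega> - c) 0"
    and "integrable Q (\<lambda>\<omega>. (X \<omega> - c)\<^sup>2)"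
    and "Q.expectation (\<lambda>\<omega>. (X \<omega> - c)\<^sup>2) \<le> s"
proof -
  have const: "has_bochner_integral Q (\<lambda>\<omega>. q) q" for q :: real
    by (simp add: has_bochner_integral_iff prob_space)
  show "has_bochner_integral Q (\<lambda>\<omega>. X \<omega> - c) 0"
    using has_bochner_integral_diff[OF X const[of c]] by simp
  have "has_bochner_integral Q (\<lambda>\<omega>. (X \<omega>)\<^sup>2 - 2 * c * X \<omega> + c\<^sup>2) (s - 2 * c * c + c\<^sup>2)"
    by (intro has_bochner_integral_add has_bochner_integral_diff has_bochner_integral_mult_right X X2 const)
  moreover have "(\<lambda>\<omega>. (X \<omega>)\<^sup>2 - 2 * c * X \<omega> + c\<^sup>2) = (\<lambda>\<omega>. (X \<omega> - c)\<^sup>2)"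
    by (auto simp: power2_eq_square algebra_simps)
  moreover have "s - 2 * c * c + c\<^sup>2 = s - c\<^sup>2" by (simp add: power2_eq_square)
  ultimately have h: "has_bochner_integral Q (\<lambda>\<omega>. (X \<omega> - c)\<^sup>2) (s - c\<^sup>2)" by simp
  show "integrable Q (\<lambda>\<omega>. (X \<omega> - c)\<^sup>2)" by (rule integrable.intros[OF h])
  show "Q.expectation (\<lambda>\<omega>. (X \<omega> - c)\<^sup>2) \<le> s"
    using has_bochner_integral_integral_eq[OF h] by simp
qed

lemma progressively_measurable_mult:
  assumes "progressively_measurable P X" "progressively_measurable P Y"
  shows "progressively_measurable P (\<lambda>\<omega> t. X \<omega> t * Y \<omega> t)"
  unfolding progressively_measurable_def
proof safe
  fix t :: real assume "0 \<le> t"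
  then have "(\<lambda>p. (\<lambda>(\<omega>, s). X \<omega> s) p * (\<lambda>(\<omega>, s). Y \<omega> s) p) \<in> borel_measurable (F t \<Otimes>\<^sub>M restrict_space borel {0..t})"
    using assms by (intro borel_measurable_times) (auto simp: progressively_measurable_def)
  then show "(\<lambda>(\<omega>, s). X \<omega> s * Y \<omega> s) \<in> borel_measurable (F t \<Otimes>\<^sub>M restrict_space borel {0..t})"
    by (simp add: split_beta')
qed

text \<open>\<open>L\<close> is the inverse of the exponential martingale. In \<open>Y * L\<close>
  the noise terms cancel, and the drift \<open>\<sigma>\<^sup>2 * L\<close> of \<open>L\<close>
  cancels against its covariation with \<open>Y\<close>, so only \<open>L * b\<close> is left. On
  the grid these cancellations hold up to two centred sums, which vanish in probability, and errors
  that vanish path by path.\<close>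

lemma quotient_fixed_time:
  assumes \<sigma>: "0 < \<sigma>" and T: "0 < T"
    and Y: "adapted P Y" "continuous_process Y"
    and b: "progressively_measurable P b"
    and b_int: "AE \<omega> in P. set_integrable lborel {0..T} (b \<omega>)"
    and I: "ito_integral P (\<lambda>\<omega> s. - (\<sigma> * Y \<omega> s)) I"
    and eq: "AE \<omega> in P. \<forall>t\<ge>0. Y \<omega> t = y0 + primitive (b \<omega>) t + I \<omega> t"
  defines "L \<equiv> \<lambda>\<omega> t. exp (\<sigma> * \<omega> t + \<sigma>\<^sup>2 * t / 2)"
  shows "AE \<omega> in P. Y \<omega> T * L \<omega> T = y0 + primitive (\<lambda>s. L \<omega> s * b \<omega> s) T"
proof -
  define H where "H \<omega> s = - (\<sigma> * Y \<omega> s)" for \<omega> s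
  have "\<exists>n \<tau> \<xi>. (\<forall>k. simple_integrand P (n k) (\<tau> k) (\<xi> k)) \<and>
       (\<forall>T>0. \<forall>\<epsilon>>0.
         (\<lambda>k. Q.prob {\<omega> \<in> path_space. ennreal \<epsilon> <
            (\<integral>\<^sup>+ s\<in>{0..T}. ennreal ((simple_process (n k) (\<tau> k) (\<xi> k) \<omega> s - H \<omega> s)\<^sup>2) \<partial>lborel)})
           \<longlonglongrightarrow> 0 \<and>
         (\<lambda>k. Q.prob {\<omega> \<in> path_space.
            \<exists>t\<in>{0..T}. \<epsilon> < \<bar>simple_integral (n k) (\<tau> k) (\<xi> k) \<omega> t - I \<omega> t\<bar>})
           \<longlonglongrightarrow> 0)"
    using I unfolding ito_integral_def H_def by (elim conjE)
  then obtain n0 \<tau>0 \<xi>0 where S0: "\<forall>k. simple_integrand P (n0 k) (\<tau>0 k) (\<xi>0 k)"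
    and lims: "\<forall>T>0. \<forall>\<epsilon>>0.
         (\<lambda>k. Q.prob {\<omega> \<in> path_space. ennreal \<epsilon> <
            (\<integral>\<^sup>+ s\<in>{0..T}. ennreal ((simple_process (n0 k) (\<tau>0 k) (\<xi>0 k) \<omega> s - H \<omega> s)\<^sup>2) \<partial>lborel)})
           \<longlonglongrightarrow> 0 \<and>
         (\<lambda>k. Q.prob {\<omega> \<in> path_space.
            \<exists>t\<in>{0..T}. \<epsilon> < \<bar>simple_integral (n0 k) (\<tau>0 k) (\<xi>0 k) \<omega> t - I \<omega> t\<bar>})
           \<longlonglongrightarrow> 0"
    by (elim exE conjE) (rule that)
  note S0 = S0[rule_format]
  note lim1 = lims[rule_format, OF T, THEN conjunct1] and lim2 = lims[rule_format, OF T, THEN conjunct2]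
  have Ic: "adapted P I" "continuous_process I" and Hp: "progressively_measurable P H"
    using I unfolding ito_integral_def H_def by auto
  define E1 where "E1 \<epsilon> k = {\<omega> \<in> path_space. ennreal \<epsilon> <
            (\<integral>\<^sup>+ s\<in>{0..T}. ennreal ((simple_process (n0 k) (\<tau>0 k) (\<xi>0 k) \<omega> s - H \<omega> s)\<^sup>2) \<partial>lborel)}" for \<epsilon> k
  define E2 where "E2 \<epsilon> k = {\<omega> \<in> path_space.
            \<exists>t\<in>{0..T}. \<epsilon> < \<bar>simple_integral (n0 k) (\<tau>0 k) (\<xi>0 k) \<omega> t - I \<omega> t\<bar>}" for \<epsilon> k
  have E1s: "E1 \<epsilon> k \<in> sets Q" for \<epsilon> k
    unfolding E1_def by (rule sets_simple_process_error[OF S0 Hp less_imp_le[OF T]])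
  have E2s: "E2 \<epsilon> k \<in> sets Q" for \<epsilon> k
    unfolding E2_def by (rule sets_simple_integral_sup[OF S0 Ic])
  \<comment> \<open>One subsequence serves the integrands and the integrals together, since on a
    path both kinds of closeness are needed at once.\<close>
  obtain \<kappa> where \<kappa>: "AE \<omega> in P. \<forall>\<^sub>F m in sequentially. \<omega> \<notin> E1 (1 / real (Suc m)) (\<kappa> m) \<union> E2 (1 / real (Suc m)) (\<kappa> m)"
  proof (rule in_probability_subsequence[where E = "\<lambda>\<epsilon> k. E1 \<epsilon> k \<union> E2 \<epsilon> k"])
    show "E1 \<epsilon> k \<union> E2 \<epsilon> k \<in> sets Q" for \<epsilon> k by (intro sets.Un E1s E2s)
    show "(\<lambda>k. Q.prob (E1 \<epsilon> k \<union> E2 \<epsilon> k)) \<longlonglongrightarrow> 0" if "0 < \<epsilon>" for \<epsilon>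
      by (rule prob_Un_tendsto_0[OF E1s E2s]) (unfold E1_def E2_def, rule lim1[OF that], rule lim2[OF that])
  qed (rule that)
  define n \<tau> \<xi> where "n m = n0 (\<kappa> m)" and "\<tau> m = \<tau>0 (\<kappa> m)" and "\<xi> m = \<xi>0 (\<kappa> m)" for m
  have S: "simple_integrand P (n m) (\<tau> m) (\<xi> m)" for m unfolding n_def \<tau>_def \<xi>_def by (rule S0)
  obtain \<rho> :: real where \<rho>: "0 < \<rho>"
    and small0: "\<And>r. 0 < r \<Longrightarrow> r < \<rho> \<Longrightarrow> exp r - 1 - r \<le> r\<^sup>2"
    and small1: "\<And>r. 0 < r \<Longrightarrow> r < \<rho> \<Longrightarrow> \<bar>exp r * (1 - r) - 1\<bar> \<le> r\<^sup>2"
    and small2: "\<And>r. 0 < r \<Longrightarrow> r < \<rho> \<Longrightarrow> exp (3 * r) * ((1 - 2 * r)\<^sup>2 + r) - 2 * exp r * (1 - r) + 1 \<le> r\<^sup>2"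
    and small3: "\<And>r. 0 < r \<Longrightarrow> r < \<rho> \<Longrightarrow> exp r \<le> 2"
    and small4: "\<And>r. 0 < r \<Longrightarrow> r < \<rho> \<Longrightarrow> exp (3 * r) * (1 + 4 * r) \<le> 2"
    by (fact small_moment_bounds)
  obtain k0 :: nat where k0: "\<sigma>\<^sup>2 / \<rho> < real k0" using reals_Archimedean2 by blast
  \<comment> \<open>The shift by \<open>k0\<close> keeps every step within the range of the moment
    bounds, whatever the partition \<open>\<tau> m\<close> is.\<close>
  define \<delta> where "\<delta> m = 1 / real (m + Suc k0)" for m
  have \<delta>0: "0 < \<delta> m" for m by (simp add: \<delta>_def)
  have \<delta>_lim: "\<delta> \<longlonglongrightarrow> 0"
    unfolding \<delta>_def using LIMSEQ_ignore_initial_segment[OF LIMSEQ_inverse_real_of_nat, of k0]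
    by (simp add: inverse_eq_divide)
  have \<delta>\<rho>: "\<sigma>\<^sup>2 * \<delta> m < \<rho>" for m
  proof -
    have "\<sigma>\<^sup>2 / \<rho> < real (m + Suc k0)" using k0 by simp
    then have "\<sigma>\<^sup>2 < real (m + Suc k0) * \<rho>" using \<rho> by (simp only: pos_divide_less_eq)
    then show ?thesis unfolding \<delta>_def by (simp add: pos_divide_less_eq mult.commute del: of_nat_add of_nat_Suc)
  qed
  have "\<forall>m. \<exists>r p. p 0 = 0 \<and> p r = T \<and> (\<forall>i<r. p i < p (Suc i)) \<and> (\<forall>i<r. p (Suc i) - p i \<le> \<delta> m) \<and>
      (\<forall>i<r. \<forall>l\<le>n m. \<tau> m l \<le> p i \<or> p (Suc i) \<le> \<tau> m l)"
  proof
    fix m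
    obtain r p where "p 0 = 0" "p r = T" "\<And>i. i < r \<Longrightarrow> p i < p (Suc i)" "\<And>i. i < r \<Longrightarrow> p (Suc i) - p i \<le> \<delta> m"
      "\<And>i a. i < r \<Longrightarrow> a \<in> \<tau> m ` {..n m} \<Longrightarrow> a \<le> p i \<or> p (Suc i) \<le> a"
      using refine_grid[of "\<tau> m ` {..n m}" T "\<delta> m"] T \<delta>0[of m] by (metis finite_atMost finite_imageI)
    then show "\<exists>r p. p 0 = 0 \<and> p r = T \<and> (\<forall>i<r. p i < p (Suc i)) \<and> (\<forall>i<r. p (Suc i) - p i \<le> \<delta> m) \<and>
      (\<forall>i<r. \<forall>l\<le>n m. \<tau> m l \<le> p i \<or> p (Suc i) \<le> \<tau> m l)"
      by (intro exI[of _ r] exI[of _ p]) (auto intro!: imageI)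
  qed
  then obtain r p where p: "\<And>m. p m 0 = 0" "\<And>m. p m (r m) = T" "\<And>m i. i < r m \<Longrightarrow> p m i < p m (Suc i)"
    and mesh: "\<And>m i. i < r m \<Longrightarrow> p m (Suc i) - p m i \<le> \<delta> m"
    and gap: "\<And>m i l. i < r m \<Longrightarrow> l \<le> n m \<Longrightarrow> \<tau> m l \<le> p m i \<or> p m (Suc i) \<le> \<tau> m l"
    by metis
  have pmono: "p m i \<le> p m j" if "i \<le> j" "j \<le> r m" for m i j
    by (rule grid_mono[of "r m" "p m", OF p(3) that])
  have pT: "0 \<le> p m i" "p m i \<le> T" if "i \<le> r m" for m i
    using pmono[of 0 i m] pmono[of i "r m" m] p(1,2)[of m] that by auto
  define h' where "h' m i = p m (Suc i) - p m i" for m i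
  have h'0: "0 < \<sigma>\<^sup>2 * h' m i" if "i < r m" for m i using p(3)[OF that] \<sigma> by (simp add: h'_def)
  have h'\<rho>: "\<sigma>\<^sup>2 * h' m i < \<rho>" if "i < r m" for m i
  proof -
    have "\<sigma>\<^sup>2 * h' m i \<le> \<sigma>\<^sup>2 * \<delta> m" using mesh[OF that] by (intro mult_left_mono) (auto simp: h'_def)
    then show ?thesis using \<delta>\<rho>[of m] by linarith
  qed
  define J where "J m \<omega> = simple_integral (n m) (\<tau> m) (\<xi> m) \<omega>" for m \<omega>
  define h where "h m \<omega> i = simple_process (n m) (\<tau> m) (\<xi> m) \<omega> (p m (Suc i))" for m \<omega> i
  define y where "y m \<omega> i = Y \<omega> (p m i) - I \<omega> (p m i) + J m \<omega> (p m i)" for m \<omega> i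
  define d where "d m \<omega> i = h m \<omega> i + \<sigma> * y m \<omega> i" for m \<omega> i
  define c where "c m i = exp (\<sigma>\<^sup>2 * h' m i) * (1 - \<sigma>\<^sup>2 * h' m i) - 1" for m i
  define c' where "c' m i = exp (\<sigma>\<^sup>2 * h' m i) * (\<sigma> * h' m i)" for m i
  define X1 where "X1 m \<omega> j = (\<Sum>i<j. L \<omega> (p m i) * y m \<omega> i * (inv_remainder \<sigma> (h' m i) (\<omega> (p m (Suc i)) - \<omega> (p m i)) - c m i))" for m \<omega> j
  define X2 where "X2 m \<omega> j = (\<Sum>i<j. L \<omega> (p m i) * d m \<omega> i * (inv_linear \<sigma> (h' m i) (\<omega> (p m (Suc i)) - \<omega> (p m i)) - c' m i))" for m \<omega> j
  define R where "R \<omega> = Y \<omega> T * L \<omega> T - y0 - primitive (\<lambda>s. L \<omega> s * b \<omega> s) T" for \<omega>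
  have path: "AE \<omega> in P.
      (\<lambda>m. \<Sum>i<r m. (L \<omega> (p m i) * y m \<omega> i)\<^sup>2 * (\<sigma>\<^sup>2 * h' m i)\<^sup>2) \<longlonglongrightarrow> 0 \<and>
      (\<lambda>m. \<Sum>i<r m. (L \<omega> (p m i) * d m \<omega> i)\<^sup>2 * (2 * h' m i)) \<longlonglongrightarrow> 0 \<and>
      (\<lambda>m. R \<omega> - X1 m \<omega> (r m) - X2 m \<omega> (r m)) \<longlonglongrightarrow> 0"
    using \<kappa> b_int eq AE_space
  proof eventually_elim
    case (elim \<omega>)
    from elim(4) have \<omega>: "\<omega> \<in> path_space" by (simp add: space_wiener)
    have c0: "continuous_on {0..T} f" if "continuous_on {0..} f" for f :: "real \<Rightarrow> real"
      by (rule continuous_on_subset[OF that]) auto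
    have cW: "continuous_on {0..T} \<omega>" using \<omega> by (intro c0) (simp add: path_space_def)
    have cY: "continuous_on {0..T} (Y \<omega>)" using \<omega> Y(2) by (intro c0) (simp add: continuous_process_def)
    have cI: "continuous_on {0..T} (I \<omega>)" using \<omega> Ic(2) by (intro c0) (simp add: continuous_process_def)
    have cH: "continuous_on {0..T} (H \<omega>)" unfolding H_def by (intro continuous_intros cY)
    have err1: "\<forall>\<^sub>F m in sequentially. (\<integral>\<^sup>+ s\<in>{0..T}. ennreal ((simple_process (n m) (\<tau> m) (\<xi> m) \<omega> s - H \<omega> s)\<^sup>2) \<partial>lborel)
        \<le> ennreal (1 / real (Suc m))"
      using elim(1) by eventually_elim (use \<omega> in \<open>simp add: E1_def n_def \<tau>_def \<xi>_def not_less\<close>)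
    have err2: "\<forall>\<^sub>F m in sequentially. \<forall>t\<in>{0..T}. \<bar>J m \<omega> t - I \<omega> t\<bar> \<le> 1 / real (Suc m)"
      using elim(1) by eventually_elim (use \<omega> in \<open>simp add: E2_def J_def n_def \<tau>_def \<xi>_def not_less\<close>)
    have lim_Suc: "(\<lambda>m. 1 / real (Suc m)) \<longlonglongrightarrow> 0"
      using LIMSEQ_inverse_real_of_nat by (simp add: inverse_eq_divide)
    have herr: "(\<lambda>m. \<Sum>i<r m. (h m \<omega> i + \<sigma> * Y \<omega> (p m i))\<^sup>2 * (p m (Suc i) - p m i)) \<longlonglongrightarrow> 0"
    proof (rule LIMSEQ_I)
      fix e :: real assume e: "0 < e"
      \<comment> \<open>The oscillation then costs \<open>e / 4\<close>, and the integrated error,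
        once below \<open>e / 4\<close>, enters doubled; together they stay below
        \<open>e\<close>.\<close>
      define q where "q = sqrt (e / (8 * T))"
      have q: "0 < q" "2 * q\<^sup>2 * T = e / 4" using e T by (auto simp: q_def)
      obtain w where w: "0 < w" "\<And>s t. s \<in> {0..T} \<Longrightarrow> t \<in> {0..T} \<Longrightarrow> \<bar>s - t\<bar> \<le> w \<Longrightarrow> \<bar>H \<omega> s - H \<omega> t\<bar> \<le> q"
        using uniformly_continuous_Icc[OF cH q(1)] by metis
      have ev1: "\<forall>\<^sub>F m in sequentially. \<delta> m < w" by (rule order_tendstoD(2)[OF \<delta>_lim w(1)])
      have ev2: "\<forall>\<^sub>F m in sequentially. 1 / real (Suc m) < e / 4" by (rule order_tendstoD(2)[OF lim_Suc]) (use e in simp)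
      have "\<forall>\<^sub>F m in sequentially. (\<Sum>i<r m. (h m \<omega> i + \<sigma> * Y \<omega> (p m i))\<^sup>2 * (p m (Suc i) - p m i)) < e"
        using err1 ev1 ev2
      proof eventually_elim
        case (elim m)
        have osc: "\<bar>H \<omega> s - H \<omega> (p m i)\<bar> \<le> q" if i: "i < r m" and s: "p m i \<le> s" "s \<le> p m (Suc i)" for i s
        proof (rule w(2))
          show "s \<in> {0..T}" "p m i \<in> {0..T}" using pT[of i m] pT[of "Suc i" m] i s by auto
          show "\<bar>s - p m i\<bar> \<le> w" using s mesh[OF i] elim(2) by linarith
        qed
        have "(\<Sum>i<r m. (simple_process (n m) (\<tau> m) (\<xi> m) \<omega> (p m (Suc i)) - H \<omega> (p m i))\<^sup>2 * (p m (Suc i) - p m i))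
          \<le> 2 * (1 / real (Suc m)) + 2 * q\<^sup>2 * T"
          by (rule simple_process_error_sum[where H = "H \<omega>" and p = "p m" and r = "r m", OF p(1) p(2) p(3) gap cH elim(1) _ osc]) simp_all
        then show ?case using elim(3) q(2) e unfolding h_def H_def by simp
      qed
      then obtain M where M: "\<And>m. M \<le> m \<Longrightarrow> (\<Sum>i<r m. (h m \<omega> i + \<sigma> * Y \<omega> (p m i))\<^sup>2 * (p m (Suc i) - p m i)) < e"
        unfolding eventually_sequentially by blast
      show "\<exists>M. \<forall>m\<ge>M. norm ((\<Sum>i<r m. (h m \<omega> i + \<sigma> * Y \<omega> (p m i))\<^sup>2 * (p m (Suc i) - p m i)) - 0) < e"
      proof (intro exI[of _ M] allI impI)
        fix m assume "M \<le> m"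
        have "0 \<le> (\<Sum>i<r m. (h m \<omega> i + \<sigma> * Y \<omega> (p m i))\<^sup>2 * (p m (Suc i) - p m i))"
        proof (intro sum_nonneg mult_nonneg_nonneg)
          fix i assume "i \<in> {..<r m}" then show "0 \<le> p m (Suc i) - p m i" using p(3)[of i m] by simp
        qed simp
        then show "norm ((\<Sum>i<r m. (h m \<omega> i + \<sigma> * Y \<omega> (p m i))\<^sup>2 * (p m (Suc i) - p m i)) - 0) < e"
          using M[OF \<open>M \<le> m\<close>] by (simp only: diff_zero real_norm_def abs_of_nonneg)
      qed
    qed
    have W0: "\<omega> 0 = 0" using \<omega> by (simp add: path_space_def)
    have Jinc: "J m \<omega> (p m (Suc i)) - J m \<omega> (p m i) = h m \<omega> i * (\<omega> (p m (Suc i)) - \<omega> (p m i))" if "i < r m" for m i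
      unfolding J_def h_def by (rule simple_integral_increment[OF S p(3)[OF that] gap[OF that]])
    have J0: "J m \<omega> 0 = 0" for m unfolding J_def by (rule simple_integral_0[OF S])
    have cb: "\<bar>c m i\<bar> \<le> (\<sigma>\<^sup>2 * (p m (Suc i) - p m i))\<^sup>2" if "i < r m" for m i
      unfolding c_def h'_def[symmetric] by (rule small1[OF h'0[OF that] h'\<rho>[OF that]])
    have cb': "\<bar>c' m i\<bar> \<le> 2 * \<sigma> * (p m (Suc i) - p m i)" if "i < r m" for m i
    proof -
      have "0 < h' m i" using p(3)[OF that] by (simp add: h'_def)
      then have "\<bar>c' m i\<bar> = exp (\<sigma>\<^sup>2 * h' m i) * (\<sigma> * h' m i)" using \<sigma> by (simp add: c'_def)
      also have "\<dots> \<le> 2 * (\<sigma> * h' m i)"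
        using small3[OF h'0[OF that] h'\<rho>[OF that]] \<sigma> \<open>0 < h' m i\<close> by (intro mult_right_mono) auto
      finally show ?thesis by (simp add: h'_def)
    qed
    have eqT: "Y \<omega> t = y0 + primitive (b \<omega>) t + I \<omega> t" if "0 \<le> t" "t \<le> T" for t using elim(3) that by blast
    note lims = quotient_path_limits[where W = \<omega> and Y = "Y \<omega>" and I = "I \<omega>" and b = "b \<omega>" and J = "\<lambda>m. J m \<omega>"
        and h = "\<lambda>m. h m \<omega>" and r = r and p = p and c = c and c' = c' and \<sigma> = \<sigma> and T = T and ?y0.0 = y0
        and \<delta> = \<delta> and \<epsilon> = "\<lambda>m. 1 / real (Suc m)",
        OF \<sigma> T cW cY cI W0 elim(2) eqT p(1) p(2) p(3) mesh \<delta>_lim J0 Jinc err2 lim_Suc herr cb cb',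
        folded L_def h'_def, folded y_def, folded d_def]
    show ?case
      using lims unfolding R_def X1_def X2_def L_def by blast
  qed
  have Ym: "(\<lambda>\<omega>. Y \<omega> t) \<in> borel_measurable (F t)" "(\<lambda>\<omega>. I \<omega> t) \<in> borel_measurable (F t)" if "0 \<le> t" for t
    using Y(1) Ic(1) that by (auto simp: adapted_def)
  have Lm: "(\<lambda>\<omega>. L \<omega> t) \<in> borel_measurable (F t)" if "0 \<le> t" for t
  proof -
    have [measurable]: "(\<lambda>\<omega>. \<omega> t) \<in> borel_measurable (F t)" by (rule measurable_coordinate_F[OF that order_refl])
    show ?thesis unfolding L_def by measurable
  qed
  have ym: "(\<lambda>\<omega>. y m \<omega> i) \<in> borel_measurable (F (p m i))" if "i \<le> r m" for m i
    unfolding y_def J_def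
    by (intro borel_measurable_add borel_measurable_diff Ym simple_integral_adapted[OF S] pT that)
  have dm: "(\<lambda>\<omega>. d m \<omega> i) \<in> borel_measurable (F (p m i))" if "i < r m" for m i
    unfolding d_def h_def
    by (intro borel_measurable_add borel_measurable_times borel_measurable_const ym less_imp_le[OF that]
        simple_process_measurable[OF S gap[OF that]])
  have a1m: "(\<lambda>\<omega>. L \<omega> (p m i) * y m \<omega> i) \<in> borel_measurable (F (p m i))" if "i < r m" for m i
    by (intro borel_measurable_times Lm ym pT less_imp_le[OF that])
  have a2m: "(\<lambda>\<omega>. L \<omega> (p m i) * d m \<omega> i) \<in> borel_measurable (F (p m i))" if "i < r m" for m i
    by (intro borel_measurable_times Lm dm pT less_imp_le[OF that] that)
  have \<phi>1m: "(\<lambda>w. inv_remainder \<sigma> q w - u) \<in> borel_measurable borel" for q u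
    unfolding inv_remainder_def by measurable
  have \<phi>2m: "(\<lambda>w. inv_linear \<sigma> q w - u) \<in> borel_measurable borel" for q u
    unfolding inv_linear_def by measurable
  have mom1: "has_bochner_integral Q (\<lambda>\<omega>. inv_remainder \<sigma> (h' m i) (\<omega> (p m (Suc i)) - \<omega> (p m i)) - c m i) 0"
    "integrable Q (\<lambda>\<omega>. (inv_remainder \<sigma> (h' m i) (\<omega> (p m (Suc i)) - \<omega> (p m i)) - c m i)\<^sup>2)"
    "Q.expectation (\<lambda>\<omega>. (inv_remainder \<sigma> (h' m i) (\<omega> (p m (Suc i)) - \<omega> (p m i)) - c m i)\<^sup>2) \<le> (\<sigma>\<^sup>2 * h' m i)\<^sup>2"
    if i: "i < r m" for m i
  proof -
    note mom = inv_remainder_moments[OF pT(1)[OF less_imp_le[OF i]] p(3)[OF i], of \<sigma>, folded h'_def, folded c_def]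
    note cen = centered_moments[OF mom]
    show "has_bochner_integral Q (\<lambda>\<omega>. inv_remainder \<sigma> (h' m i) (\<omega> (p m (Suc i)) - \<omega> (p m i)) - c m i) 0" by (rule cen(1))
    show "integrable Q (\<lambda>\<omega>. (inv_remainder \<sigma> (h' m i) (\<omega> (p m (Suc i)) - \<omega> (p m i)) - c m i)\<^sup>2)" by (rule cen(2))
    show "Q.expectation (\<lambda>\<omega>. (inv_remainder \<sigma> (h' m i) (\<omega> (p m (Suc i)) - \<omega> (p m i)) - c m i)\<^sup>2) \<le> (\<sigma>\<^sup>2 * h' m i)\<^sup>2"
      by (rule order_trans[OF cen(3) small2[OF h'0[OF i] h'\<rho>[OF i]]])
  qed
  have mom2: "has_bochner_integral Q (\<lambda>\<omega>. inv_linear \<sigma> (h' m i) (\<omega> (p m (Suc i)) - \<omega> (p m i)) - c' m i) 0"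
    "integrable Q (\<lambda>\<omega>. (inv_linear \<sigma> (h' m i) (\<omega> (p m (Suc i)) - \<omega> (p m i)) - c' m i)\<^sup>2)"
    "Q.expectation (\<lambda>\<omega>. (inv_linear \<sigma> (h' m i) (\<omega> (p m (Suc i)) - \<omega> (p m i)) - c' m i)\<^sup>2) \<le> 2 * h' m i"
    if i: "i < r m" for m i
  proof -
    note mom = inv_linear_moments[OF pT(1)[OF less_imp_le[OF i]] p(3)[OF i], of \<sigma>, folded h'_def, folded c'_def]
    note cen = centered_moments[OF mom]
    show "has_bochner_integral Q (\<lambda>\<omega>. inv_linear \<sigma> (h' m i) (\<omega> (p m (Suc i)) - \<omega> (p m i)) - c' m i) 0" by (rule cen(1))
    show "integrable Q (\<lambda>\<omega>. (inv_linear \<sigma> (h' m i) (\<omega> (p m (Suc i)) - \<omega> (p m i)) - c' m i)\<^sup>2)" by (rule cen(2))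
    have "0 \<le> h' m i" using p(3)[OF i] by (simp add: h'_def)
    then show "Q.expectation (\<lambda>\<omega>. (inv_linear \<sigma> (h' m i) (\<omega> (p m (Suc i)) - \<omega> (p m i)) - c' m i)\<^sup>2) \<le> 2 * h' m i"
      using cen(3) mult_right_mono[OF small4[OF h'0[OF i] h'\<rho>[OF i]], of "h' m i"] by linarith
  qed
  have p0: "0 \<le> p m 0" for m by (simp add: p)
  have v1: "0 < (\<sigma>\<^sup>2 * h' m i)\<^sup>2" if "i < r m" for m i by (rule zero_less_power[OF h'0[OF that]])
  have v2: "0 < 2 * h' m i" if "i < r m" for m i using p(3)[OF that] by (simp add: h'_def)
  have lim_a1: "AE \<omega> in P. (\<lambda>m. \<Sum>i<r m. (L \<omega> (p m i) * y m \<omega> i)\<^sup>2 * (\<sigma>\<^sup>2 * h' m i)\<^sup>2) \<longlonglongrightarrow> 0"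
    using path by eventually_elim blast
  have lim_a2: "AE \<omega> in P. (\<lambda>m. \<Sum>i<r m. (L \<omega> (p m i) * d m \<omega> i)\<^sup>2 * (2 * h' m i)) \<longlonglongrightarrow> 0"
    using path by eventually_elim blast
  have X1_lim: "(\<lambda>m. Q.prob {\<omega>\<in>path_space. \<exists>j\<le>r m. \<epsilon> < \<bar>X1 m \<omega> j\<bar>}) \<longlonglongrightarrow> 0" if \<epsilon>: "0 < \<epsilon>" for \<epsilon>
    unfolding X1_def
    by (rule martingale_sum_tendsto_0[where n = r and \<tau> = p and a = "\<lambda>m i \<omega>. L \<omega> (p m i) * y m \<omega> i"
          and \<phi> = "\<lambda>m i w. inv_remainder \<sigma> (h' m i) w - c m i" and v = "\<lambda>m i. (\<sigma>\<^sup>2 * h' m i)\<^sup>2",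
          OF p0 p(3) a1m \<phi>1m mom1(1) mom1(2) mom1(3) v1 lim_a1 \<epsilon>])
  have X2_lim: "(\<lambda>m. Q.prob {\<omega>\<in>path_space. \<exists>j\<le>r m. \<epsilon> < \<bar>X2 m \<omega> j\<bar>}) \<longlonglongrightarrow> 0" if \<epsilon>: "0 < \<epsilon>" for \<epsilon>
    unfolding X2_def
    by (rule martingale_sum_tendsto_0[where n = r and \<tau> = p and a = "\<lambda>m i \<omega>. L \<omega> (p m i) * d m \<omega> i"
          and \<phi> = "\<lambda>m i w. inv_linear \<sigma> (h' m i) w - c' m i" and v = "\<lambda>m i. 2 * h' m i",
          OF p0 p(3) a2m \<phi>2m mom2(1) mom2(2) mom2(3) v2 lim_a2 \<epsilon>])
  have cL: "continuous_on {0..} (L \<omega>)" if "\<omega> \<in> path_space" for \<omega>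
    using that unfolding L_def path_space_def by (auto intro!: continuous_intros)
  have pL: "progressively_measurable P L"
    by (rule progressively_measurable_continuous) (use Lm cL in \<open>auto simp: adapted_def continuous_process_def\<close>)
  have Rm: "R \<in> borel_measurable Q"
    unfolding R_def[abs_def]
    by (intro borel_measurable_diff borel_measurable_times borel_measurable_const measurable_F_Q[OF Ym(1)] measurable_F_Q[OF Lm]
        measurable_F_Q[OF adapted_primitive[OF progressively_measurable_mult[OF pL b]]] less_imp_le[OF T])
  have FQ: "f \<in> borel_measurable Q" if "f \<in> borel_measurable (F t)" for f :: "(real \<Rightarrow> real) \<Rightarrow> real" and t
    by (rule measurable_F_Q[OF that])
  have X1m: "(\<lambda>\<omega>. X1 m \<omega> j) \<in> borel_measurable Q" if "j \<le> r m" for m j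
    unfolding X1_def
  proof (intro borel_measurable_sum)
    fix i assume "i \<in> {..<j}"
    then have i: "i < r m" using that by simp
    show "(\<lambda>\<omega>. L \<omega> (p m i) * y m \<omega> i * (inv_remainder \<sigma> (h' m i) (\<omega> (p m (Suc i)) - \<omega> (p m i)) - c m i)) \<in> borel_measurable Q"
      by (rule borel_measurable_times[OF FQ[OF a1m[OF i]] FQ[OF increment_measurable_F[OF pT(1)[OF less_imp_le[OF i]] less_imp_le[OF p(3)[OF i]] \<phi>1m]]])
  qed
  have X2m: "(\<lambda>\<omega>. X2 m \<omega> j) \<in> borel_measurable Q" if "j \<le> r m" for m j
    unfolding X2_def
  proof (intro borel_measurable_sum)
    fix i assume "i \<in> {..<j}"
    then have i: "i < r m" using that by simp
    show "(\<lambda>\<omega>. L \<omega> (p m i) * d m \<omega> i * (inv_linear \<sigma> (h' m i) (\<omega> (p m (Suc i)) - \<omega> (p m i)) - c' m i)) \<in> borel_measurable Q"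
      by (rule borel_measurable_times[OF FQ[OF a2m[OF i]] FQ[OF increment_measurable_F[OF pT(1)[OF less_imp_le[OF i]] less_imp_le[OF p(3)[OF i]] \<phi>2m]]])
  qed
  \<comment> \<open>\<open>R\<close> does not depend on \<open>m\<close>, yet for each
    \<open>m\<close> it is a sum of three terms, each exceeding \<open>\<epsilon>\<close> with a
    probability that tends to 0. A constant sequence with limit 0 is 0.\<close>
  have null: "Q.prob {\<omega>\<in>space Q. 3 * \<epsilon> < \<bar>R \<omega>\<bar>} = 0" if \<epsilon>: "0 < \<epsilon>" for \<epsilon>
  proof -
    define B0 where "B0 m = {\<omega>\<in>space Q. \<epsilon> < \<bar>R \<omega> - X1 m \<omega> (r m) - X2 m \<omega> (r m)\<bar>}" for m
    define B1 where "B1 m = {\<omega>\<in>space Q. \<epsilon> < \<bar>X1 m \<omega> (r m)\<bar>}" for m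
    define B2 where "B2 m = {\<omega>\<in>space Q. \<epsilon> < \<bar>X2 m \<omega> (r m)\<bar>}" for m
    have B0s: "B0 m \<in> sets Q" for m
      unfolding B0_def by (intro borel_measurable_less borel_measurable_const borel_measurable_abs borel_measurable_diff Rm X1m X2m order_refl)
    have B1s: "B1 m \<in> sets Q" for m
      unfolding B1_def by (intro borel_measurable_less borel_measurable_const borel_measurable_abs X1m order_refl)
    have B2s: "B2 m \<in> sets Q" for m
      unfolding B2_def by (intro borel_measurable_less borel_measurable_const borel_measurable_abs X2m order_refl)
    have Ex_sets: "{\<omega>\<in>path_space. \<exists>j\<le>r m. \<epsilon> < \<bar>f \<omega> j\<bar>} \<in> sets Q"
      if "\<And>j. j \<le> r m \<Longrightarrow> (\<lambda>\<omega>. f \<omega> j) \<in> borel_measurable Q" for f :: "(real \<Rightarrow> real) \<Rightarrow> nat \<Rightarrow> real" and m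
    proof -
      have "{\<omega>\<in>space Q. \<exists>j\<in>{..r m}. \<epsilon> < \<bar>f \<omega> j\<bar>} \<in> sets Q"
        by (intro sets.sets_Collect_finite_Ex borel_measurable_less borel_measurable_const borel_measurable_abs that) auto
      moreover have "{\<omega>\<in>space Q. \<exists>j\<in>{..r m}. \<epsilon> < \<bar>f \<omega> j\<bar>} = {\<omega>\<in>path_space. \<exists>j\<le>r m. \<epsilon> < \<bar>f \<omega> j\<bar>}"
        by (auto simp: space_wiener)
      ultimately show ?thesis by (simp only:)
    qed
    have B0_lim: "(\<lambda>m. Q.prob (B0 m)) \<longlonglongrightarrow> 0"
    proof (rule prob_tendsto_0[OF B0s])
      show "AE \<omega> in P. \<forall>\<^sub>F m in sequentially. \<omega> \<notin> B0 m"
        using path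
      proof eventually_elim
        case (elim \<omega>)
        then have "(\<lambda>m. \<bar>R \<omega> - X1 m \<omega> (r m) - X2 m \<omega> (r m)\<bar>) \<longlonglongrightarrow> 0" by (intro tendsto_rabs_zero) blast
        from order_tendstoD(2)[OF this \<epsilon>] show ?case by eventually_elim (simp add: B0_def)
      qed
    qed
    have B1_lim: "(\<lambda>m. Q.prob (B1 m)) \<longlonglongrightarrow> 0"
      by (rule prob_subset_tendsto_0[OF always_eventually Ex_sets[OF X1m] X1_lim[OF \<epsilon>]]) (auto simp: B1_def space_wiener)
    have B2_lim: "(\<lambda>m. Q.prob (B2 m)) \<longlonglongrightarrow> 0"
      by (rule prob_subset_tendsto_0[OF always_eventually Ex_sets[OF X2m] X2_lim[OF \<epsilon>]]) (auto simp: B2_def space_wiener)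
    have "(\<lambda>m::nat. Q.prob {\<omega>\<in>space Q. 3 * \<epsilon> < \<bar>R \<omega>\<bar>}) \<longlonglongrightarrow> 0"
    proof (rule prob_subset_tendsto_0)
      show "(\<lambda>m. Q.prob ((B0 m \<union> B1 m) \<union> B2 m)) \<longlonglongrightarrow> 0"
        by (intro prob_Un_tendsto_0 sets.Un B0s B1s B2s B0_lim B1_lim B2_lim)
      show "(B0 m \<union> B1 m) \<union> B2 m \<in> sets Q" for m by (intro sets.Un B0s B1s B2s)
      show "\<forall>\<^sub>F m in sequentially. {\<omega>\<in>space Q. 3 * \<epsilon> < \<bar>R \<omega>\<bar>} \<subseteq> (B0 m \<union> B1 m) \<union> B2 m"
      proof (intro always_eventually allI subsetI)
        fix m \<omega> assume \<omega>: "\<omega> \<in> {\<omega>\<in>space Q. 3 * \<epsilon> < \<bar>R \<omega>\<bar>}"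
        then have "\<epsilon> < \<bar>R \<omega> - X1 m \<omega> (r m) - X2 m \<omega> (r m)\<bar> \<or> \<epsilon> < \<bar>X1 m \<omega> (r m)\<bar> \<or> \<epsilon> < \<bar>X2 m \<omega> (r m)\<bar>" by auto
        then show "\<omega> \<in> (B0 m \<union> B1 m) \<union> B2 m" using \<omega> unfolding B0_def B1_def B2_def by blast
      qed
    qed
    then show ?thesis by (simp add: LIMSEQ_const_iff)
  qed
  have "AE \<omega> in Q. \<forall>k. \<bar>R \<omega>\<bar> \<le> 3 * (1 / real (Suc k))"
    unfolding AE_all_countable
  proof
    fix k
    have s: "{\<omega>\<in>space Q. 3 * (1 / real (Suc k)) < \<bar>R \<omega>\<bar>} \<in> sets Q"
      by (intro borel_measurable_less borel_measurable_const borel_measurable_abs Rm)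
    have "Q.prob {\<omega>\<in>space Q. 3 * (1 / real (Suc k)) < \<bar>R \<omega>\<bar>} = 0" by (rule null) simp
    then have "{\<omega>\<in>space Q. 3 * (1 / real (Suc k)) < \<bar>R \<omega>\<bar>} \<in> null_sets Q"
      using s by (simp only: null_sets_def mem_Collect_eq Q.emeasure_eq_measure) simp
    from AE_not_in[OF this] show "AE \<omega> in Q. \<bar>R \<omega>\<bar> \<le> 3 * (1 / real (Suc k))"
      using AE_space by eventually_elim (simp only: mem_Collect_eq not_less simp_thms)
  qed
  then have "AE \<omega> in Q. R \<omega> = 0"
  proof eventually_elim
    case (elim \<omega>)
    have "(\<lambda>k. 3 * (1 / real (Suc k))) \<longlonglongrightarrow> 0"
      using tendsto_mult_right_zero[OF LIMSEQ_inverse_real_of_nat, of 3] by (simp add: inverse_eq_divide)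
    then have "\<bar>R \<omega>\<bar> \<le> 0" by (rule LIMSEQ_le_const) (use elim in blast)
    then show ?case by simp
  qed
  then have "AE \<omega> in P. R \<omega> = 0" by (simp only: AE_completion_iff)
  then show ?thesis by eventually_elim (simp add: R_def)
qed

end

section \<open>From fixed times to all times, and modification on null sets\<close>

lemma eq_on_nonneg_of_rationals:
  fixes f g :: "real \<Rightarrow> real"
  assumes f: "continuous_on {0..} f" and g: "continuous_on {0..} g"
    and eq: "\<And>q. q \<in> \<rat> \<Longrightarrow> 0 < q \<Longrightarrow> f q = g q" and t: "0 \<le> t"
  shows "f t = g t"
proof -
  \<comment> \<open>The approximation is from the right, so that \<open>t = 0\<close> is also
    reached through positive rationals.\<close>
  have "\<exists>q\<in>\<rat>. t < q \<and> q < t + 1 / real (Suc n)" for n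
    by (rule Rats_dense_in_real) simp
  then obtain q where q: "\<And>n. q n \<in> \<rat>" "\<And>n. t < q n" "\<And>n. q n < t + 1 / real (Suc n)" by metis
  have lim: "q \<longlonglongrightarrow> t"
  proof (rule tendsto_sandwich[OF _ _ tendsto_const])
    show "(\<lambda>n. t + 1 / real (Suc n)) \<longlonglongrightarrow> t"
      using tendsto_add[OF tendsto_const[of t] LIMSEQ_inverse_real_of_nat] by (simp add: inverse_eq_divide)
    show "\<forall>\<^sub>F n in sequentially. t \<le> q n" by (intro always_eventually allI less_imp_le q)
    show "\<forall>\<^sub>F n in sequentially. q n \<le> t + 1 / real (Suc n)" by (intro always_eventually allI less_imp_le q)
  qed
  have pos: "0 < q n" for n using q(2)[of n] t by linarith
  have ev: "\<forall>\<^sub>F n in sequentially. q n \<in> {0..}" using less_imp_le[OF pos] by (intro always_eventually allI) simp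
  have "(\<lambda>n. f (q n)) \<longlonglongrightarrow> f t" by (rule continuous_on_tendsto_compose[OF f lim _ ev]) (use t in simp)
  moreover have "(\<lambda>n. g (q n)) \<longlonglongrightarrow> g t" by (rule continuous_on_tendsto_compose[OF g lim _ ev]) (use t in simp)
  moreover have "(\<lambda>n. f (q n)) = (\<lambda>n. g (q n))" using eq q(1) pos by blast
  ultimately show ?thesis using LIMSEQ_unique by metis
qed

lemma inverse_exp_martingale: "1 / exp_martingale \<sigma> \<omega> t = exp (\<sigma> * \<omega> t + \<sigma>\<^sup>2 * t / 2)"
  by (simp add: exp_martingale_def exp_minus[symmetric] inverse_eq_divide[symmetric])

context wiener_measure
begin

text \<open>The exceptional null set of the fixed-time identity depends on the time. Positive
  rational times involve countably many null sets, and both sides are continuous in time.\<close>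

lemma quotient_exp_martingale:
  assumes \<sigma>: "0 < \<sigma>"
    and Y: "adapted P Y" "continuous_process Y"
    and b: "progressively_measurable P b"
    and b_int: "AE \<omega> in P. \<forall>T>0. set_integrable lborel {0..T} (b \<omega>)"
    and I: "ito_integral P (\<lambda>\<omega> s. - (\<sigma> * Y \<omega> s)) I"
    and eq: "AE \<omega> in P. \<forall>t\<ge>0. Y \<omega> t = y0 + primitive (b \<omega>) t + I \<omega> t"
  shows "AE \<omega> in P. \<forall>t\<ge>0. Y \<omega> t / exp_martingale \<sigma> \<omega> t
    = y0 + primitive (\<lambda>s. 1 / exp_martingale \<sigma> \<omega> s * b \<omega> s) t"
proof -
  define L where "L \<omega> t = 1 / exp_martingale \<sigma> \<omega> t" for \<omega> t
  have "AE \<omega> in P. \<forall>q\<in>{q\<in>\<rat>. 0 < q}. Y \<omega> q * L \<omega> q = y0 + primitive (\<lambda>s. L \<omega> s * b \<omega> s) q"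
  proof (subst AE_ball_countable)
    show "countable {q\<in>\<rat>. (0::real) < q}" by (rule countable_subset[OF _ countable_rat]) auto
    show "\<forall>q\<in>{q\<in>\<rat>. 0 < q}. AE \<omega> in P. Y \<omega> q * L \<omega> q = y0 + primitive (\<lambda>s. L \<omega> s * b \<omega> s) q"
    proof
      fix q :: real assume "q \<in> {q\<in>\<rat>. 0 < q}"
      then have q: "0 < q" by simp
      have "AE \<omega> in P. set_integrable lborel {0..q} (b \<omega>)"
        using b_int by eventually_elim (use q in blast)
      from quotient_fixed_time[OF \<sigma> q Y b this I eq]
      show "AE \<omega> in P. Y \<omega> q * L \<omega> q = y0 + primitive (\<lambda>s. L \<omega> s * b \<omega> s) q"
        unfolding L_def inverse_exp_martingale .
    qed
  qed
  then show ?thesis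
    using b_int AE_space
  proof eventually_elim
    case (elim \<omega>)
    from elim(3) have \<omega>: "\<omega> \<in> path_space" by (simp add: space_wiener)
    have cL: "continuous_on {0..} (L \<omega>)"
      unfolding L_def using \<omega> unfolding inverse_exp_martingale path_space_def by (auto intro!: continuous_intros)
    have f: "continuous_on {0..} (\<lambda>t. Y \<omega> t * L \<omega> t)"
      using Y(2) \<omega> by (intro continuous_on_mult cL) (simp add: continuous_process_def)
    have g: "continuous_on {0..} (\<lambda>t. y0 + primitive (\<lambda>s. L \<omega> s * b \<omega> s) t)"
    proof (intro continuous_on_add continuous_on_const continuous_on_primitive set_integrable_mult_continuous)
      fix T :: real assume "0 < T"
      then show "set_integrable lborel {0..T} (b \<omega>)" using elim(2) by blast
      show "continuous_on {0..T} (L \<omega>)" by (rule continuous_on_subset[OF cL]) auto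
    qed
    show ?case
    proof (intro allI impI)
      fix t :: real assume t: "0 \<le> t"
      have "Y \<omega> t * L \<omega> t = y0 + primitive (\<lambda>s. L \<omega> s * b \<omega> s) t"
        by (rule eq_on_nonneg_of_rationals[OF f g _ t]) (use elim(1) in blast)
      then show "Y \<omega> t / exp_martingale \<sigma> \<omega> t = y0 + primitive (\<lambda>s. 1 / exp_martingale \<sigma> \<omega> s * b \<omega> s) t"
        by (simp add: L_def)
    qed
  qed
qed

lemma progressively_measurable_drift:
  fixes X c :: "(real \<Rightarrow> real) \<Rightarrow> real \<Rightarrow> real" and \<alpha> \<mu> :: real
  assumes "progressively_measurable P X" "progressively_measurable P c"
  shows "progressively_measurable P (\<lambda>\<omega> t. X \<omega> t powr \<alpha> - \<mu> * X \<omega> t - c \<omega> t * X \<omega> t)"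
  unfolding progressively_measurable_def
proof safe
  fix t :: real assume t: "0 \<le> t"
  have [measurable]: "(\<lambda>(\<omega>, s). X \<omega> s) \<in> borel_measurable (F t \<Otimes>\<^sub>M restrict_space borel {0..t})"
      "(\<lambda>(\<omega>, s). c \<omega> s) \<in> borel_measurable (F t \<Otimes>\<^sub>M restrict_space borel {0..t})"
    using assms t by (auto simp: progressively_measurable_def)
  have "(\<lambda>p. (\<lambda>(\<omega>, s). X \<omega> s) p powr \<alpha> - \<mu> * (\<lambda>(\<omega>, s). X \<omega> s) p - (\<lambda>(\<omega>, s). c \<omega> s) p * (\<lambda>(\<omega>, s). X \<omega> s) p)
      \<in> borel_measurable (F t \<Otimes>\<^sub>M restrict_space borel {0..t})"
    by measurable
  then show "(\<lambda>(\<omega>, s). X \<omega> s powr \<alpha> - \<mu> * X \<omega> s - c \<omega> s * X \<omega> s) \<in> borel_measurable (F t \<Otimes>\<^sub>M restrict_space borel {0..t})"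
    by (simp add: split_beta')
qed

text \<open>The augmentation puts null sets into the filtration at every time, so a process may be
  redefined on one and remain adapted. This gives the solution regular paths even where
  \<open>c\<close> fails to be integrable.\<close>

lemma measurable_If_null:
  fixes f g :: "(real \<Rightarrow> real) \<Rightarrow> real"
  assumes N: "N \<in> null_sets P" and f: "f \<in> borel_measurable (F t)" and g: "g \<in> borel_measurable (F t)"
  shows "(\<lambda>\<omega>. if \<omega> \<in> N then f \<omega> else g \<omega>) \<in> borel_measurable (F t)"
proof (rule measurable_If[OF f g])
  have "N \<in> sets (F t)" by (rule null_sets_F[OF null_sets_completionI[OF N]])
  moreover have "{\<omega>\<in>space (F t). \<omega> \<in> N} = N" using sets.sets_into_space[OF calculation] by auto
  ultimately show "{\<omega>\<in>space (F t). \<omega> \<in> N} \<in> sets (F t)" by (simp only:)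
qed

end

section \<open>Existence, positivity and uniqueness for the stochastic equation\<close>

theorem proposition3p1:
  fixes P :: "(real \<Rightarrow> real) measure"
    and \<alpha> \<sigma> \<mu> x :: real
    and c :: "(real \<Rightarrow> real) \<Rightarrow> real \<Rightarrow> real"
  assumes "wiener_measure P"
    and "0 < \<alpha>" and "\<alpha> < 1" and "0 < \<sigma>" and "0 < \<mu>"
    and "c \<in> consumption_processes P"
    and "0 < x"
  defines "solution \<equiv> strong_solution P
      (\<lambda>\<omega> t y. y powr \<alpha> - \<mu> * y - c \<omega> t * y) (\<lambda>\<omega> t y. - (\<sigma> * y)) x"
  shows "\<exists>X. solution X \<and> (\<forall>Y. solution Y \<longrightarrow> indistinguishable P X Y) \<and>
           (AE \<omega> in P. \<forall>t\<ge>0. 0 < X \<omega> t)"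
proof -
  interpret wiener_measure P by fact
  interpret bernoulli_ode \<alpha> x by unfold_locales fact+
  have cp: "progressively_measurable P c" and c0: "\<And>\<omega> s. \<omega> \<in> path_space \<Longrightarrow> 0 \<le> s \<Longrightarrow> 0 \<le> c \<omega> s"
    and cfin: "AE \<omega> in P. \<forall>t>0. (\<integral>\<^sup>+ s\<in>{0..t}. ennreal (c \<omega> s) \<partial>lborel) < \<infinity>"
    using \<open>c \<in> consumption_processes P\<close> unfolding consumption_processes_def by blast+
  obtain N where N: "N \<in> null_sets P"
    and Nc: "\<And>\<omega> t. \<omega> \<in> path_space \<Longrightarrow> \<omega> \<notin> N \<Longrightarrow> 0 < t \<Longrightarrow> (\<integral>\<^sup>+ s\<in>{0..t}. ennreal (c \<omega> s) \<partial>lborel) < \<infinity>"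
  proof -
    obtain N where N: "N \<in> null_sets P" "{\<omega>\<in>space P. \<not> (\<forall>t>0. (\<integral>\<^sup>+ s\<in>{0..t}. ennreal (c \<omega> s) \<partial>lborel) < \<infinity>)} \<subseteq> N"
      using cfin unfolding eventually_ae_filter by blast
    show ?thesis by (rule that[OF N(1)]) (use N(2) in \<open>unfold space_wiener, blast\<close>)
  qed
  have AE_good: "AE \<omega> in P. \<omega> \<in> path_space \<and> \<omega> \<notin> N"
    using AE_not_in[OF N] AE_space by eventually_elim (simp add: space_wiener)
  have c_int: "set_integrable lborel {0..T} (c \<omega>)" if "\<omega> \<in> path_space" "\<omega> \<notin> N" "0 < T" for \<omega> T
    unfolding set_integrable_def
  proof (rule integrableI_nonneg)
    show "(\<lambda>s. indicator {0..T} s *\<^sub>R c \<omega> s) \<in> borel_measurable lborel"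
      using progressive_section[OF cp that(1) less_imp_le[OF that(3)]] by simp
    show "AE s in lborel. 0 \<le> indicator {0..T} s *\<^sub>R c \<omega> s"
      using c0[OF that(1)] by (intro AE_I2) (auto simp: indicator_def)
    have "(\<integral>\<^sup>+ s. ennreal (indicator {0..T} s *\<^sub>R c \<omega> s) \<partial>lborel) = (\<integral>\<^sup>+ s\<in>{0..T}. ennreal (c \<omega> s) \<partial>lborel)"
      by (rule nn_integral_cong) (auto simp: indicator_def)
    then show "(\<integral>\<^sup>+ s. ennreal (indicator {0..T} s *\<^sub>R c \<omega> s) \<partial>lborel) < \<infinity>" using Nc[OF that] by (simp only:)
  qed
  define M where "M = exp_martingale \<sigma>"
  have M0: "0 < M \<omega> t" for \<omega> t unfolding M_def by (rule exp_martingale_pos)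
  have cM: "continuous_on {0..} (M \<omega>)" if "\<omega> \<in> path_space" for \<omega>
    unfolding M_def by (rule continuous_exp_martingale[OF that])
  have Mm: "(\<lambda>\<omega>. M \<omega> t) \<in> borel_measurable (F t)" if "0 \<le> t" for t
    unfolding M_def by (rule exp_martingale_adapted[OF that])
  define A where "A \<omega> = amplitude \<mu> (c \<omega>) (M \<omega>)" for \<omega>
  \<comment> \<open>\<open>strong_solution\<close> demands continuity and nonnegativity of every
    path, while the explicit formula is justified only off \<open>N\<close>. The value
    \<open>x\<close> on \<open>N\<close> keeps \<open>G\<close> continuous and positive
    there.\<close>
  define G where "G \<omega> t = (if \<omega> \<in> N then x else A \<omega> t)" for \<omega> t
  define X where "X \<omega> t = M \<omega> t * G \<omega> t" for \<omega> t
  define b where "b \<omega> s = X \<omega> s powr \<alpha> - \<mu> * X \<omega> s - c \<omega> s * X \<omega> s" for \<omega> s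
  \<comment> \<open>The integral is what the equation forces it to be. On \<open>N\<close> it is set
    to 0, because there the primitive of the drift need not be continuous.\<close>
  define I where "I \<omega> t = (if \<omega> \<in> N then 0 else X \<omega> t - x - primitive (b \<omega>) t)" for \<omega> t
  \<comment> \<open>The value 1 on \<open>N\<close> makes this density continuous on every path,
    hence progressively measurable, so that its primitive is adapted.\<close>
  define dens' where "dens' \<omega> s = (if \<omega> \<in> N then 1 else (M \<omega> s * damping \<mu> (c \<omega>) s) powr (\<alpha> - 1))" for \<omega> s
  have cA: "continuous_on {0..} (A \<omega>)" if "\<omega> \<in> path_space" "\<omega> \<notin> N" for \<omega>
    unfolding A_def by (rule continuous_amplitude[OF cM[OF that(1)] M0 c_int[OF that]])
  have Apos: "0 < A \<omega> t" if "\<omega> \<in> path_space" "\<omega> \<notin> N" "0 \<le> t" for \<omega> t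
    unfolding A_def by (rule amplitude_pos[OF cM[OF that(1)] M0 c_int[OF that(1,2)] that(3)])
  have dens_cont: "continuous_process dens'"
    unfolding continuous_process_def
  proof
    fix \<omega> assume \<omega>: "\<omega> \<in> path_space"
    show "continuous_on {0..} (dens' \<omega>)"
    proof (cases "\<omega> \<in> N")
      case True
      then show ?thesis by (simp add: dens'_def[abs_def])
    next
      case False
      then have "dens' \<omega> = (\<lambda>s. (M \<omega> s * damping \<mu> (c \<omega>) s) powr (\<alpha> - 1))" by (simp add: dens'_def[abs_def])
      then show ?thesis using continuous_dens[OF cM[OF \<omega>] M0 c_int[OF \<omega> False]] by (simp only:)
    qed
  qed
  have damp_m: "(\<lambda>\<omega>. damping \<mu> (c \<omega>) t) \<in> borel_measurable (F t)" if t: "0 \<le> t" for t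
  proof -
    have "progressively_measurable P (\<lambda>\<omega> s. - (\<mu> + c \<omega> s))"
      unfolding progressively_measurable_def
    proof safe
      fix t :: real assume "0 \<le> t"
      then have "(\<lambda>p. - (\<mu> + (\<lambda>(\<omega>, s). c \<omega> s) p)) \<in> borel_measurable (F t \<Otimes>\<^sub>M restrict_space borel {0..t})"
        using cp by (intro borel_measurable_uminus borel_measurable_add borel_measurable_const)
          (simp add: progressively_measurable_def)
      then show "(\<lambda>(\<omega>, s). - (\<mu> + c \<omega> s)) \<in> borel_measurable (F t \<Otimes>\<^sub>M restrict_space borel {0..t})"
        by (simp add: split_beta')
    qed
    from adapted_primitive[OF this t] show ?thesis
      unfolding damping_def by (rule measurable_compose) simp
  qed
  have dens_ad: "adapted P dens'"
    unfolding adapted_def dens'_def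
  proof (intro allI impI measurable_If_null[OF N] borel_measurable_const)
    fix t :: real assume t: "0 \<le> t"
    have [measurable]: "(\<lambda>\<omega>. M \<omega> t) \<in> borel_measurable (F t)" "(\<lambda>\<omega>. damping \<mu> (c \<omega>) t) \<in> borel_measurable (F t)"
      using Mm[OF t] damp_m[OF t] by auto
    show "(\<lambda>\<omega>. (M \<omega> t * damping \<mu> (c \<omega>) t) powr (\<alpha> - 1)) \<in> borel_measurable (F t)" by measurable
  qed
  have G_ad: "adapted P G"
    unfolding adapted_def
  proof (intro allI impI)
    fix t :: real assume t: "0 \<le> t"
    have [measurable]: "(\<lambda>\<omega>. damping \<mu> (c \<omega>) t) \<in> borel_measurable (F t)"
      "(\<lambda>\<omega>. primitive (dens' \<omega>) t) \<in> borel_measurable (F t)"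
      using damp_m[OF t] adapted_primitive[OF progressively_measurable_continuous[OF dens_ad dens_cont] t] by auto
    have "(\<lambda>\<omega>. damping \<mu> (c \<omega>) t * (x powr (1 - \<alpha>) + (1 - \<alpha>) * primitive (dens' \<omega>) t) powr (1 / (1 - \<alpha>))) \<in> borel_measurable (F t)"
      by measurable
    from measurable_If_null[OF N borel_measurable_const[of x] this]
    have "(\<lambda>\<omega>. if \<omega> \<in> N then x else damping \<mu> (c \<omega>) t * (x powr (1 - \<alpha>) + (1 - \<alpha>) * primitive (dens' \<omega>) t) powr (1 / (1 - \<alpha>))) \<in> borel_measurable (F t)" .
    also have "(\<lambda>\<omega>. if \<omega> \<in> N then x else damping \<mu> (c \<omega>) t * (x powr (1 - \<alpha>) + (1 - \<alpha>) * primitive (dens' \<omega>) t) powr (1 / (1 - \<alpha>)))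
      = (\<lambda>\<omega>. G \<omega> t)"
      \<comment> \<open>Off \<open>N\<close> the modified density is the one inside
        \<open>amplitude\<close>; on \<open>N\<close> the outer conditional already decides the
        value.\<close>
      by (rule ext) (simp add: G_def A_def amplitude_def flow_def dens'_def[abs_def])
    finally show "(\<lambda>\<omega>. G \<omega> t) \<in> borel_measurable (F t)" .
  qed
  have G_cont: "continuous_process G"
    unfolding continuous_process_def
  proof
    fix \<omega> assume \<omega>: "\<omega> \<in> path_space"
    show "continuous_on {0..} (G \<omega>)"
      by (cases "\<omega> \<in> N") (simp_all add: G_def[abs_def] cA[OF \<omega>])
  qed
  have X_cont: "continuous_process X"
    using G_cont cM unfolding continuous_process_def X_def[abs_def] by (auto intro: continuous_on_mult)
  have X_ad: "adapted P X"
    using G_ad Mm unfolding adapted_def X_def by (auto intro: borel_measurable_times)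
  have X_prog: "progressively_measurable P X" by (rule progressively_measurable_continuous[OF X_ad X_cont])
  have X_pos: "0 < X \<omega> t" if "\<omega> \<in> path_space" "0 \<le> t" for \<omega> t
    using M0[of \<omega> t] Apos[OF that(1) _ that(2)] x by (simp add: X_def G_def)
  have b_prog: "progressively_measurable P b"
    unfolding b_def by (rule progressively_measurable_drift[OF X_prog cp])
  \<comment> \<open>The density supplied by \<open>amplitude_eq\<close>. Off \<open>N\<close> it
    satisfies \<open>M * g = b\<close>, which also yields integrability of the drift, as
    \<open>M\<close> is continuous and \<open>g\<close> integrable.\<close>
  define g where "g \<omega> s = damping \<mu> (c \<omega>) s * ((M \<omega> s * damping \<mu> (c \<omega>) s) powr (\<alpha> - 1)
      * flow (\<lambda>s. (M \<omega> s * damping \<mu> (c \<omega>) s) powr (\<alpha> - 1)) s powr \<alpha>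
      + (- (\<mu> + c \<omega> s)) * flow (\<lambda>s. (M \<omega> s * damping \<mu> (c \<omega>) s) powr (\<alpha> - 1)) s)" for \<omega> s
  have g: "set_integrable lborel {0..T} (g \<omega>)" "G \<omega> T = x + primitive (g \<omega>) T" "M \<omega> T * g \<omega> T = b \<omega> T"
    if \<omega>: "\<omega> \<in> path_space" "\<omega> \<notin> N" and T: "0 \<le> T" for \<omega> T
  proof -
    note eq = amplitude_eq[OF cM[OF \<omega>(1)] M0 c_int[OF \<omega>] T, of \<mu>, folded g_def]
    show "set_integrable lborel {0..T} (g \<omega>)" using eq(1) unfolding g_def .
    show "G \<omega> T = x + primitive (g \<omega>) T" using eq(2) \<omega>(2) unfolding g_def G_def A_def by simp
    show "M \<omega> T * g \<omega> T = b \<omega> T" using eq(3) \<omega>(2) unfolding g_def b_def X_def G_def A_def by simp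
  qed
  have b_int: "set_integrable lborel {0..T} (b \<omega>)" if \<omega>: "\<omega> \<in> path_space" "\<omega> \<notin> N" and T: "0 \<le> T" for \<omega> T
  proof -
    have "set_integrable lborel {0..T} (\<lambda>s. M \<omega> s * g \<omega> s)"
      by (rule set_integrable_mult_continuous[OF g(1)[OF \<omega> T] continuous_on_subset[OF cM[OF \<omega>(1)]]]) auto
    also have "set_integrable lborel {0..T} (\<lambda>s. M \<omega> s * g \<omega> s) = set_integrable lborel {0..T} (b \<omega>)"
      by (rule set_integrable_cong) (use g(3)[OF \<omega>] in auto)
    finally show ?thesis .
  qed
  have I_ad: "adapted P I"
    unfolding adapted_def I_def
    by (intro allI impI measurable_If_null[OF N] borel_measurable_const borel_measurable_diff adapted_primitive[OF b_prog])
      (use X_ad in \<open>auto simp: adapted_def\<close>)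
  have I_cont: "continuous_process I"
    unfolding continuous_process_def
  proof
    fix \<omega> assume \<omega>: "\<omega> \<in> path_space"
    show "continuous_on {0..} (I \<omega>)"
    proof (cases "\<omega> \<in> N")
      case True
      then show ?thesis by (simp add: I_def[abs_def])
    next
      case False
      have "continuous_on {0..} (\<lambda>t. X \<omega> t - x - primitive (b \<omega>) t)"
        using X_cont \<omega> by (intro continuous_on_diff continuous_on_const continuous_on_primitive b_int[OF \<omega> False])
          (auto simp: continuous_process_def)
      then show ?thesis using False by (simp add: I_def[abs_def])
    qed
  qed
  have ito: "ito_integral P (\<lambda>\<omega> s. - (\<sigma> * X \<omega> s)) I"
    unfolding X_def M_def
  proof (rule ito_integral_exp_martingale_product[OF \<open>0 < \<sigma>\<close> G_ad G_cont _ I_ad I_cont, where g = g])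
    show "AE \<omega> in P. \<forall>T\<ge>0. set_integrable lborel {0..T} (g \<omega>) \<and> G \<omega> T = G \<omega> 0 + primitive (g \<omega>) T"
      using AE_good
    proof eventually_elim
      case (elim \<omega>)
      have "G \<omega> 0 = x" using g(2)[of \<omega> 0] elim by simp
      then show ?case using g(1,2)[of \<omega>] elim by simp
    qed
    show "AE \<omega> in P. \<forall>t\<ge>0. I \<omega> t = exp_martingale \<sigma> \<omega> t * G \<omega> t - G \<omega> 0 - primitive (\<lambda>s. exp_martingale \<sigma> \<omega> s * g \<omega> s) t"
      using AE_good
    proof eventually_elim
      case (elim \<omega>)
      have G0: "G \<omega> 0 = x" using g(2)[of \<omega> 0] elim by simp
      show ?case
      proof (intro allI impI)
        fix t :: real assume "0 \<le> t"
        have "primitive (\<lambda>s. M \<omega> s * g \<omega> s) t = primitive (b \<omega>) t"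
          by (rule primitive_cong) (use g(3) elim in auto)
        then show "I \<omega> t = exp_martingale \<sigma> \<omega> t * G \<omega> t - G \<omega> 0 - primitive (\<lambda>s. exp_martingale \<sigma> \<omega> s * g \<omega> s) t"
          using elim G0 unfolding I_def X_def M_def by simp
      qed
    qed
  qed
  have "solution X"
    unfolding solution_def strong_solution_def b_def[symmetric] primitive_def[symmetric]
  proof (intro conjI exI[of _ I])
    show "\<forall>\<omega>\<in>path_space. \<forall>t\<ge>0. 0 \<le> X \<omega> t" using X_pos by (simp add: less_imp_le)
    show "AE \<omega> in P. \<forall>t>0. set_integrable lborel {0..t} (b \<omega>)"
      using AE_good by eventually_elim (use b_int in auto)
    show "AE \<omega> in P. \<forall>t\<ge>0. X \<omega> t = x + primitive (b \<omega>) t + I \<omega> t"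
      using AE_good by eventually_elim (simp add: I_def)
  qed (fact X_cont X_ad ito)+
  moreover have "indistinguishable P X Y" if "solution Y" for Y
  proof -
    define bY where "bY \<omega> s = Y \<omega> s powr \<alpha> - \<mu> * Y \<omega> s - c \<omega> s * Y \<omega> s" for \<omega> s
    note sol = that[unfolded solution_def strong_solution_def, folded bY_def primitive_def]
    then have Y: "adapted P Y" "continuous_process Y" and Y0: "\<And>\<omega> t. \<omega> \<in> path_space \<Longrightarrow> 0 \<le> t \<Longrightarrow> 0 \<le> Y \<omega> t"
      and bY_int: "AE \<omega> in P. \<forall>t>0. set_integrable lborel {0..t} (bY \<omega>)"
      by blast+
    from sol obtain J where J: "ito_integral P (\<lambda>\<omega> s. - (\<sigma> * Y \<omega> s)) J"
      and eqJ: "AE \<omega> in P. \<forall>t\<ge>0. Y \<omega> t = x + primitive (bY \<omega>) t + J \<omega> t"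
      by blast
    have bY_prog: "progressively_measurable P bY"
      unfolding bY_def by (rule progressively_measurable_drift[OF progressively_measurable_continuous[OF Y] cp])
    \<comment> \<open>Division by \<open>M\<close> removes the noise from the equation of an
      arbitrary solution. On almost every path a deterministic equation remains, and its only
      solution is the one used to build \<open>X\<close>.\<close>
    have "AE \<omega> in P. \<forall>t\<ge>0. Y \<omega> t / M \<omega> t = x + primitive (\<lambda>s. 1 / M \<omega> s * bY \<omega> s) t"
      unfolding M_def by (rule quotient_exp_martingale[OF \<open>0 < \<sigma>\<close> Y bY_prog bY_int J eqJ])
    then show ?thesis
      unfolding indistinguishable_def
      using AE_good bY_int
    proof eventually_elim
      case (elim \<omega>)
      then have \<omega>: "\<omega> \<in> path_space" "\<omega> \<notin> N" by auto
      have "Y \<omega> T = M \<omega> T * amplitude \<mu> (c \<omega>) (M \<omega>) T" if T: "0 \<le> T" for T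
      proof (rule amplitude_unique[OF cM[OF \<omega>(1)] M0 c_int[OF \<omega>] _ Y0[OF \<omega>(1)] _ _ T])
        show "continuous_on {0..} (Y \<omega>)" using Y(2) \<omega>(1) by (simp add: continuous_process_def)
        show "set_integrable lborel {0..T} (\<lambda>s. Y \<omega> s powr \<alpha> - \<mu> * Y \<omega> s - c \<omega> s * Y \<omega> s)" if "0 < T" for T
          using elim(3) that unfolding bY_def by blast
        show "Y \<omega> t / M \<omega> t = x + primitive (\<lambda>s. 1 / M \<omega> s * (Y \<omega> s powr \<alpha> - \<mu> * Y \<omega> s - c \<omega> s * Y \<omega> s)) t"
          if "0 \<le> t" for t
          using elim(1) that unfolding bY_def by blast
      qed
      then show ?case using \<omega>(2) by (simp add: X_def G_def A_def)
    qed
  qed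
  moreover have "AE \<omega> in P. \<forall>t\<ge>0. 0 < X \<omega> t"
    using AE_good by eventually_elim (use X_pos in blast)
  ultimately show ?thesis by blast
qed

end
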